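(* Let $\Omega\subset\mathbb{R}^d$ be a bounded Lipschitz domain, let $R>0$ be such that $\delta_\Omega(x)<R$ for all $x\in\Omega$, and let $\beta>1$. (i) There exists a constant $C=C(d,\Omega,\beta)>0$ (depending only on $d,\Omega,\beta$) such that for every integer $m\ge1$ and all $u\in BV(\Omega)$, $$\int_\Omega\frac{|u(x)-(u)_\Omega|}{\delta_\Omega(x)}\,\mathcal{L}_1\!\left(\frac{\delta_\Omega(x)}{R}\right)\cdots\mathcal{L}_{m-1}\!\left(\frac{\delta_\Omega(x)}{R}\right)\mathcal{L}_m^\beta\!\left(\frac{\delta_\Omega(x)}{R}\right)dx\le C2^m[u]_{BV(\Omega)},$$ with the convention that for $m=1$ the product of $\mathcal{L}$-factors is just $\mathcal{L}_1^\beta\left(\frac{\delta_\Omega(x)}{R}\right)$. (ii) For any $0<\alpha<\frac12$, there exists a constant $C=C(d,\Omega,\beta)>0$ (depending only on $d,\Omega,\beta$) such that for all $u\in BV(\Omega)$, $$\sum_{m=2}^\infty\alpha^m\int_\Omega\frac{|u(x)-(u)_\Omega|}{\delta_\Omega(x)}\,\mathcal{L}_1\!\left(\frac{\delta_\Omega(x)}{R}\right)\cdots\mathcal{L}_{m-1}\!\left(\frac{\delta_\Omega(x)}{R}\right)\mathcal{L}_m^\beta\!\left(\frac{\delta_\Omega(x)}{R}\right)dx\le C\left(\frac{4\alpha^2}{1-2\alpha}\right)[u]_{BV(\Omega)}.$$ (iii) The series inequality in (ii) fails whenever $\alpha\ge1$ or $0<\beta\le1$: for $\alpha>0$ and $\beta>0$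 with $\alpha\ge1$ or $\beta\le1$, there is no finite constant $C'$ such that the left-hand side of the inequality in (ii) is at most $C'[u]_{BV(\Omega)}$ for all $u\in BV(\Omega)$.
   Context: For a bounded domain $\Omega\subset\mathbb{R}^d$, $d\ge1$, $\delta_\Omega(x)=\min_{y\in\partial\Omega}|x-y|$ is the distance to the boundary. The functions $\mathcal{L}_m$ are defined on $(0,1)$ by $\mathcal{L}_1(t)=\frac{1}{1-\ln t}$ and recursively $\mathcal{L}_m(t)=\mathcal{L}_1(\mathcal{L}_{m-1}(t))$ for $m\ge2$; $\mathcal{L}_m^\beta(t)$ means $(\mathcal{L}_m(t))^\beta$. A function $u\in L^1(\Omega)$ belongs to $BV(\Omega)$ if $[u]_{BV(\Omega)}:=\sup\{\int_\Omega u\,\mathrm{div}(\phi)\,dx:\phi\in C_c^1(\Omega;\mathbb{R}^d),\ |\phi(x)|\le1\text{ on }\Omega\}<\infty$. The average of $u$ is $(u)_\Omega=\frac1{|\Omega|}\int_\Omega u(y)\,dy$. *)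

theory Defs
  imports "HOL-Analysis.Analysis"
begin

text \<open>
  \<open>x\<close> splits into its component \<open>e \<bullet> x\<close> along the unit vector \<open>e\<close> and its projection onto the
  hyperplane orthogonal to \<open>e\<close>; up to a rotation this is the usual splitting
  \<open>\<real>\<^sup>d = \<real>\<^sup>d\<^sup>-\<^sup>1 \<times> \<real>\<close>. In dimension one the hyperplane is \<open>{0}\<close>.
\<close>
definition lipschitz_boundary :: "'a::euclidean_space set \<Rightarrow> bool" where
  "lipschitz_boundary \<Omega> \<longleftrightarrow>
     (\<forall>z\<in>frontier \<Omega>. \<exists>r>0. \<exists>(e::'a) (\<gamma>::'a \<Rightarrow> real) L.
        norm e = 1 \<and> L-lipschitz_on {y. e \<bullet> y = 0} \<gamma> \<and>
        \<Omega> \<inter> ball z r = {x \<in> ball z r. e \<bullet> x < \<gamma> (x - (e \<bullet> x) *\<^sub>R e)})"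

definition bounded_lipschitz_domain :: "'a::euclidean_space set \<Rightarrow> bool" where
  "bounded_lipschitz_domain \<Omega> \<longleftrightarrow>
     open \<Omega> \<and> connected \<Omega> \<and> \<Omega> \<noteq> {} \<and> bounded \<Omega> \<and> lipschitz_boundary \<Omega>"

text \<open>For bounded nonempty open \<open>\<Omega>\<close> the frontier is compact and nonempty, so the infimum is a minimum.\<close>
definition bdist :: "'a::euclidean_space set \<Rightarrow> 'a \<Rightarrow> real" where
  "bdist \<Omega> x = infdist x (frontier \<Omega>)"

definition L1 :: "real \<Rightarrow> real" where
  "L1 t = 1 / (1 - ln t)"

text \<open>Only indices \<open>m \<ge> 1\<close> and arguments in \<open>(0,1)\<close>, which \<^const>\<open>L1\<close> maps into itself, are used.\<close>
definition Lm :: "nat \<Rightarrow> real \<Rightarrow> real" where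
  "Lm m = L1 ^^ m"

definition divergence :: "('a::euclidean_space \<Rightarrow> 'a) \<Rightarrow> 'a \<Rightarrow> real" where
  "divergence \<phi> x = (\<Sum>b\<in>Basis. frechet_derivative \<phi> (at x) b \<bullet> b)"

text \<open>
  The fields in \<open>C\<^sub>c\<^sup>1(\<Omega>; \<real>\<^sup>d)\<close> bounded by one, identified with their extensions by zero to the
  whole space.
\<close>
definition test_fields :: "'a::euclidean_space set \<Rightarrow> ('a \<Rightarrow> 'a) set" where
  "test_fields \<Omega> =
     {\<phi>. \<phi> differentiable_on UNIV \<and>
         (\<forall>b\<in>Basis. continuous_on UNIV (\<lambda>x. frechet_derivative \<phi> (at x) b)) \<and>
         compact (closure {x. \<phi> x \<noteq> 0}) \<and> closure {x. \<phi> x \<noteq> 0} \<subseteq> \<Omega> \<and>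
         (\<forall>x\<in>\<Omega>. norm (\<phi> x) \<le> 1)}"

text \<open>The supremum is nonnegative, since the zero field is admissible, so \<^const>\<open>e2ennreal\<close> does not change it.\<close>
definition bv_seminorm :: "'a::euclidean_space set \<Rightarrow> ('a \<Rightarrow> real) \<Rightarrow> ennreal" where
  "bv_seminorm \<Omega> u =
     e2ennreal (SUP \<phi>\<in>test_fields \<Omega>. ereal (\<integral>x. u x * divergence \<phi> x \<partial>lebesgue_on \<Omega>))"

definition BV :: "'a::euclidean_space set \<Rightarrow> ('a \<Rightarrow> real) set" where
  "BV \<Omega> = {u. integrable (lebesgue_on \<Omega>) u \<and> bv_seminorm \<Omega> u < \<infinity>}"

definition average :: "'a::euclidean_space set \<Rightarrow> ('a \<Rightarrow> real) \<Rightarrow> real" where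
  "average \<Omega> u = (\<integral>y. u y \<partial>lebesgue_on \<Omega>) / measure lebesgue \<Omega>"

text \<open>An extended nonnegative integral: no integrability is presupposed, and divergence gives \<open>\<infinity>\<close>.\<close>
definition hardy_integral ::
    "'a::euclidean_space set \<Rightarrow> real \<Rightarrow> real \<Rightarrow> nat \<Rightarrow> ('a \<Rightarrow> real) \<Rightarrow> ennreal" where
  "hardy_integral \<Omega> R \<beta> m u =
     (\<integral>\<^sup>+x. ennreal (\<bar>u x - average \<Omega> u\<bar> / bdist \<Omega> x *
        (\<Prod>i\<in>{1..<m}. Lm i (bdist \<Omega> x / R)) * Lm m (bdist \<Omega> x / R) powr \<beta>) \<partial>lebesgue_on \<Omega>)"

text \<open>The sum over \<open>m \<ge> 2\<close>, with the index shifted to start at \<open>0\<close>.\<close>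
definition hardy_series ::
    "'a::euclidean_space set \<Rightarrow> real \<Rightarrow> real \<Rightarrow> real \<Rightarrow> ('a \<Rightarrow> real) \<Rightarrow> ennreal" where
  "hardy_series \<Omega> R \<beta> \<alpha> u =
     (\<Sum>m. ennreal (\<alpha> ^ (m + 2)) * hardy_integral \<Omega> R \<beta> (m + 2) u)"

end

(* The weight (1/t) L_1(t) ... L_{m-1}(t) L_m(t)^beta is the derivative of L_m(t)^(beta-1)/(beta-1), so
   for beta > 1 its integral over (0,1) is at most 1/(beta-1) uniformly in m. It therefore suffices to
   bound the integral of |u - c| w(delta/R)/delta for an increasing weight w <= 1 by the total variation
   times 1 + (integral of w(t)/t).

   No approximation of BV functions is needed. If F(x) = int_0^1 f(x + s h) ds, then F h is an
   admissible field up to scaling, with divergence f(x + h) - f(x). Hence, by duality, u(x) - u(x - h)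
   is bounded in any weighted L^1 norm whose weight has bounded integral along lines in direction h.
   With weight one this gives the Poincare inequality on balls, and chaining of balls gives it on
   compact subsets of the domain. Near a boundary point, with h pointing along the axis of the graph,
   delta is comparable to the vertical distance from the graph, so the weight w(delta/R)/delta is
   integrable on vertical lines; averaging over h moves the remaining term into a compact subset.

   For (iii) a linear function u(x) = b . x works: it stays away from its average near some boundary
   point, and near that point the same vertical lines bound the integral of w(delta/R)/delta from
   below by a multiple of the one-dimensional integral of w(t)/t near 0. *)
theory Submission imports Defs
begin

section \<open>Continuously differentiable functions\<close>


text \<open>The constants must not depend on \<open>R\<close>. Two facts secure this: every
  admissible \<open>R\<close> exceeds the value of delta at one fixed point, so charts can be sized
  once and for all with heights below \<open>R\<close>; and dt/t is invariant under scaling, so the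
  integral of w(h/R)/h along a vertical line is at most the mass of w(t)/t, whatever
  \<open>R\<close> is.

  Weights are increasing because delta is only comparable to the graph height h: from delta <= h <=
  L delta, monotonicity gives w(delta/R)/delta <= L w(h/R)/h without any doubling property of w.

  The constant c is a value u(x), picked by averaging over a small ball; it depends on u but on no
  weight. The passage to the mean over the domain uses the same inequality once more for w(t) = t,
  whose density w(delta/R)/delta is the constant 1/R.

  For alpha >= 1 in (iii) the lower bound has to be uniform in m. It comes from L_m(t) >= t, which
  keeps the mass of the weights near 0 away from zero.\<close>

definition C1_grad :: "('a::euclidean_space \<Rightarrow> real) \<Rightarrow> ('a \<Rightarrow> 'a) \<Rightarrow> bool" where
  "C1_grad f g \<longleftrightarrow> (\<forall>x. (f has_derivative (\<lambda>h. g x \<bullet> h)) (at x)) \<and> continuous_on UNIV g"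

definition C1 :: "('a::euclidean_space \<Rightarrow> real) \<Rightarrow> bool" where
  "C1 f \<longleftrightarrow> (\<exists>g. C1_grad f g)"

lemma C1_grad_continuous: "C1_grad f g \<Longrightarrow> continuous_on UNIV f"
  unfolding C1_grad_def
  by (meson continuous_at_imp_continuous_on has_derivative_continuous)

lemma C1_continuous: "C1 f \<Longrightarrow> continuous_on UNIV f"
  by (auto simp: C1_def dest: C1_grad_continuous)

lemma C1_const: "C1 (\<lambda>x. c)"
  unfolding C1_def C1_grad_def by (intro exI[of _ "\<lambda>x. 0"]) (auto intro!: continuous_intros derivative_eq_intros)

lemma C1_bounded_linear:
  assumes "bounded_linear f"
  shows "C1 f"
proof -
  have "f h = (\<Sum>b\<in>Basis. f b *\<^sub>R b) \<bullet> h" for h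
  proof -
    have "f h = f (\<Sum>b\<in>Basis. (h \<bullet> b) *\<^sub>R b)" by (simp add: euclidean_representation)
    also have "\<dots> = (\<Sum>b\<in>Basis. (h \<bullet> b) * f b)"
      using assms by (simp add: linear_sum linear_scale bounded_linear.linear)
    finally show ?thesis by (simp add: inner_sum_right inner_commute mult.commute)
  qed
  then have "f = (\<lambda>h. (\<Sum>b\<in>Basis. f b *\<^sub>R b) \<bullet> h)" by blast
  then show ?thesis
    unfolding C1_def C1_grad_def
    by (intro exI[of _ "\<lambda>x. \<Sum>b\<in>Basis. f b *\<^sub>R b"])
      (metis assms bounded_linear_imp_has_derivative continuous_on_const)
qed

lemma C1_add: assumes "C1 f" "C1 g" shows "C1 (\<lambda>x. f x + g x)"
proof -
  obtain f' g' where "C1_grad f f'" "C1_grad g g'" using assms by (auto simp: C1_def)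
  then show ?thesis
    unfolding C1_def C1_grad_def
    by (intro exI[of _ "\<lambda>x. f' x + g' x"])
      (auto intro!: derivative_eq_intros continuous_intros simp: inner_add_left)
qed

lemma C1_mult: assumes "C1 f" "C1 g" shows "C1 (\<lambda>x. f x * g x)"
proof -
  obtain f' g' where fg: "C1_grad f f'" "C1_grad g g'" using assms by (auto simp: C1_def)
  then have "continuous_on UNIV f" "continuous_on UNIV g" by (auto dest: C1_grad_continuous)
  then show ?thesis
    using fg unfolding C1_def C1_grad_def
    by (intro exI[of _ "\<lambda>x. f x *\<^sub>R g' x + g x *\<^sub>R f' x"])
      (auto intro!: derivative_eq_intros continuous_intros simp: inner_add_left)
qed

lemma C1_sum: "(\<And>i. i \<in> I \<Longrightarrow> C1 (f i)) \<Longrightarrow> C1 (\<lambda>x. \<Sum>i\<in>I. f i x)"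
  by (induction I rule: infinite_finite_induct) (auto intro: C1_const C1_add)

lemma C1_real_polynomial_function: "real_polynomial_function p \<Longrightarrow> C1 p"
  by (induction rule: real_polynomial_function.induct)
    (auto intro: C1_bounded_linear C1_const C1_add C1_mult)

text \<open>Differentiability of \<open>p\<close> is asked only along the range of \<open>f\<close>,
  because the outer function 1 - 1/y used for the cutoffs breaks down at 0.\<close>

lemma C1_compose:
  assumes "C1 f" and p: "\<And>x. (p has_real_derivative p' (f x)) (at (f x))"
    and "continuous_on (range f) p'"
  shows "C1 (\<lambda>x. p (f x))"
proof -
  obtain f' where f: "C1_grad f f'" using assms by (auto simp: C1_def)
  then have cf: "continuous_on UNIV f" by (auto dest: C1_grad_continuous)
  have "continuous_on UNIV (\<lambda>x. p' (f x))"
    using continuous_on_compose[OF cf, of p'] assms(3) by (simp add: o_def)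
  moreover have "((\<lambda>x. p (f x)) has_derivative (\<lambda>h. (p' (f x) *\<^sub>R f' x) \<bullet> h)) (at x)" for x
  proof -
    have "(p has_derivative (\<lambda>h. p' (f x) * h)) (at (f x))"
      using p[of x] by (simp add: has_field_derivative_def)
    moreover have "(f has_derivative (\<lambda>h. f' x \<bullet> h)) (at x)" using f by (simp add: C1_grad_def)
    ultimately show ?thesis using diff_chain_at[of f "\<lambda>h. f' x \<bullet> h" x p "\<lambda>h. p' (f x) * h"]
      by (simp add: o_def)
  qed
  ultimately show ?thesis
    using f unfolding C1_def C1_grad_def
    by (intro exI[of _ "\<lambda>x. p' (f x) *\<^sub>R f' x"] ) (auto intro!: continuous_on_scaleR simp del: inner_scaleR_left)
qed

section \<open>Compactly supported C1 cutoffs\<close>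

lemma has_real_derivative_max0_square:
  "((\<lambda>y::real. (max 0 y)\<^sup>2) has_real_derivative 2 * max 0 y) (at y)"
proof -
  consider "y < 0" | "y > 0" | "y = 0" by linarith
  then show ?thesis
  proof cases
    case 1
    have "((\<lambda>y::real. 0) has_real_derivative 0) (at y)" by simp
    then have "((\<lambda>y::real. (max 0 y)\<^sup>2) has_real_derivative 0) (at y)"
      by (rule DERIV_cong_ev[THEN iffD1, rotated 3, OF _ refl])
        (use 1 in \<open>auto intro!: eventually_mono[OF order_tendstoD(2)[OF tendsto_ident_at 1]] simp: eventually_nhds intro!: exI[of _ "{..<0}"]\<close>)
    then show ?thesis using 1 by simp
  next
    case 2
    have "((\<lambda>y::real. y\<^sup>2) has_real_derivative 2 * y) (at y)" by (auto intro!: derivative_eq_intros)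
    then have "((\<lambda>y::real. (max 0 y)\<^sup>2) has_real_derivative 2 * y) (at y)"
      by (rule DERIV_cong_ev[THEN iffD1, rotated 3, OF _ refl])
        (use 2 in \<open>auto simp: eventually_nhds intro!: exI[of _ "{0<..}"]\<close>)
    then show ?thesis using 2 by simp
  next
    case 3
    have "(\<lambda>h::real. (max 0 h)\<^sup>2 / h) \<midarrow>0\<rightarrow> 0"
    proof (rule Lim_null_comparison)
      show "\<forall>\<^sub>F h::real in at 0. norm ((max 0 h)\<^sup>2 / h) \<le> \<bar>h\<bar>"
        by (auto simp: max_def power2_eq_square)
      show "((\<lambda>h::real. \<bar>h\<bar>) \<longlongrightarrow> 0) (at 0)" by (auto intro!: tendsto_eq_intros)
    qed
    then show ?thesis using 3 by (simp add: DERIV_def)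
  qed
qed

text \<open>Squaring the positive part removes its kink, so this function is C1 and still positive
  exactly on the open ball of radius r > 0.\<close>

lemma C1_bump: "C1 (\<lambda>x::'a::euclidean_space. (max 0 (r\<^sup>2 - (x - a) \<bullet> (x - a)))\<^sup>2)"
proof (rule C1_compose[where p = "\<lambda>y. (max 0 y)\<^sup>2" and p' = "\<lambda>y. 2 * max 0 y"])
  show "C1 (\<lambda>x. r\<^sup>2 - (x - a) \<bullet> (x - a))"
    unfolding C1_def C1_grad_def
    by (intro exI[of _ "\<lambda>x. -2 *\<^sub>R (x - a)"])
      (auto intro!: derivative_eq_intros continuous_intros simp: inner_diff_left inner_diff_right inner_commute)
qed (auto intro!: has_real_derivative_max0_square continuous_intros)

text \<open>Lindelof gives countably many balls covering \<open>W\<close> whose closed balls also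
  lie in \<open>W\<close>. The bumps of the first n of them add up to \<open>S n\<close>. The
  function 1 - 1/(1 + n S n) vanishes off finitely many closed balls, stays below 1, and tends to 1
  where some bump is positive, because n S n is then eventually at least a positive multiple of
  n.\<close>

lemma C1_exhaustion:
  fixes W :: "'a::euclidean_space set"
  assumes W: "open W"
  obtains \<zeta> :: "nat \<Rightarrow> 'a \<Rightarrow> real" where
    "\<And>n. C1 (\<zeta> n)" "\<And>n. compact (closure {x. \<zeta> n x \<noteq> 0})" "\<And>n. closure {x. \<zeta> n x \<noteq> 0} \<subseteq> W"
    "\<And>n x. 0 \<le> \<zeta> n x" "\<And>n x. \<zeta> n x \<le> 1" "\<And>x. x \<in> W \<Longrightarrow> (\<lambda>n. \<zeta> n x) \<longlonglongrightarrow> 1"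
proof (cases "W = {}")
  case True
  then show ?thesis by (intro that[of "\<lambda>_ _. 0"]) (auto intro: C1_const)
next
  case False
  define I where "I = {(a, r::real). r > 0 \<and> cball a r \<subseteq> W}"
  have "W = \<Union>((\<lambda>(a, r). ball a r) ` I)"
  proof (intro equalityI subsetI)
    fix x assume "x \<in> W"
    then obtain e where "e > 0" "cball x e \<subseteq> W" using W open_contains_cball by blast
    then show "x \<in> \<Union>((\<lambda>(a, r). ball a r) ` I)" by (force simp: I_def)
  next
    fix x assume "x \<in> \<Union>((\<lambda>(a, r). ball a r) ` I)"
    then show "x \<in> W" by (auto simp: I_def)
  qed
  moreover obtain \<F> where F: "\<F> \<subseteq> (\<lambda>(a, r). ball a r) ` I" "countable \<F>"
      "\<Union>\<F> = \<Union>((\<lambda>(a, r). ball a r) ` I)"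
    by (rule Lindelof[of "(\<lambda>(a, r). ball a r) ` I"]) auto
  moreover obtain J where "J \<subseteq> I" "countable J" "\<F> = (\<lambda>(a, r). ball a r) ` J"
    using F countable_subset_image[of \<F> "\<lambda>(a, r). ball a r" I] by blast
  ultimately have J: "J \<subseteq> I" "countable J" "\<Union>((\<lambda>(a, r). ball a r) ` J) = W" by simp_all
  then have "J \<noteq> {}" using False by auto
  define a r where "a = (\<lambda>n. fst (from_nat_into J n))" and "r = (\<lambda>n. snd (from_nat_into J n))"
  have "from_nat_into J n \<in> I" for n using from_nat_into[OF \<open>J \<noteq> {}\<close>] J by blast
  then have r: "r n > 0" "cball (a n) (r n) \<subseteq> W" for n
    by (auto simp: I_def a_def r_def case_prod_unfold)
  have cov: "\<exists>n. x \<in> ball (a n) (r n)" if "x \<in> W" for x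
  proof -
    obtain p where "p \<in> J" "x \<in> ball (fst p) (snd p)" using \<open>x \<in> W\<close> J(3) by (auto simp: case_prod_unfold)
    moreover obtain n where "p = from_nat_into J n"
      using from_nat_into_surj[OF \<open>countable J\<close> \<open>p \<in> J\<close>] by blast
    ultimately show ?thesis by (auto simp: a_def r_def)
  qed
  define b where "b = (\<lambda>n x. (max 0 ((r n)\<^sup>2 - (x - a n) \<bullet> (x - a n)))\<^sup>2)"
  have b0: "b n x \<ge> 0" for n x by (simp add: b_def)
  have bpos: "b n x > 0 \<longleftrightarrow> x \<in> ball (a n) (r n)" for n x
  proof -
    have "(x - a n) \<bullet> (x - a n) < (r n)\<^sup>2 \<longleftrightarrow> dist (a n) x < r n"
      using r(1)[of n] by (metis abs_of_pos dist_commute dist_norm norm_lt_square)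
    then show ?thesis by (auto simp: b_def max_def)
  qed
  define S where "S = (\<lambda>n x. \<Sum>i<n. b i x)"
  have S0: "S n x \<ge> 0" for n x by (simp add: S_def b0 sum_nonneg)
  define \<zeta> where "\<zeta> = (\<lambda>n x. 1 - 1 / (1 + real n * S n x))"
  have pos: "1 + real n * S n x > 0" for n x using S0[of n x] by (simp add: add_pos_nonneg)
  have supp: "{x. \<zeta> n x \<noteq> 0} \<subseteq> (\<Union>i<n. cball (a i) (r i))" for n
  proof
    fix x assume "x \<in> {x. \<zeta> n x \<noteq> 0}"
    then have "S n x \<noteq> 0" by (auto simp: \<zeta>_def)
    then obtain i where "i < n" "b i x \<noteq> 0" by (metis S_def lessThan_iff sum.neutral)
    then have "x \<in> ball (a i) (r i)" using bpos[of i x] b0[of i x] by linarith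
    with \<open>i < n\<close> show "x \<in> (\<Union>i<n. cball (a i) (r i))" by force
  qed
  have comp: "compact (\<Union>i<n. cball (a i) (r i))" for n by (intro compact_UN) auto
  have clos: "closure {x. \<zeta> n x \<noteq> 0} \<subseteq> (\<Union>i<n. cball (a i) (r i))" for n
    using supp comp by (simp add: closure_minimal compact_imp_closed)
  show ?thesis
  proof (rule that)
    fix n
    have "C1 (\<lambda>x. 1 + real n * S n x)"
      unfolding S_def b_def by (intro C1_add C1_mult C1_const C1_sum C1_bump)
    then show "C1 (\<zeta> n)" unfolding \<zeta>_def
    proof (rule C1_compose[where p = "\<lambda>y. 1 - 1 / y" and p' = "\<lambda>y. 1 / y\<^sup>2"])
      fix x
      show "((\<lambda>y. 1 - 1 / y) has_real_derivative 1 / (1 + real n * S n x)\<^sup>2) (at (1 + real n * S n x))"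
        using pos[of n x] by (auto intro!: derivative_eq_intros simp: power2_eq_square)
      show "continuous_on (range (\<lambda>x. 1 + real n * S n x)) (\<lambda>y. 1 / y\<^sup>2)"
        using pos[of n] by (intro continuous_intros) (force simp: less_le)
    qed
    show "compact (closure {x. \<zeta> n x \<noteq> 0})"
      using clos[of n] comp[of n] by (meson bounded_subset compact_closure compact_imp_bounded closure_subset order_trans bounded_closure)
    show "closure {x. \<zeta> n x \<noteq> 0} \<subseteq> W" using clos[of n] r by blast
    fix x
    show "0 \<le> \<zeta> n x" using pos[of n x] S0[of n x] by (simp add: \<zeta>_def field_simps)
    show "\<zeta> n x \<le> 1" using pos[of n x] by (simp add: \<zeta>_def)
  next
    fix x assume "x \<in> W"
    then obtain k where "x \<in> ball (a k) (r k)" using cov by blast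
    then have bk: "b k x > 0" using bpos by blast
    have "filterlim (\<lambda>n. 1 + real n * S n x) at_top sequentially"
    proof (rule filterlim_at_top_mono)
      show "filterlim (\<lambda>n. b k x * real n) at_top sequentially"
        using bk by (intro filterlim_tendsto_pos_mult_at_top[OF tendsto_const]) (auto simp: filterlim_real_sequentially)
      show "\<forall>\<^sub>F n in sequentially. b k x * real n \<le> 1 + real n * S n x"
        using eventually_gt_at_top[of k]
      proof eventually_elim
        case (elim n)
        then have "b k x \<le> S n x" unfolding S_def by (intro member_le_sum) (auto simp: b0)
        then have "b k x * real n \<le> real n * S n x" by (simp add: mult.commute mult_left_mono)
        then show ?case by simp
      qed
    qed
    then have "(\<lambda>n. 1 / (1 + real n * S n x)) \<longlonglongrightarrow> 0"
      by (rule tendsto_divide_0[OF tendsto_const filterlim_at_top_imp_at_infinity])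
    then have "(\<lambda>n. 1 - 1 / (1 + real n * S n x)) \<longlonglongrightarrow> 1 - 0" by (intro tendsto_intros)
    then show "(\<lambda>n. \<zeta> n x) \<longlonglongrightarrow> 1" by (simp add: \<zeta>_def)
  qed
qed


text \<open>The signs of \<open>v\<close> are an a.e. limit of continuous functions, which polynomials approximate
  uniformly on compact sets.\<close>
lemma nn_integral_le_by_C1_duality:
  fixes v G :: "'a::euclidean_space \<Rightarrow> real"
  assumes W: "open W" and v: "integrable lborel v"
    and G: "continuous_on W G" and Gpos: "\<And>x. x \<in> W \<Longrightarrow> G x > 0"
    and bound: "\<And>f. C1 f \<Longrightarrow> compact (closure {x. f x \<noteq> 0}) \<Longrightarrow> closure {x. f x \<noteq> 0} \<subseteq> W
        \<Longrightarrow> (\<And>x. x \<in> W \<Longrightarrow> \<bar>f x\<bar> \<le> G x) \<Longrightarrow> (\<integral>x. v x * f x \<partial>lborel) \<le> M"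
  shows "(\<integral>\<^sup>+x\<in>W. ennreal (\<bar>v x\<bar> * G x) \<partial>lborel) \<le> ennreal M"
proof -
  note [measurable] = borel_measurable_integrable[OF v]
  define G0 where "G0 = (\<lambda>x. indicator W x * G x)"
  have [measurable]: "G0 \<in> borel_measurable borel"
    unfolding G0_def using borel_measurable_continuous_on_indicator[of W G] W G by simp
  have "(\<lambda>x. sgn (v x)) \<in> borel_measurable lebesgue"
    by (rule measurable_completion) measurable
  then have "(\<lambda>x. sgn (v x)) measurable_on UNIV"
    by (intro lebesgue_measurable_imp_measurable_on) auto
  then obtain N g where N: "negligible N" and cg: "\<And>n. continuous_on UNIV (g n)"
    and lim: "\<And>x. x \<notin> N \<Longrightarrow> (\<lambda>n. g n x) \<longlonglongrightarrow> sgn (v x)"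
    unfolding measurable_on_def by auto
  \<comment> \<open>\<open>N\<close> is only Lebesgue negligible, while the almost-everywhere
    statement below is about \<open>lborel\<close> and needs a Borel null set containing it.\<close>
  obtain N' where N': "N' \<in> null_sets lborel" "N \<subseteq> N'"
    using N by (auto simp: negligible_iff_null_sets null_sets_completion_iff2)
  \<comment> \<open>The claim with a cutoff \<open>z\<close> as extra factor. On the compact support
    of \<open>z\<close> the function \<open>G\<close> has a positive lower bound \<open>mm\<close>,
    which allows an approximation error relative to \<open>G\<close>.\<close>
  have step: "(\<integral>\<^sup>+x. ennreal (\<bar>v x\<bar> * (z x * G0 x)) \<partial>lborel) \<le> ennreal M"
    if z: "C1 z" "compact (closure {x. z x \<noteq> 0})" "closure {x. z x \<noteq> 0} \<subseteq> W"
      "\<And>x. 0 \<le> z x" "\<And>x. z x \<le> 1" for z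
  proof -
    define K where "K = closure {x. z x \<noteq> 0}"
    have K: "compact K" "K \<subseteq> W" using z by (auto simp: K_def)
    have z0: "z x = 0" if "x \<notin> K" for x using that closure_subset[of "{x. z x \<noteq> 0}"] by (auto simp: K_def)
    have GK: "continuous_on K G" using G K continuous_on_subset by blast
    obtain mm MM where mm: "mm > 0" "\<And>x. x \<in> K \<Longrightarrow> mm \<le> G x" "\<And>x. x \<in> K \<Longrightarrow> G x \<le> MM" "MM \<ge> 0"
    proof (cases "K = {}")
      case True then show ?thesis using that[of 1 0] by auto
    next
      case False
      obtain a where "a \<in> K" "\<And>x. x \<in> K \<Longrightarrow> G a \<le> G x"
        using continuous_attains_inf[OF K(1) False GK] by blast
      moreover obtain b where "b \<in> K" "\<And>x. x \<in> K \<Longrightarrow> G x \<le> G b"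
        using continuous_attains_sup[OF K(1) False GK] by blast
      ultimately show ?thesis using that[of "G a" "G b"] Gpos K by (meson less_eq_real_def subsetD)
    qed
    \<comment> \<open>Clipping to [-1, 1] does not disturb the limit, which is a sign, and forces
      |q| <= G on \<open>K\<close>.\<close>
    define q where "q = (\<lambda>n x. max (-1) (min 1 (g n x)) * G x)"
    have "\<exists>p. real_polynomial_function p \<and> (\<forall>x\<in>K. \<bar>q n x - p x\<bar> < mm / real (n + 1))" for n
    proof -
      have "continuous_on K (q n)" unfolding q_def
        by (intro continuous_intros GK continuous_on_subset[OF cg]) auto
      then show ?thesis
        using Stone_Weierstrass_real_polynomial_function[of K "q n" "mm / real (n + 1)"] K mm
        by (metis divide_pos_pos of_nat_0_less_iff zero_less_Suc Suc_eq_plus1)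
    qed
    then obtain p where p: "\<And>n. real_polynomial_function (p n)"
        "\<And>n x. x \<in> K \<Longrightarrow> \<bar>q n x - p n x\<bar> < mm / real (n + 1)" by metis
    \<comment> \<open>On \<open>K\<close>, |p n| <= G + mm/(n+1) <= G (n+2)/(n+1). The factor
      (n+1)/(n+2) restores |f n| <= G exactly, as \<open>bound\<close> demands, and tends to
      1.\<close>
    define f where "f = (\<lambda>n x. z x * (p n x * (real (n + 1) / real (n + 2))))"
    have C1f: "C1 (f n)" for n
      unfolding f_def by (intro C1_mult z(1) C1_real_polynomial_function p C1_const)
    have [measurable]: "f n \<in> borel_measurable borel" for n
      using C1_continuous[OF C1f] by (simp add: borel_measurable_continuous_onI)
    have [measurable]: "z \<in> borel_measurable borel"
      using C1_continuous[OF z(1)] by (simp add: borel_measurable_continuous_onI)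
    have fb: "\<bar>f n x\<bar> \<le> z x * G0 x" for n x
    proof (cases "x \<in> K")
      case True
      have "\<bar>q n x\<bar> \<le> 1 * G x" unfolding q_def abs_mult
        using Gpos[of x] True K by (intro mult_mono) auto
      moreover have "\<bar>p n x\<bar> \<le> \<bar>q n x\<bar> + mm / real (n + 1)" using p(2)[OF True, of n] by linarith
      moreover have "mm / real (n + 1) \<le> G x / real (n + 1)"
        using mm(2)[OF True] by (intro divide_right_mono) auto
      ultimately have "\<bar>p n x\<bar> \<le> G x + G x / real (n + 1)" by linarith
      then have "\<bar>p n x\<bar> * (real (n + 1) / real (n + 2)) \<le> (G x + G x / real (n + 1)) * (real (n + 1) / real (n + 2))"
        by (intro mult_right_mono) auto
      also have "\<dots> = G x"
      proof -
        have "(G + G / a) * (a / (a + 1)) = G" if "a > 0" for G a :: real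
          using that by (simp add: divide_simps) (simp add: algebra_simps)
        from this[of "real (n + 1)"] show ?thesis by (simp add: add.commute)
      qed
      also have "G x = G0 x" using True K by (auto simp: G0_def)
      finally have "z x * (\<bar>p n x\<bar> * (real (n + 1) / real (n + 2))) \<le> z x * G0 x"
        using z(4) by (rule mult_left_mono)
      then show ?thesis using z(4)[of x] by (simp add: f_def abs_mult)
    qed (auto simp: f_def z0)
    have supp: "closure {x. f n x \<noteq> 0} \<subseteq> K" for n
      unfolding K_def by (intro closure_mono) (auto simp: f_def)
    have "(\<integral>x. v x * f n x \<partial>lborel) \<le> M" for n
    proof (rule bound[OF C1f])
      show "compact (closure {x. f n x \<noteq> 0})"
        using supp[of n] K(1) by (metis closed_closure compact_Int_closed inf.absorb_iff2)
      show "closure {x. f n x \<noteq> 0} \<subseteq> W" using supp[of n] K(2) by blast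
      fix x assume x: "x \<in> W"
      have "z x * G0 x \<le> 1 * G0 x" using z x Gpos[OF x] by (intro mult_right_mono) (auto simp: G0_def)
      then show "\<bar>f n x\<bar> \<le> G x" using fb[of n x] x by (simp add: G0_def)
    qed
    moreover have "(\<lambda>n. \<integral>x. v x * f n x \<partial>lborel) \<longlonglongrightarrow> (\<integral>x. v x * (z x * (sgn (v x) * G0 x)) \<partial>lborel)"
    proof (rule integral_dominated_convergence)
      show "integrable lborel (\<lambda>x. \<bar>v x\<bar> * MM)" using v by simp
      show "AE x in lborel. (\<lambda>n. v x * f n x) \<longlonglongrightarrow> v x * (z x * (sgn (v x) * G0 x))"
      proof (rule AE_I'[OF N'(1)], rule subsetI)
        fix x assume *: "x \<in> {x \<in> space lborel. \<not> (\<lambda>n. v x * f n x) \<longlonglongrightarrow> v x * (z x * (sgn (v x) * G0 x))}"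
        show "x \<in> N'"
        proof (rule ccontr)
          assume "x \<notin> N'"
          then have l: "(\<lambda>n. g n x) \<longlonglongrightarrow> sgn (v x)" using lim N' by blast
          have "(\<lambda>n. f n x) \<longlonglongrightarrow> z x * (sgn (v x) * G0 x)"
          proof (cases "x \<in> K")
            case True
            have "(\<lambda>n. q n x) \<longlonglongrightarrow> max (-1) (min 1 (sgn (v x))) * G x"
              unfolding q_def by (intro tendsto_intros l)
            also have "max (-1) (min 1 (sgn (v x))) = sgn (v x)" by (auto simp: sgn_if)
            finally have ql: "(\<lambda>n. q n x) \<longlonglongrightarrow> sgn (v x) * G0 x" using True K by (auto simp: G0_def)
            have "(\<lambda>n. mm / real (n + 1)) \<longlonglongrightarrow> 0"
              using LIMSEQ_ignore_initial_segment[OF lim_const_over_n, of mm 1] by simp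
            then have "(\<lambda>n. q n x - p n x) \<longlonglongrightarrow> 0"
              by (rule Lim_null_comparison[rotated]) (use p(2)[OF True] in \<open>auto intro!: always_eventually less_imp_le\<close>)
            from tendsto_diff[OF ql this] have pl: "(\<lambda>n. p n x) \<longlonglongrightarrow> sgn (v x) * G0 x" by simp
            have "(\<lambda>n. real (n + 1) / real (n + 2)) \<longlonglongrightarrow> 1"
              using LIMSEQ_ignore_initial_segment[OF LIMSEQ_n_over_Suc_n, of 1] by simp
            from tendsto_mult[OF tendsto_const tendsto_mult[OF pl this]] show ?thesis unfolding f_def by simp
          qed (simp add: f_def z0)
          then show False using * by (auto intro!: tendsto_intros)
        qed
      qed
      fix n
      have "z x * G0 x \<le> 1 * MM" for x
      proof (cases "x \<in> K")
        case True then show ?thesis using K mm(3)[OF True] z(4,5)[of x] Gpos[of x] by (intro mult_mono) (auto simp: G0_def)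
      qed (use mm z0 in auto)
      then have "\<bar>f n x\<bar> \<le> MM" for x using fb[of n x] by (metis mult_1 order_trans)
      then show "AE x in lborel. norm (v x * f n x) \<le> \<bar>v x\<bar> * MM"
        by (auto simp: abs_mult intro!: mult_left_mono)
    qed measurable
    ultimately have le: "(\<integral>x. v x * (z x * (sgn (v x) * G0 x)) \<partial>lborel) \<le> M" by (meson LIMSEQ_le_const2)
    have eq: "v x * (z x * (sgn (v x) * G0 x)) = \<bar>v x\<bar> * (z x * G0 x)" for x
      by (simp add: abs_sgn mult_ac)
    have H: "0 \<le> z x * G0 x" "z x * G0 x \<le> MM" for x
      using fb[of 0 x] K mm z(4,5)[of x] z0[of x] Gpos[of x]
      by (auto simp: G0_def indicator_def intro: order_trans[OF abs_ge_zero])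
        (metis (no_types, lifting) mult_left_le_one_le mult_zero_left order_trans less_imp_le)+
    have "integrable lborel (\<lambda>x. \<bar>v x\<bar> * (z x * G0 x))"
    proof (rule Bochner_Integration.integrable_bound)
      show "integrable lborel (\<lambda>x. MM * v x)" using v by simp
      show "AE x in lborel. norm (\<bar>v x\<bar> * (z x * G0 x)) \<le> norm (MM * v x)"
      proof (rule always_eventually, rule allI)
        fix x show "norm (\<bar>v x\<bar> * (z x * G0 x)) \<le> norm (MM * v x)"
          using mult_left_mono[OF H(2)[of x], of "\<bar>v x\<bar>"] abs_of_nonneg[OF H(1)[of x]] mm(4)
          by (simp add: abs_mult mult.commute[of MM])
      qed
    qed measurable
    then have "(\<integral>\<^sup>+x. ennreal (\<bar>v x\<bar> * (z x * G0 x)) \<partial>lborel) = ennreal (\<integral>x. \<bar>v x\<bar> * (z x * G0 x) \<partial>lborel)"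
      using H by (intro nn_integral_eq_integral) auto
    with le show ?thesis unfolding eq by (simp add: ennreal_leI)
  qed
  \<comment> \<open>Fatou's lemma along the exhausting cutoffs turns the cutoff into the indicator
    of \<open>W\<close>.\<close>
  obtain \<zeta> :: "nat \<Rightarrow> 'a \<Rightarrow> real" where ze: "\<And>n. C1 (\<zeta> n)" "\<And>n. compact (closure {x. \<zeta> n x \<noteq> 0})" "\<And>n. closure {x. \<zeta> n x \<noteq> 0} \<subseteq> W"
    "\<And>n x. 0 \<le> \<zeta> n x" "\<And>n x. \<zeta> n x \<le> 1" "\<And>x. x \<in> W \<Longrightarrow> (\<lambda>n. \<zeta> n x) \<longlonglongrightarrow> 1"
    using C1_exhaustion[OF W] by metis
  have [measurable]: "\<zeta> n \<in> borel_measurable borel" for n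
    using C1_continuous[OF ze(1)] by (simp add: borel_measurable_continuous_onI)
  have "ennreal (\<bar>v x\<bar> * G x) * indicator W x = liminf (\<lambda>n. ennreal (\<bar>v x\<bar> * (\<zeta> n x * G0 x)))" for x
  proof -
    have "(\<lambda>n. \<bar>v x\<bar> * (\<zeta> n x * G0 x)) \<longlonglongrightarrow> \<bar>v x\<bar> * G0 x"
    proof (cases "x \<in> W")
      case True
      have "(\<lambda>n. \<bar>v x\<bar> * (\<zeta> n x * G0 x)) \<longlonglongrightarrow> \<bar>v x\<bar> * (1 * G0 x)" by (intro tendsto_intros ze True)
      then show ?thesis by simp
    qed (simp add: G0_def)
    then have "(\<lambda>n. ennreal (\<bar>v x\<bar> * (\<zeta> n x * G0 x))) \<longlonglongrightarrow> ennreal (\<bar>v x\<bar> * G0 x)" by (rule tendsto_ennrealI)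
    then have "liminf (\<lambda>n. ennreal (\<bar>v x\<bar> * (\<zeta> n x * G0 x))) = ennreal (\<bar>v x\<bar> * G0 x)"
      by (intro lim_imp_Liminf) auto
    then show ?thesis by (simp add: G0_def indicator_def)
  qed
  then have "(\<integral>\<^sup>+x\<in>W. ennreal (\<bar>v x\<bar> * G x) \<partial>lborel)
      = (\<integral>\<^sup>+x. liminf (\<lambda>n. ennreal (\<bar>v x\<bar> * (\<zeta> n x * G0 x))) \<partial>lborel)" by simp
  also have "\<dots> \<le> liminf (\<lambda>n. \<integral>\<^sup>+x. ennreal (\<bar>v x\<bar> * (\<zeta> n x * G0 x)) \<partial>lborel)"
    by (intro nn_integral_liminf) measurable
  also have "\<dots> \<le> ennreal M"
    using step[OF ze(1-5)] by (intro Liminf_le) (auto)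
  finally show ?thesis .
qed

section \<open>Translation estimates for functions of bounded variation\<close>


text \<open>A Borel form of BV: \<open>u\<close> lives on the whole space, so that translates make
  sense, and \<open>B\<close> is any real upper bound of the supremum, which keeps infinite values
  out of the estimates. Test fields vanish off \<Omega>, so the values of \<open>u\<close> there do
  not influence the bound.\<close>

definition var_bound :: "'a::euclidean_space set \<Rightarrow> ('a \<Rightarrow> real) \<Rightarrow> real \<Rightarrow> bool" where
  "var_bound \<Omega> u B \<longleftrightarrow> integrable lborel u \<and> 0 \<le> B \<and>
     (\<forall>\<phi>\<in>test_fields \<Omega>. (\<integral>x. u x * divergence \<phi> x \<partial>lborel) \<le> B)"

lemma nn_integral_lborel_translate:
  fixes f :: "'a::euclidean_space \<Rightarrow> ennreal"
  assumes [measurable]: "f \<in> borel_measurable borel"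
  shows "(\<integral>\<^sup>+x. f (x + c) \<partial>lborel) = (\<integral>\<^sup>+x. f x \<partial>lborel)"
proof -
  have "(\<integral>\<^sup>+x. f x \<partial>lborel) = (\<integral>\<^sup>+x. f x \<partial>distr lborel borel ((+) c))" by (simp add: lborel_distr_plus)
  also have "\<dots> = (\<integral>\<^sup>+x. f (c + x) \<partial>lborel)" by (subst nn_integral_distr) auto
  finally show ?thesis by (simp add: add.commute)
qed

lemma
  fixes f :: "'a::euclidean_space \<Rightarrow> real"
  assumes f: "f \<in> borel_measurable borel"
  shows integral_lborel_translate: "(\<integral>x. f (x + c) \<partial>lborel) = (\<integral>x. f x \<partial>lborel)"
    and integrable_lborel_translate: "integrable lborel (\<lambda>x. f (x + c)) \<longleftrightarrow> integrable lborel f"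
proof -
  note [measurable] = f
  have "(\<integral>x. f x \<partial>lborel) = (\<integral>x. f x \<partial>distr lborel borel ((+) c))" by (simp add: lborel_distr_plus)
  also have "\<dots> = (\<integral>x. f (c + x) \<partial>lborel)" by (subst integral_distr) auto
  finally show "(\<integral>x. f (x + c) \<partial>lborel) = (\<integral>x. f x \<partial>lborel)" by (simp add: add.commute)
  have "integrable lborel f \<longleftrightarrow> integrable (distr lborel borel ((+) c)) f" by (simp add: lborel_distr_plus)
  also have "\<dots> \<longleftrightarrow> integrable lborel (\<lambda>x. f (c + x))" by (subst integrable_distr_eq) auto
  finally show "integrable lborel (\<lambda>x. f (x + c)) \<longleftrightarrow> integrable lborel f" by (simp add: add.commute)
qed

text \<open>The first claim is differentiation under the integral sign; \<open>leibniz_rule\<close>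
  wants the derivative as a bounded linear map, hence \<open>blinfun_inner_right\<close>. The second
  is the fundamental theorem of calculus along the segment from x to x + h.\<close>

lemma C1_grad_segment_average:
  fixes f :: "'a::euclidean_space \<Rightarrow> real" and h :: 'a
  assumes "C1_grad f g"
  shows "C1_grad (\<lambda>x. integral {0..1} (\<lambda>s. f (x + s *\<^sub>R h)))
           (\<lambda>x. integral {0..1} (\<lambda>s. g (x + s *\<^sub>R h)))" (is "C1_grad ?F ?g")
    and "integral {0..1} (\<lambda>s. g (x + s *\<^sub>R h)) \<bullet> h = f (x + h) - f x"
proof -
  have df: "(f has_derivative (\<lambda>k. g x \<bullet> k)) (at x)" for x using assms by (simp add: C1_grad_def)
  have cg: "continuous_on UNIV g" and cf: "continuous_on UNIV f"
    using assms C1_grad_continuous by (auto simp: C1_grad_def)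
  have cg': "continuous_on S (\<lambda>y. g (a y))" if "continuous_on S a" for a :: "'b::topological_space \<Rightarrow> 'a" and S
    using continuous_on_compose2[OF cg that] by auto
  have cf': "continuous_on S (\<lambda>y. f (a y))" if "continuous_on S a" for a :: "'b::topological_space \<Rightarrow> 'a" and S
    using continuous_on_compose2[OF cf that] by auto
  have gint: "(\<lambda>s. g (x + s *\<^sub>R h)) integrable_on {0..1}" for x
    by (intro integrable_continuous_interval cg' continuous_intros)
  have "(?F has_derivative (\<lambda>k. ?g x \<bullet> k)) (at x)" for x
  proof -
    have "((\<lambda>x. integral (cbox 0 1) (\<lambda>s. f (x + s *\<^sub>R h))) has_derivative
        integral (cbox 0 1) (\<lambda>s::real. blinfun_inner_right (g (x + s *\<^sub>R h)))) (at x within UNIV)"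
    proof (rule leibniz_rule)
      fix x :: 'a and s :: real
      have "((\<lambda>x. f (x + s *\<^sub>R h)) has_derivative (\<lambda>k. g (x + s *\<^sub>R h) \<bullet> k)) (at x)"
        by (rule has_derivative_compose[OF _ df, where f' = "\<lambda>k. k"]) (auto intro!: derivative_eq_intros)
      then show "((\<lambda>x. f (x + s *\<^sub>R h)) has_derivative blinfun_apply (blinfun_inner_right (g (x + s *\<^sub>R h)))) (at x within UNIV)"
        by simp
    next
      show "(\<lambda>s. f (x + s *\<^sub>R h)) integrable_on cbox 0 1" for x
        by (intro integrable_continuous cf' continuous_intros)
      show "continuous_on (UNIV \<times> cbox 0 1) (\<lambda>(x, t). blinfun_inner_right (g (x + t *\<^sub>R h)))"
        unfolding case_prod_unfold
        by (intro bounded_linear.continuous_on[OF bounded_linear_blinfun_inner_right] cg' continuous_intros)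
    qed auto
    moreover have "blinfun_apply (integral (cbox 0 1) (\<lambda>s::real. blinfun_inner_right (g (x + s *\<^sub>R h)))) = (\<lambda>k. ?g x \<bullet> k)"
    proof -
      have "integral {0..1} (\<lambda>s::real. blinfun_inner_right (g (x + s *\<^sub>R h))) = blinfun_inner_right (?g x)"
        using integral_linear[OF gint bounded_linear_blinfun_inner_right, of x] by (simp add: o_def)
      then show ?thesis by simp
    qed
    ultimately show ?thesis by simp
  qed
  moreover have "continuous_on UNIV ?g"
  proof -
    have "continuous_on UNIV (\<lambda>x. integral (cbox 0 1) (\<lambda>s. g (x + s *\<^sub>R h)))"
      by (rule integral_continuous_on_param) (auto simp: case_prod_unfold intro!: cg' continuous_intros)
    then show ?thesis by simp
  qed
  ultimately show "C1_grad ?F ?g" by (simp add: C1_grad_def)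
  have "((\<lambda>s. g (x + s *\<^sub>R h) \<bullet> h) has_integral (f (x + 1 *\<^sub>R h) - f (x + 0 *\<^sub>R h))) {0..1}"
  proof (rule fundamental_theorem_of_calculus)
    fix s :: real
    have "((\<lambda>s. f (x + s *\<^sub>R h)) has_derivative (\<lambda>k. g (x + s *\<^sub>R h) \<bullet> (k *\<^sub>R h))) (at s)"
      by (rule has_derivative_compose[OF _ df, where f' = "\<lambda>k. k *\<^sub>R h"]) (auto intro!: derivative_eq_intros)
    then show "((\<lambda>s. f (x + s *\<^sub>R h)) has_vector_derivative g (x + s *\<^sub>R h) \<bullet> h) (at s within {0..1})"
      by (auto simp: has_vector_derivative_def intro: has_derivative_at_withinI)
  qed auto
  moreover have "((\<lambda>s. g (x + s *\<^sub>R h) \<bullet> h) has_integral (?g x \<bullet> h)) {0..1}"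
    using has_integral_linear[OF integrable_integral[OF gint[of x]] bounded_linear_inner_left[of h]]
    by (simp add: o_def)
  ultimately show "?g x \<bullet> h = f (x + h) - f x" by (auto dest: has_integral_unique)
qed

text \<open>The difference \<open>f (x + h) - f x\<close> is the divergence of \<open>x \<mapsto> (\<integral>\<^sub>0\<^sup>1 f (x + s h) ds) h\<close>.\<close>
lemma var_bound_difference_integral_le:
  fixes u f :: "'a::euclidean_space \<Rightarrow> real"
  assumes u: "var_bound \<Omega> u B"
    and f: "C1 f" and K: "compact (closure {x. f x \<noteq> 0})"
    and seg: "\<And>x s. x \<in> closure {x. f x \<noteq> 0} \<Longrightarrow> s \<in> {0..1} \<Longrightarrow> x - s *\<^sub>R h \<in> \<Omega>"
    and M: "M > 0" "\<And>x. norm h * \<bar>integral {0..1} (\<lambda>s. f (x + s *\<^sub>R h))\<bar> \<le> M"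
  shows "(\<integral>x. (u (x - h) - u x) * f x \<partial>lborel) \<le> M * B"
proof -
  obtain g where g: "C1_grad f g" using f by (auto simp: C1_def)
  define F where "F = (\<lambda>x. integral {0..1} (\<lambda>s. f (x + s *\<^sub>R h)))"
  define G where "G = (\<lambda>x. integral {0..1} (\<lambda>s. g (x + s *\<^sub>R h)))"
  have FG: "C1_grad F G" unfolding F_def G_def by (rule C1_grad_segment_average[OF g])
  have Gh: "G x \<bullet> h = f (x + h) - f x" for x
    unfolding G_def by (rule C1_grad_segment_average[OF g])
  \<comment> \<open>If F x is nonzero, then f is nonzero somewhere on the segment from x to x + h.
    So F lives on the support of f swept backwards along h, a compact set that \<open>seg\<close>
    places inside \<Omega>.\<close>
  define K' where "K' = (\<lambda>p. fst p - snd p *\<^sub>R h) ` (closure {x. f x \<noteq> 0} \<times> {0..1})"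
  have K': "compact K'" "K' \<subseteq> \<Omega>"
  proof -
    show "compact K'" unfolding K'_def
      by (intro compact_continuous_image compact_Times K continuous_intros compact_Icc)
    show "K' \<subseteq> \<Omega>" using seg by (auto simp: K'_def)
  qed
  have F0: "x \<in> K'" if "F x \<noteq> 0" for x
  proof (rule ccontr)
    assume x: "x \<notin> K'"
    have "f (x + s *\<^sub>R h) = 0" if "s \<in> {0..1}" for s
    proof (rule ccontr)
      assume "f (x + s *\<^sub>R h) \<noteq> 0"
      then have "x + s *\<^sub>R h \<in> closure {x. f x \<noteq> 0}" using closure_subset[of "{x. f x \<noteq> 0}"] by auto
      then have "(x + s *\<^sub>R h) - s *\<^sub>R h \<in> K'"
        unfolding K'_def using that by (metis (no_types, lifting) SigmaI fst_conv snd_conv image_eqI)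
      then show False using x by simp
    qed
    then have "F x = integral {0..1} (\<lambda>s::real. 0)" unfolding F_def by (rule integral_cong)
    then show False using that by simp
  qed
  \<comment> \<open>Dividing by \<open>M\<close> makes the field admissible, since \<open>M\<close>
    bounds norm h times |F|; the factor returns in the conclusion.\<close>
  define \<phi> where "\<phi> = (\<lambda>x. (F x / M) *\<^sub>R h)"
  have d\<phi>: "(\<phi> has_derivative (\<lambda>k. (G x \<bullet> k / M) *\<^sub>R h)) (at x)" for x
    using FG M(1) unfolding \<phi>_def C1_grad_def by (auto intro!: derivative_eq_intros)
  have fr: "frechet_derivative \<phi> (at x) = (\<lambda>k. (G x \<bullet> k / M) *\<^sub>R h)" for x
    using frechet_derivative_at[OF d\<phi>] by simp
  have cG: "continuous_on UNIV G" using FG by (simp add: C1_grad_def)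
  have "\<phi> \<in> test_fields \<Omega>"
  proof -
    have sub: "closure {x. \<phi> x \<noteq> 0} \<subseteq> K'"
      using F0 K' by (intro closure_minimal) (auto simp: \<phi>_def compact_imp_closed)
    have "norm (\<phi> x) \<le> 1" for x
      using M(2)[of x, folded F_def] M(1) by (simp add: \<phi>_def divide_simps mult.commute F_def)
    moreover have "\<phi> differentiable_on UNIV"
      using d\<phi> differentiable_at_imp_differentiable_on differentiableI by blast
    moreover have "continuous_on UNIV (\<lambda>x. frechet_derivative \<phi> (at x) b)" for b
      unfolding fr by (intro continuous_intros cG) (use M in auto)
    moreover have "compact (closure {x. \<phi> x \<noteq> 0})"
      using sub K'(1) by (metis closed_closure compact_Int_closed inf.absorb_iff2)
    ultimately show ?thesis using sub K'(2) unfolding test_fields_def by blast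
  qed
  then have le: "(\<integral>x. u x * divergence \<phi> x \<partial>lborel) \<le> B" using u by (auto simp: var_bound_def)
  \<comment> \<open>The derivative of the field has rank one, so its trace is the inner product of G
    x and h, divided by \<open>M\<close>.\<close>
  have div: "divergence \<phi> x = (f (x + h) - f x) / M" for x
  proof -
    have "divergence \<phi> x = (\<Sum>b\<in>Basis. (G x \<bullet> b) * (h \<bullet> b)) / M"
      by (simp add: divergence_def fr sum_divide_distrib)
    then show ?thesis using euclidean_inner[of "G x" h] by (simp add: Gh)
  qed
  have ui: "integrable lborel u" using u by (simp add: var_bound_def)
  then have [measurable]: "u \<in> borel_measurable borel" by auto
  have cf: "continuous_on UNIV f" using f by (rule C1_continuous)
  then have [measurable]: "f \<in> borel_measurable borel" by (simp add: borel_measurable_continuous_onI)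
  obtain b where b: "\<And>x. \<bar>f x\<bar> \<le> b"
  proof -
    have "bounded (f ` closure {x. f x \<noteq> 0})"
      using cf K by (intro compact_imp_bounded compact_continuous_image) (auto intro: continuous_on_subset)
    then obtain b where b: "\<And>x. x \<in> closure {x. f x \<noteq> 0} \<Longrightarrow> \<bar>f x\<bar> \<le> b" unfolding bounded_iff by auto
    have "\<bar>f x\<bar> \<le> max 0 b" for x
      using b[of x] closure_subset[of "{x. f x \<noteq> 0}"] by (cases "f x = 0") (auto simp: le_max_iff_disj)
    then show ?thesis using that by blast
  qed
  have int: "integrable lborel (\<lambda>x. u (x + c) * f (x + d))" for c d
  proof (rule Bochner_Integration.integrable_bound)
    show "integrable lborel (\<lambda>x. b * u (x + c))"
      using ui integrable_lborel_translate[of u c] by simp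
    have "0 \<le> b" using b[of 0] by linarith
    then show "AE x in lborel. norm (u (x + c) * f (x + d)) \<le> norm (b * u (x + c))"
      using b by (auto simp: abs_mult mult.commute[of b] intro!: mult_left_mono)
  qed measurable
  have "(\<integral>x. (u (x - h) - u x) * f x \<partial>lborel) = (\<integral>x. u (x - h) * f x \<partial>lborel) - (\<integral>x. u x * f x \<partial>lborel)"
    using int[of "-h" 0] int[of 0 0] by (subst Bochner_Integration.integral_diff[symmetric]) (simp_all add: left_diff_distrib)
  \<comment> \<open>Translation invariance moves the difference from \<open>u\<close> onto
    \<open>f\<close>.\<close>
  also have "(\<integral>x. u (x - h) * f x \<partial>lborel) = (\<integral>x. u x * f (x + h) \<partial>lborel)"
    using integral_lborel_translate[of "\<lambda>x. u (x - h) * f x" h] by simp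
  also have "(\<integral>x. u x * f (x + h) \<partial>lborel) - (\<integral>x. u x * f x \<partial>lborel) = (\<integral>x. u x * (f (x + h) - f x) \<partial>lborel)"
    using int[of 0 h] int[of 0 0] by (subst Bochner_Integration.integral_diff[symmetric]) (simp_all add: right_diff_distrib)
  also have "\<dots> = M * (\<integral>x. u x * divergence \<phi> x \<partial>lborel)" using M(1) by (simp add: div)
  also have "\<dots> \<le> M * B" using le M(1) by simp
  finally show ?thesis .
qed

text \<open>By duality it is enough to test against f with |f| <= G. The field built from such an f
  is bounded by norm h times the integral of \<open>G\<close> over a segment, so only line integrals
  of \<open>G\<close> matter and \<open>G\<close> itself may blow up at the boundary.\<close>

lemma weighted_translation_estimate:
  fixes u G :: "'a::euclidean_space \<Rightarrow> real"
  assumes u: "var_bound \<Omega> u B" and W: "open W"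
    and seg: "\<And>x s. x \<in> W \<Longrightarrow> s \<in> {0..1} \<Longrightarrow> x - s *\<^sub>R h \<in> \<Omega>"
    and G: "continuous_on W G" and Gpos: "\<And>x. x \<in> W \<Longrightarrow> G x > 0"
    and M: "M > 0" "\<And>x. ennreal (norm h) * (\<integral>\<^sup>+s\<in>{0..1}. ennreal (G (x + s *\<^sub>R h)) * indicator W (x + s *\<^sub>R h) \<partial>lborel) \<le> ennreal M"
  shows "(\<integral>\<^sup>+x\<in>W. ennreal (\<bar>u x - u (x - h)\<bar> * G x) \<partial>lborel) \<le> ennreal (M * B)"
proof -
  have ui: "integrable lborel u" using u by (simp add: var_bound_def)
  then have [measurable]: "u \<in> borel_measurable borel" by auto
  have "(\<integral>\<^sup>+x\<in>W. ennreal (\<bar>u (x - h) - u x\<bar> * G x) \<partial>lborel) \<le> ennreal (M * B)"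
  proof (rule nn_integral_le_by_C1_duality[OF W _ G Gpos])
    show "integrable lborel (\<lambda>x. u (x - h) - u x)"
      using ui integrable_lborel_translate[of u "-h"] by simp
    fix f assume f: "C1 f" "compact (closure {x. f x \<noteq> 0})" "closure {x. f x \<noteq> 0} \<subseteq> W"
      and fG: "\<And>x. x \<in> W \<Longrightarrow> \<bar>f x\<bar> \<le> G x"
    show "(\<integral>x. (u (x - h) - u x) * f x \<partial>lborel) \<le> M * B"
    proof (rule var_bound_difference_integral_le[OF u f(1,2) _ M(1)])
      show "x - s *\<^sub>R h \<in> \<Omega>" if "x \<in> closure {x. f x \<noteq> 0}" "s \<in> {0..1}" for x s
        using seg f(3) that by blast
      fix x
      have "continuous_on {0..1} (\<lambda>s. f (x + s *\<^sub>R h))"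
        by (rule continuous_on_compose2[OF C1_continuous[OF f(1)]]) (auto intro!: continuous_intros)
      then have I: "(\<lambda>s. f (x + s *\<^sub>R h)) integrable_on {0..1}" "(\<lambda>s. \<bar>f (x + s *\<^sub>R h)\<bar>) integrable_on {0..1}"
        by (auto intro!: integrable_continuous_interval continuous_intros)
      have [measurable]: "f \<in> borel_measurable borel"
        using C1_continuous[OF f(1)] by (simp add: borel_measurable_continuous_onI)
      have "\<bar>integral {0..1} (\<lambda>s. f (x + s *\<^sub>R h))\<bar> \<le> integral {0..1} (\<lambda>s. \<bar>f (x + s *\<^sub>R h)\<bar>)"
        using integral_norm_bound_integral[OF I] by simp
      moreover have "ennreal (integral {0..1} (\<lambda>s. \<bar>f (x + s *\<^sub>R h)\<bar>))
          = (\<integral>\<^sup>+s\<in>{0..1}. ennreal \<bar>f (x + s *\<^sub>R h)\<bar> \<partial>lborel)"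
        using nn_integral_has_integral_lebesgue'[of "{0..1}" "\<lambda>s. \<bar>f (x + s *\<^sub>R h)\<bar>"] integrable_integral[OF I(2)]
        by simp
      moreover have "(\<integral>\<^sup>+s\<in>{0..1}. ennreal \<bar>f (x + s *\<^sub>R h)\<bar> \<partial>lborel)
        \<le> (\<integral>\<^sup>+s\<in>{0..1}. ennreal (G (x + s *\<^sub>R h)) * indicator W (x + s *\<^sub>R h) \<partial>lborel)"
      proof (rule nn_integral_mono)
        fix s
        show "ennreal \<bar>f (x + s *\<^sub>R h)\<bar> * indicator {0..1} s \<le> ennreal (G (x + s *\<^sub>R h)) * indicator W (x + s *\<^sub>R h) * indicator {0..1} s"
        proof (cases "x + s *\<^sub>R h \<in> W")
          case True
          then show ?thesis using fG by (auto simp: indicator_def intro!: ennreal_leI)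
        next
          case False
          then have "f (x + s *\<^sub>R h) = 0" using f(3) closure_subset[of "{x. f x \<noteq> 0}"] by auto
          then show ?thesis by simp
        qed
      qed
      ultimately have "ennreal (norm h * \<bar>integral {0..1} (\<lambda>s. f (x + s *\<^sub>R h))\<bar>)
        \<le> ennreal (norm h) * (\<integral>\<^sup>+s\<in>{0..1}. ennreal (G (x + s *\<^sub>R h)) * indicator W (x + s *\<^sub>R h) \<partial>lborel)"
        unfolding ennreal_mult'[OF norm_ge_zero]
        by (intro mult_left_mono) (auto intro: order_trans[OF ennreal_leI])
      also have "\<dots> \<le> ennreal M" by (rule M(2))
      finally show "norm h * \<bar>integral {0..1} (\<lambda>s. f (x + s *\<^sub>R h))\<bar> \<le> M" using M(1) by (simp add: ennreal_le_iff)
    qed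
  qed
  then show ?thesis by (simp add: abs_minus_commute)
qed

section \<open>Interior Poincare inequality\<close>


lemma var_boundD:
  assumes "var_bound \<Omega> u B"
  shows "integrable lborel u" "u \<in> borel_measurable borel" "0 \<le> B"
  using assms by (auto simp: var_bound_def dest: borel_measurable_integrable)

text \<open>A double integral rather than the deviation from a mean: it is symmetric and obeys a
  triangle inequality in the sets, which is what chaining needs.\<close>

definition osc :: "('a::euclidean_space \<Rightarrow> real) \<Rightarrow> 'a set \<Rightarrow> 'a set \<Rightarrow> ennreal" where
  "osc u A A' = (\<integral>\<^sup>+x. (\<integral>\<^sup>+y. ennreal \<bar>u x - u y\<bar> * indicator A' y \<partial>lborel) * indicator A x \<partial>lborel)"

text \<open>Substitute y = x + h and apply Fubini. For fixed h, when x and x + h both lie in the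
  ball, convexity keeps the segment between them inside, so the translation estimate with weight 1
  gives 2 r B. Only norm h < 2 r contributes, whence the volume factor.\<close>

lemma osc_ball_le:
  fixes u :: "'a::euclidean_space \<Rightarrow> real"
  assumes u: "var_bound \<Omega> u B" and sub: "ball a r \<subseteq> \<Omega>" and r: "r > 0"
  shows "osc u (ball a r) (ball a r) \<le> ennreal (2 * r * measure lborel (ball (0::'a) (2 * r)) * B)"
proof -
  note [measurable] = var_boundD(2)[OF u]
  have [measurable]: "ball a r \<in> sets borel" by simp
  let ?i = "indicator (ball a r) :: 'a \<Rightarrow> ennreal"
  have "osc u (ball a r) (ball a r)
      = (\<integral>\<^sup>+x. (\<integral>\<^sup>+y. ennreal \<bar>u x - u y\<bar> * ?i y * ?i x \<partial>lborel) \<partial>lborel)"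
    unfolding osc_def by (intro nn_integral_cong nn_integral_multc[symmetric]) measurable
  also have "\<dots> = (\<integral>\<^sup>+x. (\<integral>\<^sup>+h. ennreal \<bar>u x - u (h + x)\<bar> * ?i (h + x) * ?i x \<partial>lborel) \<partial>lborel)"
  proof (rule nn_integral_cong)
    fix x
    show "(\<integral>\<^sup>+y. ennreal \<bar>u x - u y\<bar> * ?i y * ?i x \<partial>lborel) = (\<integral>\<^sup>+h. ennreal \<bar>u x - u (h + x)\<bar> * ?i (h + x) * ?i x \<partial>lborel)"
      by (rule nn_integral_lborel_translate[symmetric]) measurable
  qed
  also have "\<dots> = (\<integral>\<^sup>+h. (\<integral>\<^sup>+x. ennreal \<bar>u x - u (h + x)\<bar> * ?i (h + x) * ?i x \<partial>lborel) \<partial>lborel)"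
    by (rule lborel_pair.Fubini') measurable
  also have "\<dots> \<le> (\<integral>\<^sup>+h\<in>ball (0::'a) (2 * r). ennreal (2 * r * B) \<partial>lborel)"
  proof (rule nn_integral_mono)
    fix h :: 'a
    define W where "W = ball a r \<inter> {x. h + x \<in> ball a r}"
    have W: "open W"
    proof -
      have "{x. h + x \<in> ball a r} = (\<lambda>x. h + x) -` ball a r" by auto
      moreover have "open ((\<lambda>x. h + x) -` ball a r)"
        by (intro open_vimage continuous_intros) auto
      ultimately show ?thesis by (auto simp: W_def)
    qed
    show "(\<integral>\<^sup>+x. ennreal \<bar>u x - u (h + x)\<bar> * ?i (h + x) * ?i x \<partial>lborel) \<le> ennreal (2 * r * B) * indicator (ball (0::'a) (2 * r)) h"
    proof (cases "norm h < 2 * r")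
      case True
      have "(\<integral>\<^sup>+x\<in>W. ennreal (\<bar>u x - u (x - (-h))\<bar> * 1) \<partial>lborel) \<le> ennreal (2 * r * B)"
      proof (rule weighted_translation_estimate[OF u W])
        fix x and s :: real assume *: "x \<in> W" "s \<in> {0..1}"
        then have "(1 - s) *\<^sub>R x + s *\<^sub>R (h + x) \<in> ball a r"
          by (intro convexD[OF convex_ball]) (auto simp: W_def)
        then show "x - s *\<^sub>R - h \<in> \<Omega>" using sub by (auto simp: algebra_simps)
      next
        fix x
        have "(\<integral>\<^sup>+s\<in>{0..1}. ennreal 1 * indicator W (x + s *\<^sub>R - h) \<partial>lborel) \<le> (\<integral>\<^sup>+s. indicator {0..1::real} s \<partial>lborel)"
          by (intro nn_integral_mono) (auto simp: indicator_def)
        also have "\<dots> = 1" by simp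
        finally have "ennreal (norm (-h)) * (\<integral>\<^sup>+s\<in>{0..1}. ennreal 1 * indicator W (x + s *\<^sub>R - h) \<partial>lborel) \<le> ennreal (norm (-h)) * 1"
          by (intro mult_left_mono) auto
        also have "\<dots> \<le> ennreal (2 * r)" using True by (auto intro!: ennreal_leI)
        finally show "ennreal (norm (-h)) * (\<integral>\<^sup>+s\<in>{0..1}. ennreal 1 * indicator W (x + s *\<^sub>R - h) \<partial>lborel) \<le> ennreal (2 * r)" .
      qed (use r in auto)
      moreover have "(\<integral>\<^sup>+x. ennreal \<bar>u x - u (h + x)\<bar> * ?i (h + x) * ?i x \<partial>lborel) = (\<integral>\<^sup>+x\<in>W. ennreal (\<bar>u x - u (x - (-h))\<bar> * 1) \<partial>lborel)"
        by (intro nn_integral_cong) (auto simp: W_def indicator_def add.commute)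
      ultimately show ?thesis using True by simp
    next
      case False
      have "?i (h + x) * ?i x = 0" for x
      proof -
        have "dist x (h + x) \<le> dist a x + dist a (h + x)" by (metis dist_commute dist_triangle)
        then show ?thesis using False by (auto simp: indicator_def dist_norm)
      qed
      then have "ennreal \<bar>u x - u (h + x)\<bar> * ?i (h + x) * ?i x = 0" for x by (simp add: mult.assoc)
      then have "(\<integral>\<^sup>+x. ennreal \<bar>u x - u (h + x)\<bar> * ?i (h + x) * ?i x \<partial>lborel) = 0"
        by (simp only: nn_integral_const mult_zero_left)
      then show ?thesis by (metis zero_le)
    qed
  qed
  also have "\<dots> = ennreal (2 * r * measure lborel (ball (0::'a) (2 * r)) * B)"
    using r var_boundD(3)[OF u] emeasure_lborel_ball_finite[of "0::'a" "2 * r"]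
    by (simp add: nn_integral_cmult_indicator emeasure_eq_ennreal_measure ennreal_mult[symmetric] mult_ac less_top[symmetric])
  finally show ?thesis .
qed

lemma osc_mono: "A \<subseteq> C \<Longrightarrow> A' \<subseteq> C' \<Longrightarrow> osc u A A' \<le> osc u C C'"
  unfolding osc_def by (intro nn_integral_mono mult_mono) (auto simp: indicator_def)

lemma osc_commute:
  assumes [measurable]: "u \<in> borel_measurable borel" "A \<in> sets borel" "A' \<in> sets borel"
  shows "osc u A A' = osc u A' A"
proof -
  have "osc u A A' = (\<integral>\<^sup>+x. (\<integral>\<^sup>+y. ennreal \<bar>u x - u y\<bar> * indicator A' y * indicator A x \<partial>lborel) \<partial>lborel)"
    unfolding osc_def by (intro nn_integral_cong nn_integral_multc[symmetric]) measurable
  also have "\<dots> = (\<integral>\<^sup>+y. (\<integral>\<^sup>+x. ennreal \<bar>u x - u y\<bar> * indicator A' y * indicator A x \<partial>lborel) \<partial>lborel)"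
    by (rule lborel_pair.Fubini') measurable
  also have "\<dots> = (\<integral>\<^sup>+y. (\<integral>\<^sup>+x. ennreal \<bar>u y - u x\<bar> * indicator A x * indicator A' y \<partial>lborel) \<partial>lborel)"
    by (simp add: abs_minus_commute mult_ac)
  also have "\<dots> = osc u A' A"
    unfolding osc_def by (intro nn_integral_cong nn_integral_multc) measurable
  finally show ?thesis .
qed

text \<open>Integrate |u x - u z| <= |u x - u y| + |u z - u y| over y in \<open>D\<close>. The
  product form avoids dividing by a measure that may be zero or infinite.\<close>

lemma osc_triangle:
  assumes [measurable]: "u \<in> borel_measurable borel" "A \<in> sets borel" "D \<in> sets borel" "E \<in> sets borel"
  shows "emeasure lborel D * osc u A E \<le> emeasure lborel E * osc u A D + emeasure lborel A * osc u E D"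
proof -
  define g where "g = (\<lambda>x. \<integral>\<^sup>+y. ennreal \<bar>u x - u y\<bar> * indicator D y \<partial>lborel)"
  have [measurable]: "g \<in> borel_measurable borel" unfolding g_def by measurable
  have tri: "emeasure lborel D * ennreal \<bar>u x - u z\<bar> \<le> g x + g z" for x z
  proof -
    have "emeasure lborel D * ennreal \<bar>u x - u z\<bar> = (\<integral>\<^sup>+y. ennreal \<bar>u x - u z\<bar> * indicator D y \<partial>lborel)"
      by (subst nn_integral_cmult_indicator) (simp_all add: mult.commute)
    also have "\<dots> \<le> (\<integral>\<^sup>+y. ennreal \<bar>u x - u y\<bar> * indicator D y + ennreal \<bar>u z - u y\<bar> * indicator D y \<partial>lborel)"
      by (intro nn_integral_mono) (auto simp: indicator_def ennreal_plus[symmetric] simp del: ennreal_plus intro!: ennreal_leI)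
    also have "\<dots> = g x + g z" unfolding g_def by (intro nn_integral_add) measurable
    finally show ?thesis .
  qed
  have "emeasure lborel D * osc u A E = (\<integral>\<^sup>+x. (\<integral>\<^sup>+z. emeasure lborel D * ennreal \<bar>u x - u z\<bar> * indicator E z \<partial>lborel) * indicator A x \<partial>lborel)"
    unfolding osc_def by (simp add: nn_integral_cmult mult.assoc)
  also have "\<dots> \<le> (\<integral>\<^sup>+x. (\<integral>\<^sup>+z\<in>E. (g x + g z) \<partial>lborel) * indicator A x \<partial>lborel)"
    by (intro nn_integral_mono mult_right_mono tri) auto
  also have "\<dots> = (\<integral>\<^sup>+x. (emeasure lborel E * (g x * indicator A x) + osc u E D * indicator A x) \<partial>lborel)"
  proof (intro nn_integral_cong)
    fix x
    have "(\<integral>\<^sup>+z\<in>E. (g x + g z) \<partial>lborel) = (\<integral>\<^sup>+z. g x * indicator E z + g z * indicator E z \<partial>lborel)"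
      by (simp add: distrib_right)
    also have "\<dots> = g x * emeasure lborel E + osc u E D"
      by (subst nn_integral_add) (auto simp: nn_integral_cmult_indicator osc_def g_def)
    finally show "(\<integral>\<^sup>+z\<in>E. (g x + g z) \<partial>lborel) * indicator A x = emeasure lborel E * (g x * indicator A x) + osc u E D * indicator A x"
      by (simp only: ring_distribs mult_ac)
  qed
  also have "\<dots> = emeasure lborel E * osc u A D + emeasure lborel A * osc u E D"
  proof -
    have "(\<integral>\<^sup>+x\<in>A. g x \<partial>lborel) = osc u A D" by (simp add: osc_def g_def)
    moreover have "(\<integral>\<^sup>+x. emeasure lborel E * (g x * indicator A x) \<partial>lborel)
        = emeasure lborel E * (\<integral>\<^sup>+x\<in>A. g x \<partial>lborel)"
      by (rule nn_integral_cmult) measurable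
    moreover have "(\<integral>\<^sup>+x\<in>A. osc u E D \<partial>lborel) = emeasure lborel A * osc u E D"
      by (subst nn_integral_cmult_indicator) (auto simp: mult.commute)
    ultimately show ?thesis by (subst nn_integral_add) auto
  qed
  finally show ?thesis .
qed

text \<open>Having some pair of balls with controlled mutual oscillation is a symmetric and
  transitive relation between centres that holds locally, so connectedness spreads it over the
  domain. The constant is chosen before \<open>u\<close> and \<open>B\<close>.\<close>

lemma osc_balls_connected:
  fixes \<Omega> :: "'a::euclidean_space set"
  assumes "open \<Omega>" "connected \<Omega>" "a \<in> \<Omega>" "b \<in> \<Omega>"
  shows "\<exists>r>0. \<exists>s>0. \<exists>C\<ge>0. \<forall>u B. var_bound \<Omega> u B \<longrightarrow> osc u (ball a r) (ball b s) \<le> ennreal (C * B)"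
proof (rule connected_equivalence_relation[OF assms(2-4), where R = "\<lambda>a b. \<exists>r>0. \<exists>s>0. \<exists>C\<ge>0. \<forall>u B. var_bound \<Omega> u B \<longrightarrow> osc u (ball a r) (ball b s) \<le> ennreal (C * B)"])
  fix x y
  assume "\<exists>r>0. \<exists>s>0. \<exists>C\<ge>0. \<forall>u B. var_bound \<Omega> u B \<longrightarrow> osc u (ball x r) (ball y s) \<le> ennreal (C * B)"
  then show "\<exists>r>0. \<exists>s>0. \<exists>C\<ge>0. \<forall>u B. var_bound \<Omega> u B \<longrightarrow> osc u (ball y r) (ball x s) \<le> ennreal (C * B)"
    by (metis osc_commute[of _ "ball x _" "ball y _"] borel_open[OF open_ball] var_boundD(2))
next
  fix x y z
  assume "\<exists>r>0. \<exists>s>0. \<exists>C\<ge>0. \<forall>u B. var_bound \<Omega> u B \<longrightarrow> osc u (ball x r) (ball y s) \<le> ennreal (C * B)"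
  then obtain r s C where 1: "r > 0" "s > 0" "C \<ge> 0" and
    o1: "\<And>u B. var_bound \<Omega> u B \<Longrightarrow> osc u (ball x r) (ball y s) \<le> ennreal (C * B)" by blast
  assume "\<exists>r>0. \<exists>s>0. \<exists>C\<ge>0. \<forall>u B. var_bound \<Omega> u B \<longrightarrow> osc u (ball y r) (ball z s) \<le> ennreal (C * B)"
  then obtain r' s' C' where 2: "r' > 0" "s' > 0" "C' \<ge> 0" and
    o2: "\<And>u B. var_bound \<Omega> u B \<Longrightarrow> osc u (ball y r') (ball z s') \<le> ennreal (C' * B)" by blast
  \<comment> \<open>The two assumptions come with different balls at y. Both survive restriction to
    the smaller one, which plays the role of \<open>D\<close> in
    \<open>osc_triangle\<close>.\<close>
  define t where "t = min s r'"
  have t: "t > 0" using 1 2 by (simp add: t_def)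
  define m where "m = (\<lambda>a \<rho>. measure lborel (ball (a::'a) \<rho>))"
  have em: "emeasure lborel (ball a \<rho>) = ennreal (m a \<rho>)" for a \<rho>
    using emeasure_lborel_ball_finite[of a \<rho>] by (simp add: m_def emeasure_eq_ennreal_measure less_top)
  have mpos: "m y t > 0" using t by (simp add: m_def content_ball_pos)
  have m0: "m a \<rho> \<ge> 0" for a \<rho> by (simp add: m_def)
  show "\<exists>r>0. \<exists>s>0. \<exists>C\<ge>0. \<forall>u B. var_bound \<Omega> u B \<longrightarrow> osc u (ball x r) (ball z s) \<le> ennreal (C * B)"
  proof (intro exI conjI allI impI)
    fix u B assume u: "var_bound \<Omega> u B"
    note [measurable] = var_boundD(2)[OF u]
    have B: "B \<ge> 0" using var_boundD[OF u] by simp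
    have "osc u (ball x r) (ball y t) \<le> ennreal (C * B)"
      using o1[OF u] osc_mono[OF order_refl subset_ball[of t s y], of u "ball x r"] by (auto simp: t_def)
    moreover have "osc u (ball z s') (ball y t) \<le> ennreal (C' * B)"
      using o2[OF u] osc_mono[OF subset_ball[of t r' y] order_refl, of u "ball z s'"] osc_commute[of u "ball z s'" "ball y t"]
      by (auto simp: t_def)
    ultimately have "ennreal (m z s') * osc u (ball x r) (ball y t) + ennreal (m x r) * osc u (ball z s') (ball y t)
        \<le> ennreal (m z s') * ennreal (C * B) + ennreal (m x r) * ennreal (C' * B)"
      by (intro add_mono mult_left_mono) auto
    also have "\<dots> = ennreal (m z s' * C * B + m x r * C' * B)"
      using B 1 2 m0 by (simp add: ennreal_mult[symmetric] ennreal_plus[symmetric] mult_ac del: ennreal_plus)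
    finally have "ennreal (m y t) * osc u (ball x r) (ball z s') \<le> ennreal (m z s' * C * B + m x r * C' * B)"
      using osc_triangle[of u "ball x r" "ball y t" "ball z s'"] by (simp add: em)
    then have "ennreal (1 / m y t) * (ennreal (m y t) * osc u (ball x r) (ball z s'))
        \<le> ennreal (1 / m y t) * ennreal (m z s' * C * B + m x r * C' * B)"
      by (intro mult_left_mono) auto
    then show "osc u (ball x r) (ball z s') \<le> ennreal ((m z s' * C + m x r * C') / m y t * B)"
      using mpos m0 by (simp add: mult.assoc[symmetric] ennreal_mult[symmetric] ennreal_mult'[symmetric] add_divide_distrib distrib_right)
  qed (use 1 2 mpos m0 in \<open>auto intro!: divide_nonneg_pos add_nonneg_nonneg mult_nonneg_nonneg\<close>)
next
  fix a assume a: "a \<in> \<Omega>"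
  then obtain r where r: "r > 0" "ball a r \<subseteq> \<Omega>" using \<open>open \<Omega>\<close> open_contains_ball by blast
  have "\<exists>r>0. \<exists>s>0. \<exists>C\<ge>0. \<forall>u B. var_bound \<Omega> u B \<longrightarrow> osc u (ball a r) (ball b s) \<le> ennreal (C * B)" if b: "b \<in> ball a r" for b
  proof -
    obtain s where s: "s > 0" "ball b s \<subseteq> ball a r" using openE[OF open_ball b] by blast
    show ?thesis
    proof (intro exI conjI allI impI)
      fix u B assume u: "var_bound \<Omega> u B"
      show "osc u (ball a r) (ball b s) \<le> ennreal (2 * r * measure lborel (ball (0::'a) (2 * r)) * B)"
        using osc_ball_le[OF u r(2,1)] osc_mono[OF order_refl s(2), of u "ball a r"] by (rule order_trans[rotated])
    qed (use r s in auto)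
  qed
  then show "\<exists>T. openin (top_of_set \<Omega>) T \<and> a \<in> T \<and> (\<forall>x\<in>T. \<exists>r>0. \<exists>s>0. \<exists>C\<ge>0. \<forall>u B. var_bound \<Omega> u B \<longrightarrow> osc u (ball a r) (ball x s) \<le> ennreal (C * B))"
    using r by (intro exI[of _ "ball a r"]) (auto intro: open_subset)
qed

abbreviation deviation :: "('a::euclidean_space \<Rightarrow> real) \<Rightarrow> real \<Rightarrow> 'a set \<Rightarrow> ennreal" where
  "deviation u c K \<equiv> \<integral>\<^sup>+x. ennreal \<bar>u x - c\<bar> * indicator K x \<partial>lborel"

text \<open>Finitely many of the target balls cover \<open>K\<close>, and the corresponding balls
  around the base point \<open>a\<close> are cut to a common one, \<open>A\<close>. The mean over x
  in \<open>A\<close> of the deviation of \<open>u\<close> on \<open>K\<close> from u x is then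
  controlled by \<open>B\<close>; some x does at least as well as the mean, and c = u x.\<close>

proposition interior_Poincare:
  fixes \<Omega> :: "'a::euclidean_space set"
  assumes \<Omega>: "open \<Omega>" "connected \<Omega>" "\<Omega> \<noteq> {}" and K: "compact K" "K \<subseteq> \<Omega>"
  obtains C where "C \<ge> 0" "\<And>u B. var_bound \<Omega> u B \<Longrightarrow> \<exists>c. deviation u c K \<le> ennreal (C * B)"
proof (cases "K = {}")
  case True
  then show ?thesis by (intro that[of 0]) auto
next
  case False
  obtain a where a: "a \<in> \<Omega>" using \<Omega> by blast
  have "\<forall>b\<in>K. \<exists>r s C. r > 0 \<and> s > 0 \<and> C \<ge> 0 \<and> (\<forall>u B. var_bound \<Omega> u B \<longrightarrow> osc u (ball a r) (ball b s) \<le> ennreal (C * B))"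
    using osc_balls_connected[OF \<Omega>(1,2) a] K(2) by (meson subsetD)
  then obtain r s C where rs: "\<And>b. b \<in> K \<Longrightarrow> r b > 0" "\<And>b. b \<in> K \<Longrightarrow> s b > 0" "\<And>b. b \<in> K \<Longrightarrow> C b \<ge> (0::real)"
    and o: "\<And>b u B. b \<in> K \<Longrightarrow> var_bound \<Omega> u B \<Longrightarrow> osc u (ball a (r b)) (ball b (s b)) \<le> ennreal (C b * B)"
    by metis
  obtain T where T: "T \<subseteq> K" "finite T" "K \<subseteq> (\<Union>b\<in>T. ball b (s b))"
  proof (rule compactE_image[OF K(1), of K "\<lambda>b. ball b (s b)"])
    show "K \<subseteq> (\<Union>b\<in>K. ball b (s b))" using rs(2) by force
  qed auto
  then have "T \<noteq> {}" using False by auto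
  define \<rho> where "\<rho> = Min (r ` T)"
  have \<rho>: "\<rho> > 0" "\<And>b. b \<in> T \<Longrightarrow> \<rho> \<le> r b"
    using T \<open>T \<noteq> {}\<close> rs(1) by (auto simp: \<rho>_def subset_eq)
  define A where "A = ball a \<rho>"
  define m where "m = measure lborel A"
  have m: "m > 0" "emeasure lborel A = ennreal m"
    using \<rho>(1) emeasure_lborel_ball_finite[of a \<rho>]
    by (auto simp: m_def A_def content_ball_pos emeasure_eq_ennreal_measure less_top)
  have [measurable]: "A \<in> sets borel" "K \<in> sets borel"
    using K by (auto simp: A_def borel_closed compact_imp_closed)
  have [measurable]: "ball b t \<in> sets borel" for b :: 'a and t by simp
  show ?thesis
  proof (rule that)
    show "(\<Sum>b\<in>T. C b) / m \<ge> 0" using m T rs(3) by (intro divide_nonneg_pos sum_nonneg) auto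
    fix u B assume u: "var_bound \<Omega> u B"
    note [measurable] = var_boundD(2)[OF u]
    have B: "B \<ge> 0" using var_boundD[OF u] by simp
    define g where "g = (\<lambda>x. \<integral>\<^sup>+y. ennreal \<bar>u y - u x\<bar> * indicator K y \<partial>lborel)"
    have [measurable]: "g \<in> borel_measurable borel" unfolding g_def by measurable
    have "(\<integral>\<^sup>+x\<in>A. g x \<partial>lborel) \<le> (\<integral>\<^sup>+x. (\<Sum>b\<in>T. (\<integral>\<^sup>+y. ennreal \<bar>u x - u y\<bar> * indicator (ball b (s b)) y \<partial>lborel)) * indicator A x \<partial>lborel)"
    proof (intro nn_integral_mono mult_right_mono)
      fix x
      have "g x \<le> (\<integral>\<^sup>+y. (\<Sum>b\<in>T. ennreal \<bar>u x - u y\<bar> * indicator (ball b (s b)) y) \<partial>lborel)"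
        unfolding g_def
      proof (rule nn_integral_mono)
        fix y
        show "ennreal \<bar>u y - u x\<bar> * indicator K y \<le> (\<Sum>b\<in>T. ennreal \<bar>u x - u y\<bar> * indicator (ball b (s b)) y)"
        proof (cases "y \<in> K")
          case True
          then obtain b where b: "b \<in> T" "y \<in> ball b (s b)" using T by blast
          have "ennreal \<bar>u x - u y\<bar> * indicator (ball b (s b)) y \<le> (\<Sum>b\<in>T. ennreal \<bar>u x - u y\<bar> * indicator (ball b (s b)) y)"
            using b T by (intro member_le_sum) auto
          then show ?thesis using b True by (simp add: abs_minus_commute)
        qed simp
      qed
      also have "\<dots> = (\<Sum>b\<in>T. (\<integral>\<^sup>+y. ennreal \<bar>u x - u y\<bar> * indicator (ball b (s b)) y \<partial>lborel))"
        by (intro nn_integral_sum) measurable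
      finally show "g x \<le> \<dots>" .
    qed auto
    also have "\<dots> = (\<Sum>b\<in>T. osc u A (ball b (s b)))"
      unfolding osc_def sum_distrib_right by (intro nn_integral_sum) measurable
    also have "\<dots> \<le> (\<Sum>b\<in>T. ennreal (C b * B))"
    proof (rule sum_mono)
      fix b assume b: "b \<in> T"
      have "A \<subseteq> ball a (r b)" using \<rho>(2)[OF b] by (auto simp: A_def)
      then show "osc u A (ball b (s b)) \<le> ennreal (C b * B)"
        using o[OF _ u, of b] b T osc_mono[of A "ball a (r b)" "ball b (s b)" "ball b (s b)" u] by (auto intro: order_trans)
    qed
    also have "\<dots> = ennreal ((\<Sum>b\<in>T. C b) * B)"
      using rs(3) B T by (subst sum_ennreal) (auto simp: sum_distrib_right)
    finally have le: "(\<integral>\<^sup>+x\<in>A. g x \<partial>lborel) \<le> ennreal ((\<Sum>b\<in>T. C b) * B)" .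
    define t where "t = ennreal ((\<Sum>b\<in>T. C b) / m * B)"
    have "\<exists>x\<in>A. g x \<le> t"
    proof (rule ccontr)
      assume "\<not> ?thesis"
      then have gt: "\<And>x. x \<in> A \<Longrightarrow> t < g x" by force
      have int: "(\<integral>\<^sup>+x\<in>A. t \<partial>lborel) = ennreal ((\<Sum>b\<in>T. C b) * B)"
        using m by (simp add: nn_integral_cmult_indicator t_def ennreal_mult''[symmetric])
      have "(\<integral>\<^sup>+x\<in>A. t \<partial>lborel) < (\<integral>\<^sup>+x\<in>A. g x \<partial>lborel)"
      proof (rule nn_integral_less)
        show "AE x in lborel. t * indicator A x \<le> g x * indicator A x"
          using gt by (auto simp: indicator_def less_imp_le)
        show "\<not> (AE x in lborel. g x * indicator A x \<le> t * indicator A x)"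
        proof
          assume "AE x in lborel. g x * indicator A x \<le> t * indicator A x"
          then have "AE x in lborel. x \<notin> A"
            by eventually_elim (use gt in \<open>force simp: indicator_def\<close>)
          then have "emeasure lborel A = 0" by (subst (asm) AE_iff_measurable[OF _ refl]) auto
          then show False using m by simp
        qed
      qed (use int in \<open>auto simp: t_def\<close>)
      then show False using le int by simp
    qed
    then show "\<exists>c. deviation u c K \<le> ennreal ((\<Sum>b\<in>T. C b) / m * B)"
      by (auto simp: g_def t_def)
  qed
qed

section \<open>Boundary charts and weights\<close>


text \<open>\<open>h\<close> is the height of the boundary graph above the point, measured along \<open>e\<close>.\<close>
definition chart :: "'a::euclidean_space set \<Rightarrow> 'a \<Rightarrow> real \<Rightarrow> 'a \<Rightarrow> ('a \<Rightarrow> real) \<Rightarrow> real \<Rightarrow> bool" where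
  "chart \<Omega> z r e h L \<longleftrightarrow> z \<in> frontier \<Omega> \<and> r > 0 \<and> norm e = 1 \<and> L \<ge> 1 \<and>
     (\<forall>x y. \<bar>h x - h y\<bar> \<le> L * dist x y) \<and> (\<forall>x s. h (x + s *\<^sub>R e) = h x - s) \<and> h z = 0 \<and>
     (\<forall>x\<in>ball z r. x \<in> \<Omega> \<longleftrightarrow> h x > 0)"

lemma chartD:
  assumes "chart \<Omega> z r e h L"
  shows "z \<in> frontier \<Omega>" "r > 0" "norm e = 1" "L \<ge> 1" "\<bar>h x - h y\<bar> \<le> L * dist x y"
    "h (x + s *\<^sub>R e) = h x - s" "h z = 0" "dist z x < r \<Longrightarrow> x \<in> \<Omega> \<longleftrightarrow> h x > 0"
  using assms unfolding chart_def by auto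

text \<open>The height is \<gamma> of the projection minus the coordinate along \<open>e\<close>;
  the projection contracts distances, so l + 1 is a Lipschitz constant. A frontier point z has
  height 0: it lies outside the open set, so its height is at most 0, and a negative height would
  persist nearby and exclude points of \<Omega> close to z.\<close>

lemma chart_exists:
  fixes \<Omega> :: "'a::euclidean_space set"
  assumes "lipschitz_boundary \<Omega>" "open \<Omega>" and z: "z \<in> frontier \<Omega>"
  obtains r e h L where "chart \<Omega> z r e h L"
proof -
  obtain r e \<gamma> l where r: "r > 0" and e: "norm e = 1" and l: "l-lipschitz_on {y. e \<bullet> y = 0} \<gamma>"
    and eq: "\<Omega> \<inter> ball z r = {x \<in> ball z r. e \<bullet> x < \<gamma> (x - (e \<bullet> x) *\<^sub>R e)}"
    using assms(1) z unfolding lipschitz_boundary_def by blast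
  define p where "p = (\<lambda>x. x - (e \<bullet> x) *\<^sub>R e)"
  define h where "h = (\<lambda>x. \<gamma> (p x) - e \<bullet> x)"
  have ee: "e \<bullet> e = 1" using e by (simp add: norm_eq_1)
  have p0: "e \<bullet> p x = 0" for x by (simp add: p_def inner_diff_right ee)
  have l0: "l \<ge> 0" using l by (rule lipschitz_on_nonneg)
  have pn: "norm (p x) \<le> norm x" for x
  proof -
    have "(norm (p x))\<^sup>2 = (norm x)\<^sup>2 - (e \<bullet> x)\<^sup>2"
      unfolding power2_norm_eq_inner p_def
      by (simp add: inner_diff_left inner_diff_right ee inner_commute power2_eq_square)
    then show ?thesis by (metis diff_le_0_iff_le norm_ge_zero power2_le_imp_le add_diff_cancel_left' diff_add_cancel le_add_same_cancel2 zero_le_power2 add.commute)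
  qed
  have lip: "\<bar>h x - h y\<bar> \<le> (l + 1) * dist x y" for x y
  proof -
    have "\<bar>\<gamma> (p x) - \<gamma> (p y)\<bar> \<le> l * dist (p x) (p y)"
      using lipschitz_onD[OF l, of "p x" "p y"] p0 by (simp add: dist_real_def)
    also have "dist (p x) (p y) \<le> dist x y"
      using pn[of "x - y"] by (simp add: dist_norm p_def inner_diff_right algebra_simps)
    finally have "\<bar>\<gamma> (p x) - \<gamma> (p y)\<bar> \<le> l * dist x y" using l0 by (simp add: mult_left_mono)
    moreover have "\<bar>e \<bullet> x - e \<bullet> y\<bar> \<le> dist x y"
      using Cauchy_Schwarz_ineq2[of e "x - y"] e by (simp add: dist_norm inner_diff_right)
    ultimately show ?thesis unfolding h_def by (simp add: distrib_right)
  qed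
  have tr: "h (x + s *\<^sub>R e) = h x - s" for x s
  proof -
    have "p (x + s *\<^sub>R e) = p x" by (simp add: p_def inner_add_right ee algebra_simps)
    then show ?thesis by (simp add: h_def inner_add_right ee)
  qed
  have char: "x \<in> \<Omega> \<longleftrightarrow> h x > 0" if "x \<in> ball z r" for x
    using eq that by (auto simp: h_def p_def set_eq_iff)
  have "z \<notin> \<Omega>" using z \<open>open \<Omega>\<close> by (simp add: frontier_def interior_open)
  then have "h z \<le> 0" using char[of z] r by simp
  moreover have "\<not> h z < 0"
  proof
    assume neg: "h z < 0"
    have "min r (- h z / (l + 1)) > 0" using r neg l0 by (auto intro!: divide_neg_pos)
    then obtain y where y: "y \<in> \<Omega>" "dist y z < min r (- h z / (l + 1))"
      using z unfolding frontier_def by (metis DiffD1 closure_approachable)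
    then have "h y > 0" using char[of y] by (simp add: dist_commute)
    moreover have "(l + 1) * dist y z < - h z"
      using y(2) l0 pos_less_divide_eq[of "l + 1" "dist y z" "- h z"] by (simp add: mult.commute)
    ultimately show False using lip[of y z] by linarith
  qed
  ultimately have "h z = 0" by simp
  then have "chart \<Omega> z r e h (l + 1)" unfolding chart_def using z r e l0 lip tr char by auto
  then show ?thesis using that by blast
qed

text \<open>A frontier point y in the chart ball has height at most 0, since a positive height would
  persist nearby and make y interior; the Lipschitz bound then gives h x <= L dist x y. A frontier
  point outside the ball is farther from x than z is, and z has height 0.\<close>

lemma chart_height_le_bdist:
  assumes c: "chart \<Omega> z r e h L" and x: "dist z x < r / 2"
  shows "h x \<le> L * bdist \<Omega> x"
proof -
  have ne: "frontier \<Omega> \<noteq> {}" and L: "L \<ge> 1" using c by (auto simp: chart_def)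
  have "h x / L \<le> dist x y" if y: "y \<in> frontier \<Omega>" for y
  proof (cases "y \<in> ball z r")
    case True
    have "h y \<le> 0"
    proof (rule ccontr)
      assume "\<not> h y \<le> 0"
      have lip: "\<bar>h y' - h y\<bar> \<le> L * dist y' y" for y' using c by (simp add: chart_def)
      have "min (r - dist z y) (h y / L) > 0" using True L \<open>\<not> h y \<le> 0\<close> by auto
      moreover have "y' \<in> \<Omega>" if "dist y' y < min (r - dist z y) (h y / L)" for y'
      proof -
        have "dist z y' < r" using that dist_triangle[of z y' y] by (simp add: dist_commute)
        moreover have "L * dist y' y < h y" using that L by (simp add: pos_less_divide_eq mult.commute)
        ultimately show ?thesis using lip[of y'] chartD(8)[OF c, of y'] by linarith
      qed
      ultimately have "y \<in> interior \<Omega>"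
        unfolding mem_interior by (metis dist_commute mem_ball subsetI)
      then show False using y by (simp add: frontier_def)
    qed
    moreover have "\<bar>h x - h y\<bar> \<le> L * dist x y" using c by (simp add: chart_def)
    ultimately show ?thesis using L by (simp add: pos_divide_le_eq mult.commute)
  next
    case False
    have "\<bar>h x - h z\<bar> \<le> L * dist x z" "h z = 0" by (fact chartD[OF c])+
    then have "h x / L \<le> dist x z" using L by (simp add: pos_divide_le_eq mult.commute)
    also have "\<dots> \<le> dist x y" using x False dist_triangle[of z y x] by (simp add: dist_commute)
    finally show ?thesis .
  qed
  then have "h x / L \<le> infdist x (frontier \<Omega>)"
    using ne by (simp add: infdist_notempty cINF_greatest)
  then show ?thesis using L by (simp add: bdist_def pos_divide_le_eq mult.commute)
qed

text \<open>Moving x along \<open>e\<close> by its height reaches a point of height 0, which is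
  outside \<Omega> and still in the chart ball; the segment to it meets the frontier.\<close>

lemma chart_bdist_le_height:
  assumes c: "chart \<Omega> z r e h L" and x: "x \<in> \<Omega>" "(1 + L) * dist z x < r"
  shows "bdist \<Omega> x \<le> h x"
proof -
  have L: "L \<ge> 1" and e: "norm e = 1" using c by (auto simp: chart_def)
  have "dist z x \<le> (1 + L) * dist z x" using L by (simp add: distrib_right)
  then have "x \<in> ball z r" using x by simp
  then have hx: "h x > 0" using c x by (auto simp: chart_def)
  define p where "p = x + h x *\<^sub>R e"
  have "\<bar>h x - h z\<bar> \<le> L * dist x z" "h z = 0" "h p = h x - h x" unfolding p_def by (fact chartD[OF c])+
  then have hx2: "h x \<le> L * dist z x" and hp: "h p = 0" by (auto simp: dist_commute)
  have dp: "dist x p = h x" using e hx by (simp add: p_def dist_norm)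
  then have "dist z p < r" using dist_triangle[of z p x] hx2 x(2) by (simp add: distrib_right)
  then have "p \<notin> \<Omega>" using c hp by (auto simp: chart_def)
  then obtain q where q: "q \<in> closed_segment x p" "q \<in> frontier \<Omega>"
    using connected_Int_frontier[of "closed_segment x p" \<Omega>] x(1) \<open>p \<notin> \<Omega>\<close> by fastforce
  have "bdist \<Omega> x \<le> dist x q" unfolding bdist_def using q(2) by (rule infdist_le)
  also have "\<dots> \<le> dist x p" using q(1) dist_in_closed_segment by (metis dist_commute)
  finally show ?thesis using dp by simp
qed

lemma chart_continuous:
  assumes "chart \<Omega> z r e h L"
  shows "continuous_on S h"
proof -
  have "L-lipschitz_on UNIV h"
    using chartD(4,5)[OF assms] by (intro lipschitz_onI) (auto simp: dist_real_def)
  then show ?thesis using lipschitz_on_continuous_on continuous_on_subset by blast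
qed

lemma chart_height_near:
  assumes c: "chart \<Omega> z r e h L" and x: "dist z x < \<rho>" and \<rho>: "(1 + L) * \<rho> \<le> r / 4"
  shows "x \<in> \<Omega> \<longleftrightarrow> h x > 0" "h x \<le> L * bdist \<Omega> x" "x \<in> \<Omega> \<Longrightarrow> bdist \<Omega> x \<le> h x"
proof -
  note r = chartD(2)[OF c] and L = chartD(4)[OF c]
  have "(1 + L) * dist z x \<le> (1 + L) * \<rho>" using x L by (intro mult_left_mono) auto
  then have d: "(1 + L) * dist z x < r" using \<rho> r by linarith
  have "0 \<le> \<rho>" using x zero_le_dist[of z x] by linarith
  then have "2 * \<rho> \<le> (1 + L) * \<rho>" using L by (intro mult_right_mono) auto
  then have x': "dist z x < r / 2" using x \<rho> \<open>0 \<le> \<rho>\<close> by linarith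
  show "x \<in> \<Omega> \<longleftrightarrow> h x > 0" using chartD(8)[OF c, of x] x' r by simp
  show "h x \<le> L * bdist \<Omega> x" by (rule chart_height_le_bdist[OF c x'])
  show "bdist \<Omega> x \<le> h x" if "x \<in> \<Omega>" by (rule chart_bdist_le_height[OF c that d])
qed

text \<open>Continuity and positivity make w(h/R)/h admissible as majorant in the duality, the bound
  1 serves away from the boundary, and monotonicity lets delta and the height be exchanged.\<close>

definition weight :: "(real \<Rightarrow> real) \<Rightarrow> bool" where
  "weight w \<longleftrightarrow> continuous_on {0<..<1} w \<and> (\<forall>t. 0 < t \<and> t < 1 \<longrightarrow> 0 < w t \<and> w t \<le> 1) \<and>
     (\<forall>s t. 0 < s \<and> s \<le> t \<and> t < 1 \<longrightarrow> w s \<le> w t)"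

text \<open>The density of w(t) dt/t; its total mass is the only quantity through which
  \<open>w\<close> enters the constants.\<close>

definition weight_density :: "(real \<Rightarrow> real) \<Rightarrow> real \<Rightarrow> ennreal" where
  "weight_density w t = ennreal (w t / t) * indicator {0<..<1} t"

lemma weight_density_measurable [measurable]:
  assumes "weight w"
  shows "weight_density w \<in> borel_measurable borel"
proof -
  have "continuous_on {0<..<1} (\<lambda>t. w t / t)"
    using assms by (auto simp: weight_def intro!: continuous_intros)
  then have "(\<lambda>t. indicator {0<..<1} t *\<^sub>R (w t / t)) \<in> borel_measurable borel"
    by (intro borel_measurable_continuous_on_indicator) auto
  then have "(\<lambda>t. ennreal (indicator {0<..<1} t *\<^sub>R (w t / t))) \<in> borel_measurable borel" by measurable
  moreover have "(\<lambda>t. ennreal (indicator {0<..<1} t *\<^sub>R (w t / t))) = weight_density w"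
    by (auto simp: weight_density_def indicator_def fun_eq_iff)
  ultimately show ?thesis by simp
qed

text \<open>The height falls at unit speed along \<open>e\<close>, so this evaluates integrals of
  functions of h/R along vertical lines; the result depends neither on the line nor on
  \<open>R\<close>.\<close>

lemma nn_integral_line_rescale:
  fixes f :: "real \<Rightarrow> ennreal"
  assumes [measurable]: "f \<in> borel_measurable borel" and R: "R > 0"
  shows "(\<integral>\<^sup>+s. ennreal (1 / R) * f ((a - s) / R) \<partial>lborel) = (\<integral>\<^sup>+t. f t \<partial>lborel)"
proof -
  have "(\<integral>\<^sup>+s. ennreal (1 / R) * f ((a - s) / R) \<partial>lborel)
      = ennreal (1 / R) * (\<integral>\<^sup>+s. f (a / R + (- 1 / R) * s) \<partial>lborel)"
    by (subst nn_integral_cmult) (auto simp: diff_divide_distrib)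
  also have "\<dots> = (\<integral>\<^sup>+t. f t \<partial>lborel)"
    using R by (subst (2) nn_integral_real_affine[where c = "-1 / R" and t = "a / R"]) auto
  finally show ?thesis .
qed


text \<open>Translate and apply Fubini: after averaging over the shift, \<open>g\<close> is
  integrated along lines, where \<open>M\<close> bounds it, while \<open>q\<close> is left with an
  integral over the set \<open>K\<close> that the shifted points reach. This trades a singular
  weight for a compact region.\<close>

lemma nn_integral_translate_average:
  fixes g q :: "'a::euclidean_space \<Rightarrow> ennreal"
  assumes [measurable]: "g \<in> borel_measurable borel" "q \<in> borel_measurable borel" "K \<in> sets borel" "I \<in> sets borel"
    and line: "\<And>y. (\<integral>\<^sup>+s. g (y + s *\<^sub>R e) \<partial>lborel) \<le> M"
    and supp: "\<And>x s. s \<in> I \<Longrightarrow> g x \<noteq> 0 \<Longrightarrow> x - s *\<^sub>R e \<in> K"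
  shows "(\<integral>\<^sup>+s. (\<integral>\<^sup>+x. q (x - s *\<^sub>R e) * g x \<partial>lborel) * indicator I s \<partial>lborel) \<le> M * (\<integral>\<^sup>+y\<in>K. q y \<partial>lborel)"
proof -
  have "(\<integral>\<^sup>+s. (\<integral>\<^sup>+x. q (x - s *\<^sub>R e) * g x \<partial>lborel) * indicator I s \<partial>lborel)
      = (\<integral>\<^sup>+s. (\<integral>\<^sup>+y. q y * g (y + s *\<^sub>R e) * indicator I s \<partial>lborel) \<partial>lborel)"
  proof (rule nn_integral_cong)
    fix s :: real
    have "(\<integral>\<^sup>+x. q (x - s *\<^sub>R e) * g x \<partial>lborel) = (\<integral>\<^sup>+y. q (y + s *\<^sub>R e - s *\<^sub>R e) * g (y + s *\<^sub>R e) \<partial>lborel)"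
      by (rule nn_integral_lborel_translate[symmetric]) measurable
    then show "(\<integral>\<^sup>+x. q (x - s *\<^sub>R e) * g x \<partial>lborel) * indicator I s = (\<integral>\<^sup>+y. q y * g (y + s *\<^sub>R e) * indicator I s \<partial>lborel)"
      by (simp add: nn_integral_multc)
  qed
  also have "\<dots> = (\<integral>\<^sup>+y. (\<integral>\<^sup>+s\<in>I. q y * g (y + s *\<^sub>R e) \<partial>lborel) \<partial>lborel)"
    by (rule lborel_pair.Fubini') measurable
  also have "\<dots> \<le> (\<integral>\<^sup>+y. (\<integral>\<^sup>+s. (q y * indicator K y) * g (y + s *\<^sub>R e) \<partial>lborel) \<partial>lborel)"
  proof (intro nn_integral_mono)
    fix y s
    show "q y * g (y + s *\<^sub>R e) * indicator I s \<le> (q y * indicator K y) * g (y + s *\<^sub>R e)"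
      using supp[of s "y + s *\<^sub>R e"] by (cases "g (y + s *\<^sub>R e) = 0") (auto simp: indicator_def)
  qed
  also have "\<dots> = (\<integral>\<^sup>+y. (q y * indicator K y) * (\<integral>\<^sup>+s. g (y + s *\<^sub>R e) \<partial>lborel) \<partial>lborel)"
    by (intro nn_integral_cong nn_integral_cmult) measurable
  also have "\<dots> \<le> (\<integral>\<^sup>+y. (q y * indicator K y) * M \<partial>lborel)"
    by (intro nn_integral_mono mult_left_mono line) auto
  also have "\<dots> = M * (\<integral>\<^sup>+y\<in>K. q y \<partial>lborel)"
    by (subst nn_integral_multc) (auto simp: mult.commute)
  finally show ?thesis .
qed

lemma ennreal_le_divide_real:
  assumes "ennreal a * x \<le> y" "a > 0"
  shows "x \<le> ennreal (1 / a) * y"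
proof -
  have "ennreal (1 / a) * (ennreal a * x) \<le> ennreal (1 / a) * y" using assms(1) by (rule mult_left_mono) simp
  moreover have "ennreal (1 / a) * (ennreal a * x) = x"
    using assms(2) by (simp add: mult.assoc[symmetric] ennreal_mult[symmetric])
  ultimately show ?thesis by simp
qed

abbreviation weight_mass :: "(real \<Rightarrow> real) \<Rightarrow> ennreal" where
  "weight_mass w \<equiv> \<integral>\<^sup>+t. weight_density w t \<partial>lborel"

text \<open>The order of quantifiers is the point: radius, compact set and constant are fixed before
  the weight, \<open>R\<close>, the function and \<open>k\<close>. The last clause, free of
  \<open>u\<close>, serves to change \<open>k\<close> into the average. The threshold
  \<open>\<rho>0\<close> stands for a lower bound common to all admissible \<open>R\<close>.\<close>

definition boundary_control ::
    "'a::euclidean_space set \<Rightarrow> real \<Rightarrow> 'a \<Rightarrow> real \<Rightarrow> 'a set \<Rightarrow> real \<Rightarrow> bool" where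
  "boundary_control \<Omega> \<rho>0 z \<rho> K C \<longleftrightarrow> \<rho> > 0 \<and> compact K \<and> K \<subseteq> \<Omega> \<and> C > 0 \<and>
    (\<forall>w A R u B k. weight w \<longrightarrow> weight_mass w \<le> ennreal A \<longrightarrow> A > 0 \<longrightarrow> R > \<rho>0 \<longrightarrow> var_bound \<Omega> u B \<longrightarrow>
       (\<integral>\<^sup>+x\<in>\<Omega> \<inter> ball z \<rho>. ennreal (\<bar>u x - k\<bar> * (w (bdist \<Omega> x / R) / bdist \<Omega> x)) \<partial>lborel)
         \<le> ennreal (C * A) * (ennreal B + deviation u k K)) \<and>
    (\<forall>w A R. weight w \<longrightarrow> weight_mass w \<le> ennreal A \<longrightarrow> A > 0 \<longrightarrow> R > \<rho>0 \<longrightarrow>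
       (\<integral>\<^sup>+x\<in>\<Omega> \<inter> ball z \<rho>. ennreal (w (bdist \<Omega> x / R) / bdist \<Omega> x) \<partial>lborel)
         \<le> ennreal (C * A) * emeasure lborel K)"

proposition boundary_estimate:
  fixes \<Omega> :: "'a::euclidean_space set"
  assumes \<Omega>: "open \<Omega>" and c: "chart \<Omega> z r e h L" and \<rho>0: "\<rho>0 > 0"
  shows "\<exists>\<rho> K C. boundary_control \<Omega> \<rho>0 z \<rho> K C"
proof -
  note r = chartD(2)[OF c] and e = chartD(3)[OF c] and L = chartD(4)[OF c]
  have lip: "\<bar>h x - h y\<bar> \<le> L * dist x y" for x y by (rule chartD[OF c])
  have tr: "h (x + s *\<^sub>R e) = h x - s" for x s by (rule chartD[OF c])
  have tr': "h (x - s *\<^sub>R e) = h x + s" for x s using tr[of x "-s"] by simp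
  have ch: "continuous_on S h" for S by (rule chart_continuous[OF c])
  \<comment> \<open>The first bound makes delta and h comparable on the ball. The second gives h <=
    L \<rho> <= \<rho>0 / 2 there, so h/R stays inside (0,1) for every R > \<rho>0.\<close>
  define \<rho> where "\<rho> = min (r / (4 * (1 + L))) (\<rho>0 / (2 * L))"
  define S where "S = r / 4"
  define U where "U = \<Omega> \<inter> ball z \<rho>"
  \<comment> \<open>Points within \<rho> <= r/8 of z, pushed inwards by s in [S/2, S] with S = r/4,
    land within 3r/8 of z at height at least S/2. Any closed ball of radius at least 3r/8 and below
    r would do.\<close>
  define K where "K = cball z (r / 2 - r / 100) \<inter> {x. S / 2 \<le> h x}"
  \<comment> \<open>\<open>L\<close> pays for the translation term; 2 L / S arises on dividing by
    the length S/2 of the interval of shifts.\<close>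
  define C where "C = L + 2 * L / S"
  have \<rho>: "\<rho> > 0" using r \<rho>0 L by (simp add: \<rho>_def)
  have \<rho>1: "(1 + L) * \<rho> \<le> r / 4" and \<rho>2: "L * \<rho> \<le> \<rho>0 / 2"
  proof -
    have "\<rho> \<le> r / (4 * (1 + L))" "\<rho> \<le> \<rho>0 / (2 * L)" by (auto simp: \<rho>_def)
    then show "(1 + L) * \<rho> \<le> r / 4" "L * \<rho> \<le> \<rho>0 / 2" using L by (auto simp: field_simps)
  qed
  have "2 * \<rho> \<le> (1 + L) * \<rho>" using L \<rho> by (intro mult_right_mono) auto
  then have \<rho>3: "\<rho> \<le> r / 8" using \<rho>1 by linarith
  have S: "S > 0" using r by (simp add: S_def)
  have U: "open U" using \<Omega> by (auto simp: U_def)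
  have hU: "0 < h x" "h x \<le> \<rho>0 / 2" "bdist \<Omega> x \<le> h x" "h x \<le> L * bdist \<Omega> x" "bdist \<Omega> x > 0" if x: "x \<in> U" for x
  proof -
    have d: "dist z x < \<rho>" "x \<in> \<Omega>" using x by (auto simp: U_def)
    note near = chart_height_near[OF c d(1) \<rho>1]
    show hpos: "0 < h x" using near(1) d by simp
    have "h x \<le> L * dist x z" using lip[of x z] chartD(7)[OF c] by simp
    also have "\<dots> \<le> L * \<rho>" using d L by (intro mult_left_mono) (auto simp: dist_commute)
    finally show "h x \<le> \<rho>0 / 2" using \<rho>2 by simp
    show hl: "h x \<le> L * bdist \<Omega> x" "bdist \<Omega> x \<le> h x" using near(2,3) d by auto
    show "bdist \<Omega> x > 0" using hl(1) hpos L by (metis less_le_trans zero_less_mult_pos less_le_trans zero_less_one)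
  qed
  have shift: "x - s *\<^sub>R e \<in> \<Omega>" if "x \<in> U" "0 \<le> s" "s \<le> S" for x s
  proof -
    have "dist z (x - s *\<^sub>R e) \<le> dist z x + dist x (x - s *\<^sub>R e)" by (rule dist_triangle)
    also have "dist x (x - s *\<^sub>R e) = s" using e that by (simp add: dist_norm)
    finally have "dist z (x - s *\<^sub>R e) < r" using that \<rho>3 r by (auto simp: U_def S_def)
    then show ?thesis using chartD(8)[OF c] hU(1)[OF that(1)] that(2) by (simp add: tr')
  qed
  have shiftK: "x - s *\<^sub>R e \<in> K" if "x \<in> U" "S / 2 \<le> s" "s \<le> S" for x s
  proof -
    have "dist z (x - s *\<^sub>R e) \<le> dist z x + dist x (x - s *\<^sub>R e)" by (rule dist_triangle)
    also have "dist x (x - s *\<^sub>R e) = s" using e that S by (simp add: dist_norm)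
    finally have "dist z (x - s *\<^sub>R e) \<le> r / 2 - r / 100" using that \<rho>3 r by (auto simp: U_def S_def)
    then show ?thesis using hU(1)[OF that(1)] that(2) by (simp add: K_def tr')
  qed
  have K: "compact K" "K \<subseteq> \<Omega>"
  proof -
    have "closed {x. S / 2 \<le> h x}" using ch by (intro closed_Collect_le) auto
    then show "compact K" unfolding K_def by (intro compact_Int_closed) auto
    show "K \<subseteq> \<Omega>" using chartD(8)[OF c] S r by (auto simp: K_def)
  qed
  have C: "C > 0" "L \<le> C" "2 * L / S \<le> C" using L S by (auto simp: C_def add_pos_nonneg)
  have [measurable]: "K \<in> sets borel" using K by (simp add: borel_closed compact_imp_closed)
  have [measurable]: "U \<in> sets borel" using U by simp

  \<comment> \<open>Since delta <= h <= L delta and \<open>w\<close> is increasing, this majorizes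
    w(delta/R)/delta. It depends on the height alone, so its integrals along vertical lines are
    explicit.\<close>
  define G where "G = (\<lambda>w R x. L * (w (h x / R) / h x))"
  define GU where "GU = (\<lambda>w R x. ennreal (G w R x) * indicator U x)"
  have main: "continuous_on U (G w R)" "\<And>x. x \<in> U \<Longrightarrow> G w R x > 0" "GU w R \<in> borel_measurable borel"
      "\<And>x. x \<in> U \<Longrightarrow> 0 \<le> w (bdist \<Omega> x / R) / bdist \<Omega> x \<and> w (bdist \<Omega> x / R) / bdist \<Omega> x \<le> G w R x"
      "\<And>x. (\<integral>\<^sup>+s. GU w R (x + s *\<^sub>R e) \<partial>lborel) \<le> ennreal (L * A)"
    if w: "weight w" and A: "weight_mass w \<le> ennreal A" "A > 0" and R: "R > \<rho>0" for w A R
  proof -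
    have R0: "R > 0" using R \<rho>0 by simp
    have hR: "0 < h x / R" "h x / R < 1" if "x \<in> U" for x
      using hU[OF that] R R0 \<rho>0 by (auto simp: pos_divide_less_eq)
    show cG: "continuous_on U (G w R)"
    proof -
      have "continuous_on {0<..<1} w" using w by (simp add: weight_def)
      moreover have "continuous_on U (\<lambda>x. h x / R)" by (rule continuous_on_divide[OF ch continuous_on_const]) (use R0 in simp)
      moreover have "(\<lambda>x. h x / R) ` U \<subseteq> {0<..<1}" using hR by fastforce
      ultimately have wc: "continuous_on U (\<lambda>x. w (h x / R))" by (rule continuous_on_compose2)
      have "\<forall>x\<in>U. h x \<noteq> 0" using hU(1) by force
      then show ?thesis unfolding G_def
        by (intro continuous_on_mult[OF continuous_on_const] continuous_on_divide[OF wc ch])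
    qed
    show "G w R x > 0" if "x \<in> U" for x
      using w hR[OF that] hU(1)[OF that] L by (auto simp: G_def weight_def)
    have "(\<lambda>x. ennreal (indicator U x *\<^sub>R G w R x)) \<in> borel_measurable borel"
      using borel_measurable_continuous_on_indicator[OF _ cG] by measurable
    moreover have "(\<lambda>x. ennreal (indicator U x *\<^sub>R G w R x)) = GU w R" by (auto simp: GU_def indicator_def fun_eq_iff)
    ultimately show "GU w R \<in> borel_measurable borel" by simp
    show "0 \<le> w (bdist \<Omega> x / R) / bdist \<Omega> x \<and> w (bdist \<Omega> x / R) / bdist \<Omega> x \<le> G w R x" if x: "x \<in> U" for x
    proof -
      have b: "0 < bdist \<Omega> x / R" "bdist \<Omega> x / R \<le> h x / R" using hU[OF x] R0 by (auto simp: divide_right_mono)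
      have w1: "0 < w (bdist \<Omega> x / R)" "w (bdist \<Omega> x / R) \<le> w (h x / R)"
        using w b hR[OF x] unfolding weight_def by (metis le_less_trans)+
      have "1 / bdist \<Omega> x \<le> L / h x" using hU[OF x] by (simp add: field_simps)
      then have "w (bdist \<Omega> x / R) * (1 / bdist \<Omega> x) \<le> w (h x / R) * (L / h x)"
        using w1 hU[OF x] by (intro mult_mono) auto
      then show ?thesis using w1 hU[OF x] by (simp add: G_def mult.commute)
    qed
    fix x
    note [measurable] = weight_density_measurable[OF w]
    have "(\<integral>\<^sup>+s. GU w R (x + s *\<^sub>R e) \<partial>lborel) \<le> (\<integral>\<^sup>+s. ennreal L * (ennreal (1 / R) * weight_density w ((h x - s) / R)) \<partial>lborel)"
    proof (rule nn_integral_mono)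
      fix s
      show "GU w R (x + s *\<^sub>R e) \<le> ennreal L * (ennreal (1 / R) * weight_density w ((h x - s) / R))"
      proof (cases "x + s *\<^sub>R e \<in> U")
        case True
        note hp = hR[OF True] hU(1)[OF True]
        have "G w R (x + s *\<^sub>R e) = L * (1 / R * (w ((h x - s) / R) / ((h x - s) / R)))"
          using R0 by (simp add: G_def tr)
        moreover have "0 < w ((h x - s) / R)" using w hp by (simp add: weight_def tr)
        ultimately show ?thesis
          using True hp R0 L by (simp add: GU_def weight_density_def tr ennreal_mult[symmetric])
      qed (simp add: GU_def)
    qed
    also have "\<dots> = ennreal L * weight_mass w"
      by (subst nn_integral_cmult) (auto simp: nn_integral_line_rescale[OF weight_density_measurable[OF w] R0])
    also have "\<dots> \<le> ennreal L * ennreal A" by (intro mult_left_mono A) auto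
    finally show "(\<integral>\<^sup>+s. GU w R (x + s *\<^sub>R e) \<partial>lborel) \<le> ennreal (L * A)"
      using L A by (simp add: ennreal_mult)
  qed
  have avg: "(\<integral>\<^sup>+s. (\<integral>\<^sup>+x. q (x - s *\<^sub>R e) * GU w R x \<partial>lborel) * indicator {S/2..S} s \<partial>lborel)
        \<le> ennreal (L * A) * (\<integral>\<^sup>+y\<in>K. q y \<partial>lborel)"
    if "weight w" "weight_mass w \<le> ennreal A" "A > 0" "R > \<rho>0" and [measurable]: "q \<in> borel_measurable borel"
    for w A R q
    using main(3,5)[OF that(1-4)] shiftK
    by (intro nn_integral_translate_average) (auto simp: GU_def split: split_indicator_asm)
  have lS: "(\<integral>\<^sup>+s\<in>{S/2..S}. a \<partial>lborel) = ennreal (S / 2) * a" for a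
    using S by (subst nn_integral_cmult_indicator) (auto simp: mult.commute)
  have inv: "1 / (S / 2) * (L * A) \<le> C * A" if "A > 0" for A
    using mult_right_mono[OF C(3), of A] that by (simp add: mult_ac)
  have "boundary_control \<Omega> \<rho>0 z \<rho> K C"
    unfolding boundary_control_def U_def[symmetric]
  proof (intro conjI allI impI \<rho> K C(1))
    fix w :: "real \<Rightarrow> real" and A R :: real
    assume wA: "weight w" "weight_mass w \<le> ennreal A" "A > 0" "R > \<rho>0"
    note m = main[OF wA]
    note [measurable] = m(3)
    \<comment> \<open>With the constant function 1 in \<open>avg\<close>, the shifted integral
      becomes the measure of \<open>K\<close>.\<close>
    have "ennreal (S / 2) * (\<integral>\<^sup>+x. GU w R x \<partial>lborel) \<le> ennreal (L * A) * emeasure lborel K"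
      using avg[OF wA, of "\<lambda>x. 1"] by (simp add: lS)
    from ennreal_le_divide_real[OF this] S have "(\<integral>\<^sup>+x. GU w R x \<partial>lborel) \<le> ennreal (1 / (S / 2)) * (ennreal (L * A) * emeasure lborel K)"
      by simp
    also have "\<dots> = ennreal (1 / (S / 2) * (L * A)) * emeasure lborel K"
      using S L wA by (subst ennreal_mult) (auto simp: mult.assoc)
    also have "\<dots> \<le> ennreal (C * A) * emeasure lborel K"
      by (intro mult_right_mono ennreal_leI inv wA) auto
    finally have "(\<integral>\<^sup>+x. GU w R x \<partial>lborel) \<le> ennreal (C * A) * emeasure lborel K" .
    moreover have "(\<integral>\<^sup>+x\<in>U. ennreal (w (bdist \<Omega> x / R) / bdist \<Omega> x) \<partial>lborel) \<le> (\<integral>\<^sup>+x. GU w R x \<partial>lborel)"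
      using m(4) by (intro nn_integral_mono) (auto simp: GU_def indicator_def intro!: ennreal_leI)
    ultimately show "(\<integral>\<^sup>+x\<in>U. ennreal (w (bdist \<Omega> x / R) / bdist \<Omega> x) \<partial>lborel) \<le> ennreal (C * A) * emeasure lborel K"
      by (rule order_trans[rotated])
    fix u B k assume u: "var_bound \<Omega> u B"
    note [measurable] = var_boundD(2)[OF u]
    have B: "B \<ge> 0" using var_boundD[OF u] by simp
    have AL: "L * A > 0" using L wA by simp
    define I where "I = (\<integral>\<^sup>+x. ennreal \<bar>u x - k\<bar> * GU w R x \<partial>lborel)"
    define H where "H = (\<lambda>s. \<integral>\<^sup>+x. ennreal \<bar>u (x - s *\<^sub>R e) - k\<bar> * GU w R x \<partial>lborel)"
    have [measurable]: "H \<in> borel_measurable borel" unfolding H_def by measurable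
    have IH: "I \<le> ennreal (L * A * B) + H s" if s: "s \<in> {S/2..S}" for s
    proof -
      have s0: "s > 0" "s \<le> S" using s S by auto
      have 1: "(\<integral>\<^sup>+x\<in>U. ennreal (\<bar>u x - u (x - s *\<^sub>R e)\<bar> * G w R x) \<partial>lborel) \<le> ennreal (L * A * B)"
      proof (rule weighted_translation_estimate[OF u U _ m(1,2) AL])
        fix x and \<sigma> :: real assume *: "x \<in> U" "\<sigma> \<in> {0..1}"
        then have "\<sigma> * s \<le> 1 * S" using s0 by (intro mult_mono) auto
        then show "x - \<sigma> *\<^sub>R s *\<^sub>R e \<in> \<Omega>" using shift[of x "\<sigma> * s"] * s0 by simp
      next
        fix x
        \<comment> \<open>The factor \<open>norm (s *\<^sub>R e)\<close> is the Jacobian of passing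
          from the unit interval to arc length, so the line bound \<open>m(5)\<close> applies with
          no loss as s varies.\<close>
        have "ennreal (norm (s *\<^sub>R e)) * (\<integral>\<^sup>+\<sigma>\<in>{0..1}. ennreal (G w R (x + \<sigma> *\<^sub>R s *\<^sub>R e)) * indicator U (x + \<sigma> *\<^sub>R s *\<^sub>R e) \<partial>lborel)
          \<le> ennreal \<bar>s\<bar> * (\<integral>\<^sup>+\<sigma>. GU w R (x + (0 + s * \<sigma>) *\<^sub>R e) \<partial>lborel)"
          using e by (intro mult_mono nn_integral_mono) (auto simp: GU_def indicator_def mult.commute)
        also have "\<dots> = (\<integral>\<^sup>+\<sigma>. GU w R (x + \<sigma> *\<^sub>R e) \<partial>lborel)"
          using s0 by (intro nn_integral_real_affine[symmetric]) auto
        also have "\<dots> \<le> ennreal (L * A)" by (rule m(5))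
        finally show "ennreal (norm (s *\<^sub>R e)) * (\<integral>\<^sup>+\<sigma>\<in>{0..1}. ennreal (G w R (x + \<sigma> *\<^sub>R s *\<^sub>R e)) * indicator U (x + \<sigma> *\<^sub>R s *\<^sub>R e) \<partial>lborel) \<le> ennreal (L * A)" .
      qed auto
      have "I \<le> (\<integral>\<^sup>+x. ennreal \<bar>u x - u (x - s *\<^sub>R e)\<bar> * GU w R x + ennreal \<bar>u (x - s *\<^sub>R e) - k\<bar> * GU w R x \<partial>lborel)"
        unfolding I_def distrib_right[symmetric]
        by (intro nn_integral_mono mult_right_mono) (auto simp: ennreal_plus[symmetric] simp del: ennreal_plus intro!: ennreal_leI)
      also have "\<dots> = (\<integral>\<^sup>+x. ennreal \<bar>u x - u (x - s *\<^sub>R e)\<bar> * GU w R x \<partial>lborel) + H s"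
        unfolding H_def by (intro nn_integral_add) measurable
      also have "(\<integral>\<^sup>+x. ennreal \<bar>u x - u (x - s *\<^sub>R e)\<bar> * GU w R x \<partial>lborel) = (\<integral>\<^sup>+x\<in>U. ennreal (\<bar>u x - u (x - s *\<^sub>R e)\<bar> * G w R x) \<partial>lborel)"
        by (intro nn_integral_cong) (auto simp: GU_def indicator_def ennreal_mult' mult.assoc)
      finally show ?thesis using 1 by (meson add_right_mono order_trans)
    qed
    have "ennreal (S / 2) * I = (\<integral>\<^sup>+s\<in>{S/2..S}. I \<partial>lborel)" by (simp add: lS)
    also have "\<dots> \<le> (\<integral>\<^sup>+s. ennreal (L * A * B) * indicator {S/2..S} s + H s * indicator {S/2..S} s \<partial>lborel)"
      using IH by (intro nn_integral_mono) (auto simp: indicator_def)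
    also have "\<dots> = ennreal (S / 2) * ennreal (L * A * B) + (\<integral>\<^sup>+s\<in>{S/2..S}. H s \<partial>lborel)"
      by (subst nn_integral_add) (auto simp: lS)
    also have "\<dots> \<le> ennreal (S / 2) * ennreal (L * A * B) + ennreal (L * A) * deviation u k K"
      unfolding H_def by (intro add_left_mono avg wA) measurable
    finally have "I \<le> ennreal (1 / (S / 2)) * (ennreal (S / 2) * ennreal (L * A * B) + ennreal (L * A) * deviation u k K)"
      using S by (intro ennreal_le_divide_real) auto
    also have "\<dots> = ennreal (L * A) * ennreal B + ennreal (1 / (S / 2) * (L * A)) * deviation u k K"
    proof -
      have "ennreal (1 / (S / 2)) * (ennreal (S / 2) * ennreal (L * A * B)) = ennreal (1 / (S / 2) * (S / 2 * (L * A * B)))"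
        using S AL B by (simp only: ennreal_mult[symmetric] divide_nonneg_nonneg mult_nonneg_nonneg less_imp_le zero_le_numeral zero_le_one)
      also have "1 / (S / 2) * (S / 2 * (L * A * B)) = L * A * B" using S by simp
      also have "ennreal (L * A * B) = ennreal (L * A) * ennreal B" using AL B by (intro ennreal_mult) auto
      moreover have "ennreal (1 / (S / 2) * (L * A)) = ennreal (1 / (S / 2)) * ennreal (L * A)"
        using S AL by (intro ennreal_mult) auto
      ultimately show ?thesis by (simp add: distrib_left mult.assoc)
    qed
    also have "\<dots> \<le> ennreal (C * A) * ennreal B + ennreal (C * A) * deviation u k K"
      using C(2) wA by (intro add_mono mult_right_mono ennreal_leI inv) auto
    finally have "I \<le> ennreal (C * A) * (ennreal B + deviation u k K)"
      by (simp add: distrib_left)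
    moreover have "(\<integral>\<^sup>+x\<in>U. ennreal (\<bar>u x - k\<bar> * (w (bdist \<Omega> x / R) / bdist \<Omega> x)) \<partial>lborel) \<le> I"
      unfolding I_def
    proof (rule nn_integral_mono)
      fix x
      show "ennreal (\<bar>u x - k\<bar> * (w (bdist \<Omega> x / R) / bdist \<Omega> x)) * indicator U x \<le> ennreal \<bar>u x - k\<bar> * GU w R x"
      proof (cases "x \<in> U")
        case True
        have "\<bar>u x - k\<bar> * (w (bdist \<Omega> x / R) / bdist \<Omega> x) \<le> \<bar>u x - k\<bar> * G w R x"
          using m(4)[OF True] by (intro mult_left_mono) auto
        from ennreal_leI[OF this] show ?thesis using True by (simp add: GU_def ennreal_mult')
      qed simp
    qed
    ultimately show "(\<integral>\<^sup>+x\<in>U. ennreal (\<bar>u x - k\<bar> * (w (bdist \<Omega> x / R) / bdist \<Omega> x)) \<partial>lborel)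
      \<le> ennreal (C * A) * (ennreal B + deviation u k K)"
      by (rule order_trans[rotated])
  qed
  then show ?thesis by blast
qed

section \<open>Weighted Hardy-Poincare inequality\<close>


definition hardy_density :: "'a::euclidean_space set \<Rightarrow> (real \<Rightarrow> real) \<Rightarrow> real \<Rightarrow> 'a \<Rightarrow> ennreal" where
  "hardy_density \<Omega> w R x = ennreal (w (bdist \<Omega> x / R) / bdist \<Omega> x) * indicator \<Omega> x"

lemma continuous_on_bdist: "continuous_on S (bdist \<Omega>)"
  unfolding bdist_def[abs_def] by (intro continuous_on_infdist continuous_on_id)

lemma frontier_bounded_domain:
  fixes \<Omega> :: "'a::euclidean_space set"
  assumes "bounded \<Omega>" "\<Omega> \<noteq> {}"
  shows "frontier \<Omega> \<noteq> {}" "compact (frontier \<Omega>)"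
  using assms frontier_eq_empty[of \<Omega>] not_bounded_UNIV by (auto simp: compact_frontier_bounded)

lemma bdist_pos:
  assumes "open \<Omega>" "bounded \<Omega>" "x \<in> \<Omega>"
  shows "bdist \<Omega> x > 0"
proof -
  have "x \<notin> frontier \<Omega>" using assms by (simp add: frontier_def interior_open)
  then show ?thesis
    unfolding bdist_def using assms frontier_bounded_domain[of \<Omega>]
    by (metis empty_iff frontier_closed in_closed_iff_infdist_zero infdist_nonneg less_eq_real_def)
qed

lemma hardy_density_measurable:
  assumes "weight w" "open \<Omega>" "bounded \<Omega>" "R > 0" "\<And>x. x \<in> \<Omega> \<Longrightarrow> bdist \<Omega> x < R"
  shows "hardy_density \<Omega> w R \<in> borel_measurable borel"
proof -
  have b: "0 < bdist \<Omega> x" "bdist \<Omega> x < R" if "x \<in> \<Omega>" for x using bdist_pos assms that by auto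
  have "continuous_on {0<..<1} w" using assms by (simp add: weight_def)
  moreover have "continuous_on \<Omega> (\<lambda>x. bdist \<Omega> x / R)"
    by (rule continuous_on_divide[OF continuous_on_bdist continuous_on_const]) (use assms(4) in simp)
  moreover have "(\<lambda>x. bdist \<Omega> x / R) ` \<Omega> \<subseteq> {0<..<1}" using b assms(4) by (auto simp: pos_divide_less_eq)
  ultimately have "continuous_on \<Omega> (\<lambda>x. w (bdist \<Omega> x / R))" by (rule continuous_on_compose2)
  then have "continuous_on \<Omega> (\<lambda>x. w (bdist \<Omega> x / R) / bdist \<Omega> x)"
    by (rule continuous_on_divide[OF _ continuous_on_bdist]) (use b in force)
  then have "(\<lambda>x. indicator \<Omega> x *\<^sub>R (w (bdist \<Omega> x / R) / bdist \<Omega> x)) \<in> borel_measurable borel"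
    using assms(2) by (intro borel_measurable_continuous_on_indicator) auto
  then have "(\<lambda>x. ennreal (indicator \<Omega> x *\<^sub>R (w (bdist \<Omega> x / R) / bdist \<Omega> x))) \<in> borel_measurable borel" by measurable
  moreover have "(\<lambda>x. ennreal (indicator \<Omega> x *\<^sub>R (w (bdist \<Omega> x / R) / bdist \<Omega> x))) = hardy_density \<Omega> w R"
    by (auto simp: hardy_density_def indicator_def fun_eq_iff)
  ultimately show ?thesis by simp
qed

lemma nn_integral_le_finite_cover:
  fixes g :: "'a::euclidean_space \<Rightarrow> ennreal"
  assumes [measurable]: "g \<in> borel_measurable borel" "K \<in> sets borel" "\<And>z. z \<in> T \<Longrightarrow> D z \<in> sets borel"
    and "finite T" and cov: "\<And>x. g x \<noteq> 0 \<Longrightarrow> x \<in> K \<or> (\<exists>z\<in>T. x \<in> D z)"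
  shows "(\<integral>\<^sup>+x. g x \<partial>lborel) \<le> (\<Sum>z\<in>T. \<integral>\<^sup>+x\<in>D z. g x \<partial>lborel) + (\<integral>\<^sup>+x\<in>K. g x \<partial>lborel)"
proof -
  have m: "(\<lambda>x. g x * indicator (D z) x) \<in> borel_measurable lborel" if "z \<in> T" for z
    using assms(3)[OF that] by measurable
  have "(\<integral>\<^sup>+x. g x \<partial>lborel) \<le> (\<integral>\<^sup>+x. (\<Sum>z\<in>T. g x * indicator (D z) x) + g x * indicator K x \<partial>lborel)"
  proof (rule nn_integral_mono)
    fix x
    show "g x \<le> (\<Sum>z\<in>T. g x * indicator (D z) x) + g x * indicator K x"
    proof (cases "g x = 0 \<or> x \<in> K")
      case True then show ?thesis by (auto intro: add_increasing)
    next
      case False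
      then obtain z where z: "z \<in> T" "x \<in> D z" using cov by blast
      have "g x * indicator (D z) x \<le> (\<Sum>z\<in>T. g x * indicator (D z) x)"
        using z \<open>finite T\<close> by (intro member_le_sum) auto
      then show ?thesis using z by (auto intro: add_increasing2)
    qed
  qed
  also have "\<dots> = (\<integral>\<^sup>+x. (\<Sum>z\<in>T. g x * indicator (D z) x) \<partial>lborel) + (\<integral>\<^sup>+x\<in>K. g x \<partial>lborel)"
    using m by (intro nn_integral_add) (auto intro!: borel_measurable_sum)
  also have "(\<integral>\<^sup>+x. (\<Sum>z\<in>T. g x * indicator (D z) x) \<partial>lborel) = (\<Sum>z\<in>T. \<integral>\<^sup>+x\<in>D z. g x \<partial>lborel)"
    using m by (intro nn_integral_sum) auto
  finally show ?thesis .
qed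

text \<open>For w(t) = t the density w(delta/R)/delta is the constant 1/R, so unweighted L1
  estimates become a special case.\<close>

lemma weight_id: "weight (\<lambda>t. t)" "(\<integral>\<^sup>+t. weight_density (\<lambda>t. t) t \<partial>lborel) \<le> ennreal 1"
proof -
  show "weight (\<lambda>t. t)" by (auto simp: weight_def intro: continuous_on_id)
  have "(\<integral>\<^sup>+t. weight_density (\<lambda>t. t) t \<partial>lborel) = (\<integral>\<^sup>+t. indicator {0<..<1::real} t \<partial>lborel)"
    by (intro nn_integral_cong) (auto simp: weight_density_def indicator_def)
  then show "(\<integral>\<^sup>+t. weight_density (\<lambda>t. t) t \<partial>lborel) \<le> ennreal 1" by simp
qed

text \<open>Finitely many boundary balls cover the compact frontier, and what they leave of the
  closure is compact inside \<Omega>. The constant \<open>k\<close> comes from the interior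
  inequality on the union of that remainder with the compact sets of the boundary estimates. Being
  fixed before \<open>w\<close>, \<open>A\<close> and \<open>R\<close>, it can later serve two
  weights at once.\<close>

lemma bounded_Lipschitz_estimates:
  fixes \<Omega> :: "'a::euclidean_space set"
  assumes \<Omega>: "bounded_lipschitz_domain \<Omega>"
  obtains C where "C > 0"
    "\<And>u B. var_bound \<Omega> u B \<Longrightarrow> \<exists>k. \<forall>w A R. weight w \<longrightarrow> weight_mass w \<le> ennreal A \<longrightarrow> A > 0 \<longrightarrow> R > 0 \<longrightarrow>
       (\<forall>x\<in>\<Omega>. bdist \<Omega> x < R) \<longrightarrow> (\<integral>\<^sup>+x. ennreal \<bar>u x - k\<bar> * hardy_density \<Omega> w R x \<partial>lborel) \<le> ennreal (C * (1 + A) * B)"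
    "\<And>w A R. weight w \<Longrightarrow> weight_mass w \<le> ennreal A \<Longrightarrow> A > 0 \<Longrightarrow> R > 0 \<Longrightarrow>
       \<forall>x\<in>\<Omega>. bdist \<Omega> x < R \<Longrightarrow> (\<integral>\<^sup>+x. hardy_density \<Omega> w R x \<partial>lborel) \<le> ennreal (C * (1 + A))"
proof -
  have o: "open \<Omega>" and co: "connected \<Omega>" and ne: "\<Omega> \<noteq> {}" and bd: "bounded \<Omega>" and lb: "lipschitz_boundary \<Omega>"
    using \<Omega> by (auto simp: bounded_lipschitz_domain_def)
  note [measurable] = borel_open[OF o]
  obtain x0 where x0: "x0 \<in> \<Omega>" using ne by blast
  \<comment> \<open>Every \<open>R\<close> that strictly bounds delta on \<Omega> exceeds its value
    at \<open>x0\<close>, so one threshold serves all admissible \<open>R\<close>.\<close>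
  define \<rho>0 where "\<rho>0 = bdist \<Omega> x0"
  have \<rho>0: "\<rho>0 > 0" unfolding \<rho>0_def by (rule bdist_pos[OF o bd x0])
  have "\<exists>\<rho> K C. boundary_control \<Omega> \<rho>0 z \<rho> K C" if "z \<in> frontier \<Omega>" for z
    using chart_exists[OF lb o that] boundary_estimate[OF o _ \<rho>0] by metis
  then obtain \<rho> K C where P: "\<And>z. z \<in> frontier \<Omega> \<Longrightarrow> boundary_control \<Omega> \<rho>0 z (\<rho> z) (K z) (C z)" by metis
  have \<rho>: "\<rho> z > 0" and K: "compact (K z)" "K z \<subseteq> \<Omega>" and C: "C z > 0" if "z \<in> frontier \<Omega>" for z
    using P[OF that] by (simp_all only: boundary_control_def)
  have E1: "(\<integral>\<^sup>+x\<in>\<Omega> \<inter> ball z (\<rho> z). ennreal (\<bar>u x - k\<bar> * (w (bdist \<Omega> x / R) / bdist \<Omega> x)) \<partial>lborel)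
         \<le> ennreal (C z * A) * (ennreal B + deviation u k (K z))"
    if "z \<in> frontier \<Omega>" "weight w" "weight_mass w \<le> ennreal A" "A > 0" "R > \<rho>0" "var_bound \<Omega> u B"
    for z w A R u B k
    using P[OF that(1)] that(2-) by (simp only: boundary_control_def)
  have E2: "(\<integral>\<^sup>+x\<in>\<Omega> \<inter> ball z (\<rho> z). ennreal (w (bdist \<Omega> x / R) / bdist \<Omega> x) \<partial>lborel)
         \<le> ennreal (C z * A) * emeasure lborel (K z)"
    if "z \<in> frontier \<Omega>" "weight w" "weight_mass w \<le> ennreal A" "A > 0" "R > \<rho>0" for z w A R
    using P[OF that(1)] that(2-) by (simp only: boundary_control_def)
  note fr = frontier_bounded_domain[OF bd ne]
  obtain T where T: "T \<subseteq> frontier \<Omega>" "finite T" "frontier \<Omega> \<subseteq> (\<Union>z\<in>T. ball z (\<rho> z))"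
  proof (rule compactE_image[OF fr(2), of "frontier \<Omega>" "\<lambda>z. ball z (\<rho> z)"])
    show "frontier \<Omega> \<subseteq> (\<Union>z\<in>frontier \<Omega>. ball z (\<rho> z))" using \<rho> by force
  qed auto
  have TF: "z \<in> frontier \<Omega>" if "z \<in> T" for z using T that by blast
  define K0 where "K0 = closure \<Omega> - (\<Union>z\<in>T. ball z (\<rho> z))"
  have K0: "compact K0" "K0 \<subseteq> \<Omega>"
  proof -
    show "compact K0" unfolding K0_def using bd by (intro compact_diff) (auto simp: compact_closure)
    show "K0 \<subseteq> \<Omega>" using T o by (auto simp: K0_def frontier_def interior_open)
  qed
  define Ks where "Ks = K0 \<union> (\<Union>z\<in>T. K z)"
  have Ks: "compact Ks" "Ks \<subseteq> \<Omega>"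
    using K0 K TF T(2) unfolding Ks_def by (auto intro!: compact_Un compact_UN)
  have [measurable]: "K0 \<in> sets borel" "Ks \<in> sets borel"
    using K0 Ks by (auto simp: borel_closed compact_imp_closed)
  have KzKs: "K z \<subseteq> Ks" if "z \<in> T" for z using that by (auto simp: Ks_def)
  obtain CP where CP: "CP \<ge> 0" and PI: "\<And>u B. var_bound \<Omega> u B \<Longrightarrow> \<exists>c. deviation u c Ks \<le> ennreal (CP * B)"
    using interior_Poincare[OF o co ne Ks] by blast
  obtain d where d: "d > 0" "\<And>x. x \<in> K0 \<Longrightarrow> d \<le> bdist \<Omega> x"
  proof (cases "K0 = {}")
    case True then show ?thesis using that[of 1] by auto
  next
    case False
    then obtain a where "a \<in> K0" "\<And>x. x \<in> K0 \<Longrightarrow> bdist \<Omega> a \<le> bdist \<Omega> x"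
      using continuous_attains_inf[OF K0(1) False continuous_on_bdist] by blast
    then show ?thesis using that[of "bdist \<Omega> a"] bdist_pos[OF o bd] K0 by blast
  qed
  have CT0: "0 \<le> C z" if "z \<in> T" for z using C[OF TF[OF that]] by simp
  define CT where "CT = (\<Sum>z\<in>T. C z)"
  have CT: "CT \<ge> 0" unfolding CT_def by (intro sum_nonneg CT0)
  define V where "V = measure lborel Ks"
  have V: "emeasure lborel Ks = ennreal V" unfolding V_def
    using emeasure_bounded_finite[OF compact_imp_bounded[OF Ks(1)]] by (simp add: emeasure_eq_ennreal_measure less_top)
  have V0: "V \<ge> 0" by (simp add: V_def)
  have split: "(\<integral>\<^sup>+x. q x * hardy_density \<Omega> w R x \<partial>lborel)
      \<le> (\<Sum>z\<in>T. \<integral>\<^sup>+x\<in>ball z (\<rho> z). q x * hardy_density \<Omega> w R x \<partial>lborel) + ennreal (1 / d) * (\<integral>\<^sup>+x\<in>Ks. q x \<partial>lborel)"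
    if w: "weight w" "R > 0" "\<forall>x\<in>\<Omega>. bdist \<Omega> x < R" and [measurable]: "q \<in> borel_measurable borel" for q w R
  proof -
    have [measurable]: "hardy_density \<Omega> w R \<in> borel_measurable borel"
      using w by (intro hardy_density_measurable o bd) auto
    have gm: "(\<lambda>x. q x * hardy_density \<Omega> w R x) \<in> borel_measurable borel" by measurable
    have "(\<integral>\<^sup>+x. q x * hardy_density \<Omega> w R x \<partial>lborel)
      \<le> (\<Sum>z\<in>T. \<integral>\<^sup>+x\<in>ball z (\<rho> z). q x * hardy_density \<Omega> w R x \<partial>lborel) + (\<integral>\<^sup>+x\<in>K0. q x * hardy_density \<Omega> w R x \<partial>lborel)"
    proof (rule nn_integral_le_finite_cover[OF gm _ _ T(2)])
      fix x assume "q x * hardy_density \<Omega> w R x \<noteq> 0"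
      then have "x \<in> \<Omega>" by (auto simp: hardy_density_def split: split_indicator_asm)
      then show "x \<in> K0 \<or> (\<exists>z\<in>T. x \<in> ball z (\<rho> z))" using closure_subset[of \<Omega>] by (auto simp: K0_def)
    qed auto
    also have "(\<integral>\<^sup>+x\<in>K0. q x * hardy_density \<Omega> w R x \<partial>lborel) \<le> (\<integral>\<^sup>+x. ennreal (1 / d) * (q x * indicator Ks x) \<partial>lborel)"
    proof (rule nn_integral_mono)
      fix x
      show "q x * hardy_density \<Omega> w R x * indicator K0 x \<le> ennreal (1 / d) * (q x * indicator Ks x)"
      proof (cases "x \<in> K0")
        case True
        have x: "0 < bdist \<Omega> x" "bdist \<Omega> x < R" "d \<le> bdist \<Omega> x" using d True K0 w bdist_pos[OF o bd] by auto
        then have "0 < bdist \<Omega> x / R" "bdist \<Omega> x / R < 1" using w by auto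
        then have "0 < w (bdist \<Omega> x / R)" "w (bdist \<Omega> x / R) \<le> 1" using w(1) by (auto simp: weight_def)
        then have "w (bdist \<Omega> x / R) / bdist \<Omega> x \<le> 1 / d" using x d by (intro frac_le) auto
        then have "hardy_density \<Omega> w R x \<le> ennreal (1 / d)" by (auto simp: hardy_density_def indicator_def intro!: ennreal_leI)
        then have "q x * hardy_density \<Omega> w R x \<le> q x * ennreal (1 / d)" by (rule mult_left_mono) simp
        then show ?thesis using True by (simp add: Ks_def mult.commute)
      qed simp
    qed
    also have "\<dots> = ennreal (1 / d) * (\<integral>\<^sup>+x\<in>Ks. q x \<partial>lborel)" by (intro nn_integral_cmult) measurable
    finally show ?thesis by (simp add: add_left_mono)
  qed
  define C1 where "C1 = CT + 1 / d"
  have C1: "C1 > 0" "CT \<le> C1" "1 / d \<le> C1" using CT d by (auto simp: C1_def add_nonneg_pos)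
  have total: "(\<integral>\<^sup>+x. q x * hardy_density \<Omega> w R x \<partial>lborel) \<le> ennreal (C1 * (1 + A) * X)"
    if w: "weight w" "R > 0" "\<forall>x\<in>\<Omega>. bdist \<Omega> x < R" and q: "q \<in> borel_measurable borel" and A: "A > 0" and X: "X \<ge> 0"
      and T': "\<And>z. z \<in> T \<Longrightarrow> (\<integral>\<^sup>+x\<in>ball z (\<rho> z). q x * hardy_density \<Omega> w R x \<partial>lborel) \<le> ennreal (C z * (A * X))"
      and Ks': "(\<integral>\<^sup>+x\<in>Ks. q x \<partial>lborel) \<le> ennreal X" for w R q A X
  proof -
    have "(\<Sum>z\<in>T. \<integral>\<^sup>+x\<in>ball z (\<rho> z). q x * hardy_density \<Omega> w R x \<partial>lborel) \<le> (\<Sum>z\<in>T. ennreal (C z * (A * X)))"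
      by (rule sum_mono[OF T'])
    also have "\<dots> = ennreal (CT * (A * X))"
      unfolding CT_def sum_distrib_right using CT0 A X by (intro sum_ennreal) (auto intro!: mult_nonneg_nonneg)
    finally have "(\<integral>\<^sup>+x. q x * hardy_density \<Omega> w R x \<partial>lborel) \<le> ennreal (CT * (A * X)) + ennreal (1 / d) * ennreal X"
      by (intro order_trans[OF split[OF w q]] add_mono mult_left_mono Ks') auto
    also have "\<dots> = ennreal (CT * (A * X) + 1 / d * X)"
      using CT d A X by (simp add: ennreal_mult[symmetric] ennreal_plus[symmetric] del: ennreal_plus)
    also have "\<dots> \<le> ennreal (C1 * (A * X) + C1 * X)"
      using A X C1 by (intro ennreal_leI add_mono mult_right_mono) auto
    finally show ?thesis by (simp add: algebra_simps)
  qed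
  show ?thesis
  proof (rule that)
    \<comment> \<open>The sum of the constants of the two estimates, so that a single one serves
      both.\<close>
    show "C1 * (1 + CP) + C1 * V > 0" using C1 CP V0 by (simp add: add_pos_nonneg)
    fix u B assume u: "var_bound \<Omega> u B"
    note [measurable] = var_boundD(2)[OF u]
    have B: "B \<ge> 0" using var_boundD[OF u] by simp
    obtain k where k: "deviation u k Ks \<le> ennreal (CP * B)" using PI[OF u] by blast
    have "(\<integral>\<^sup>+x. ennreal \<bar>u x - k\<bar> * hardy_density \<Omega> w R x \<partial>lborel) \<le> ennreal ((C1 * (1 + CP) + C1 * V) * (1 + A) * B)"
      if w: "weight w" "weight_mass w \<le> ennreal A" "A > 0" "R > 0" "\<forall>x\<in>\<Omega>. bdist \<Omega> x < R" for w A R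
    proof -
      have R: "R > \<rho>0" using w(5) x0 by (simp add: \<rho>0_def)
      have "(\<integral>\<^sup>+x. ennreal \<bar>u x - k\<bar> * hardy_density \<Omega> w R x \<partial>lborel) \<le> ennreal (C1 * (1 + A) * ((1 + CP) * B))"
      proof (rule total[OF w(1,4,5) _ w(3)])
        fix z assume z: "z \<in> T"
        have "(\<integral>\<^sup>+x. ennreal \<bar>u x - k\<bar> * hardy_density \<Omega> w R x * indicator (ball z (\<rho> z)) x \<partial>lborel)
          = (\<integral>\<^sup>+x\<in>\<Omega> \<inter> ball z (\<rho> z). ennreal (\<bar>u x - k\<bar> * (w (bdist \<Omega> x / R) / bdist \<Omega> x)) \<partial>lborel)"
          by (intro nn_integral_cong) (auto simp: hardy_density_def indicator_def ennreal_mult'[symmetric])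
        also have "\<dots> \<le> ennreal (C z * A) * (ennreal B + deviation u k (K z))"
          by (rule E1[OF TF[OF z] w(1-3) R u])
        also have "deviation u k (K z) \<le> deviation u k Ks"
          using z by (intro nn_integral_mono) (auto simp: Ks_def indicator_def)
        also note k
        finally have "(\<integral>\<^sup>+x. ennreal \<bar>u x - k\<bar> * hardy_density \<Omega> w R x * indicator (ball z (\<rho> z)) x \<partial>lborel)
            \<le> ennreal (C z * A) * (ennreal B + ennreal (CP * B))" by (simp add: add_left_mono mult_left_mono)
        also have "\<dots> = ennreal (C z * (A * ((1 + CP) * B)))"
          using C[OF TF[OF z]] w(3) B CP by (simp add: ennreal_mult[symmetric] ennreal_plus[symmetric] distrib_right mult.assoc del: ennreal_plus)
        finally show "(\<integral>\<^sup>+x. ennreal \<bar>u x - k\<bar> * hardy_density \<Omega> w R x * indicator (ball z (\<rho> z)) x \<partial>lborel) \<le> \<dots>" .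
      next
        show "deviation u k Ks \<le> ennreal ((1 + CP) * B)"
          using B by (intro order_trans[OF k] ennreal_leI) (simp add: distrib_right)
      qed (use B CP in simp_all)
      also have "\<dots> \<le> ennreal ((C1 * (1 + CP) + C1 * V) * (1 + A) * B)"
        using C1 w(3) B V0 by (intro ennreal_leI) (simp add: algebra_simps)
      finally show ?thesis .
    qed
    then show "\<exists>k. \<forall>w A R. weight w \<longrightarrow> weight_mass w \<le> ennreal A \<longrightarrow> A > 0 \<longrightarrow> R > 0 \<longrightarrow>
       (\<forall>x\<in>\<Omega>. bdist \<Omega> x < R) \<longrightarrow> (\<integral>\<^sup>+x. ennreal \<bar>u x - k\<bar> * hardy_density \<Omega> w R x \<partial>lborel) \<le> ennreal ((C1 * (1 + CP) + C1 * V) * (1 + A) * B)"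
      by (intro exI[of _ k] allI impI)
  next
    fix w A R assume w: "weight w" "weight_mass w \<le> ennreal A" "A > 0" "R > 0" "\<forall>x\<in>\<Omega>. bdist \<Omega> x < R"
    have R: "R > \<rho>0" using w(5) x0 by (simp add: \<rho>0_def)
    have "(\<integral>\<^sup>+x. 1 * hardy_density \<Omega> w R x \<partial>lborel) \<le> ennreal (C1 * (1 + A) * V)"
    proof (rule total[OF w(1,4,5) _ w(3) V0])
      fix z assume z: "z \<in> T"
      have "(\<integral>\<^sup>+x\<in>ball z (\<rho> z). 1 * hardy_density \<Omega> w R x \<partial>lborel)
        = (\<integral>\<^sup>+x\<in>\<Omega> \<inter> ball z (\<rho> z). ennreal (w (bdist \<Omega> x / R) / bdist \<Omega> x) \<partial>lborel)"
        by (intro nn_integral_cong) (auto simp: hardy_density_def indicator_def)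
      also have "\<dots> \<le> ennreal (C z * A) * emeasure lborel (K z)" by (rule E2[OF TF[OF z] w(1-3) R])
      also have "emeasure lborel (K z) \<le> ennreal V"
        unfolding V[symmetric] using z KzKs by (intro emeasure_mono) auto
      also have "ennreal (C z * A) * ennreal V = ennreal (C z * (A * V))"
        using C[OF TF[OF z]] w(3) V0 by (simp add: ennreal_mult[symmetric] mult.assoc)
      finally show "(\<integral>\<^sup>+x\<in>ball z (\<rho> z). 1 * hardy_density \<Omega> w R x \<partial>lborel) \<le> ennreal (C z * (A * V))"
        by (simp add: mult_left_mono)
    qed (simp_all add: V)
    also have "\<dots> \<le> ennreal ((C1 * (1 + CP) + C1 * V) * (1 + A))"
      using C1 w(3) CP by (intro ennreal_leI) (simp add: algebra_simps)
    finally show "(\<integral>\<^sup>+x. hardy_density \<Omega> w R x \<partial>lborel) \<le> ennreal ((C1 * (1 + CP) + C1 * V) * (1 + A))" by simp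
  qed
qed

text \<open>The average differs from \<open>k\<close> by at most the mean of |u - k|, which the
  estimate for w(t) = t controls. That difference is then charged against the total mass of the
  Hardy density.\<close>

proposition weighted_Hardy_Poincare:
  fixes \<Omega> :: "'a::euclidean_space set"
  assumes \<Omega>: "bounded_lipschitz_domain \<Omega>"
  obtains C where "C > 0"
    "\<And>w A R u B. weight w \<Longrightarrow> weight_mass w \<le> ennreal A \<Longrightarrow> A > 0 \<Longrightarrow> R > 0 \<Longrightarrow> \<forall>x\<in>\<Omega>. bdist \<Omega> x < R \<Longrightarrow> var_bound \<Omega> u B \<Longrightarrow>
       (\<integral>\<^sup>+x. ennreal \<bar>u x - (\<integral>y. indicator \<Omega> y * u y \<partial>lborel) / measure lborel \<Omega>\<bar> * hardy_density \<Omega> w R x \<partial>lborel)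
         \<le> ennreal (C * (1 + A) * B)"
proof -
  have o: "open \<Omega>" and ne: "\<Omega> \<noteq> {}" and bd: "bounded \<Omega>"
    using \<Omega> by (auto simp: bounded_lipschitz_domain_def)
  note [measurable] = borel_open[OF o]
  obtain C where C: "C > 0"
    and E1: "\<And>u B. var_bound \<Omega> u B \<Longrightarrow> \<exists>k. \<forall>w A R. weight w \<longrightarrow> weight_mass w \<le> ennreal A \<longrightarrow> A > 0 \<longrightarrow> R > 0 \<longrightarrow>
       (\<forall>x\<in>\<Omega>. bdist \<Omega> x < R) \<longrightarrow> (\<integral>\<^sup>+x. ennreal \<bar>u x - k\<bar> * hardy_density \<Omega> w R x \<partial>lborel) \<le> ennreal (C * (1 + A) * B)"
    and E2: "\<And>w A R. weight w \<Longrightarrow> weight_mass w \<le> ennreal A \<Longrightarrow> A > 0 \<Longrightarrow> R > 0 \<Longrightarrow>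
       \<forall>x\<in>\<Omega>. bdist \<Omega> x < R \<Longrightarrow> (\<integral>\<^sup>+x. hardy_density \<Omega> w R x \<partial>lborel) \<le> ennreal (C * (1 + A))"
  proof (rule bounded_Lipschitz_estimates[OF \<Omega>], goal_cases)
    case (1 C)
    show ?case by (rule 1(1)) (fact 1)+
  qed
  define V where "V = measure lborel \<Omega>"
  have Ve: "emeasure lborel \<Omega> = ennreal V" unfolding V_def
    using emeasure_bounded_finite[OF bd] by (simp add: emeasure_eq_ennreal_measure less_top)
  have V: "V > 0"
  proof -
    obtain x e where e: "e > 0" "ball x e \<subseteq> \<Omega>" using o ne open_contains_ball by blast
    have "ennreal (measure lborel (ball x e)) = emeasure lborel (ball x e)"
      using emeasure_lborel_ball_finite[of x e] by (simp add: emeasure_eq_ennreal_measure less_top)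
    also have "\<dots> \<le> ennreal V" unfolding Ve[symmetric] using e by (intro emeasure_mono) auto
    finally have "measure lborel (ball x e) \<le> V" by (simp add: V_def)
    then show ?thesis using content_ball_pos[OF e(1), of x] by linarith
  qed
  obtain y0 where y0: "y0 \<in> frontier \<Omega>" using frontier_bounded_domain[OF bd ne] by blast
  \<comment> \<open>All of \<Omega> lies within \<open>D\<close> of a frontier point, so
    \<open>D\<close> is an admissible value of \<open>R\<close> for the auxiliary weight t, chosen
    from \<Omega> alone.\<close>
  obtain D where D: "D > 0" "\<Omega> \<subseteq> ball y0 D" using bounded_subset_ballD[OF bd, of y0] by blast
  have bD: "\<forall>x\<in>\<Omega>. bdist \<Omega> x < D"
    using D y0 infdist_le[OF y0] by (auto simp: bdist_def dist_commute subset_eq intro: le_less_trans)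
  show ?thesis
  proof (rule that)
    show "C + 2 * C * D / V * C > 0" using C D V by (auto intro!: add_pos_pos)
    fix w A R u B
    assume w: "weight w" "weight_mass w \<le> ennreal A" "A > 0" "R > 0" "\<forall>x\<in>\<Omega>. bdist \<Omega> x < R" and u: "var_bound \<Omega> u B"
    note [measurable] = var_boundD(2)[OF u]
    note ui = var_boundD(1)[OF u]
    have B: "B \<ge> 0" using var_boundD[OF u] by simp
    have [measurable]: "hardy_density \<Omega> w R \<in> borel_measurable borel"
      using w by (intro hardy_density_measurable o bd) auto
    obtain k where k: "\<And>w A R. weight w \<Longrightarrow> weight_mass w \<le> ennreal A \<Longrightarrow> A > 0 \<Longrightarrow> R > 0 \<Longrightarrow>
       (\<forall>x\<in>\<Omega>. bdist \<Omega> x < R) \<Longrightarrow> (\<integral>\<^sup>+x. ennreal \<bar>u x - k\<bar> * hardy_density \<Omega> w R x \<partial>lborel) \<le> ennreal (C * (1 + A) * B)"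
      using E1[OF u] by blast
    define a where "a = (\<integral>y. indicator \<Omega> y * u y \<partial>lborel) / V"
    have iu: "integrable lborel (\<lambda>x. indicator \<Omega> x * u x)" "integrable lborel (\<lambda>x. indicator \<Omega> x * (u x - k))"
    proof -
      have fin: "integrable lborel (indicator \<Omega> :: 'a \<Rightarrow> real)" using Ve by (simp add: integrable_real_indicator)
      show 1: "integrable lborel (\<lambda>x. indicator \<Omega> x * u x)"
        by (rule Bochner_Integration.integrable_bound[OF ui]) (auto simp: indicator_def)
      have "integrable lborel (\<lambda>x. indicator \<Omega> x * u x - k * indicator \<Omega> x)" using 1 fin by simp
      then show "integrable lborel (\<lambda>x. indicator \<Omega> x * (u x - k))" by (simp add: algebra_simps)
    qed
    have "ennreal (1 / D) * deviation u k \<Omega> = (\<integral>\<^sup>+x. ennreal \<bar>u x - k\<bar> * hardy_density \<Omega> (\<lambda>t. t) D x \<partial>lborel)"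
    proof -
      have "hardy_density \<Omega> (\<lambda>t. t) D x = ennreal (1 / D) * indicator \<Omega> x" for x
        using bdist_pos[OF o bd, of x] by (auto simp: hardy_density_def indicator_def)
      then show ?thesis by (subst nn_integral_cmult[symmetric]) (auto simp: mult_ac)
    qed
    also have "\<dots> \<le> ennreal (C * (1 + 1) * B)" by (rule k[OF weight_id _ D(1) bD]) simp
    finally have "deviation u k \<Omega> \<le> ennreal (1 / (1 / D)) * ennreal (C * (1 + 1) * B)"
      using D by (intro ennreal_le_divide_real) auto
    then have L1: "deviation u k \<Omega> \<le> ennreal (2 * C * D * B)"
      using D C B by (simp add: ennreal_mult[symmetric] mult_ac)
    have "\<bar>a - k\<bar> \<le> 2 * C * D * B / V"
    proof -
      have "a - k = (\<integral>x. indicator \<Omega> x * (u x - k) \<partial>lborel) / V"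
      proof -
        have "(\<integral>x. indicator \<Omega> x * (u x - k) \<partial>lborel) = (\<integral>x. indicator \<Omega> x * u x - k * indicator \<Omega> x \<partial>lborel)"
          by (simp add: algebra_simps)
        also have "\<dots> = (\<integral>x. indicator \<Omega> x * u x \<partial>lborel) - k * V"
          using iu Ve by (subst Bochner_Integration.integral_diff) (auto simp: V_def integrable_real_indicator)
        finally show ?thesis using V by (simp add: a_def diff_divide_distrib)
      qed
      moreover have "\<bar>\<integral>x. indicator \<Omega> x * (u x - k) \<partial>lborel\<bar> \<le> 2 * C * D * B"
      proof -
        have "ennreal (\<integral>x. \<bar>indicator \<Omega> x * (u x - k)\<bar> \<partial>lborel) = (\<integral>\<^sup>+x. ennreal \<bar>indicator \<Omega> x * (u x - k)\<bar> \<partial>lborel)"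
          using iu(2) by (intro nn_integral_eq_integral[symmetric]) auto
        also have "\<dots> = deviation u k \<Omega>"
          by (intro nn_integral_cong) (auto simp: indicator_def)
        finally have "(\<integral>x. \<bar>indicator \<Omega> x * (u x - k)\<bar> \<partial>lborel) \<le> 2 * C * D * B"
          using L1 C D B ennreal_le_iff[of "2 * C * D * B"] by (metis less_imp_le mult_nonneg_nonneg zero_le_numeral)
        then show ?thesis using integral_abs_bound[of lborel "\<lambda>x. indicator \<Omega> x * (u x - k)"] by linarith
      qed
      ultimately show ?thesis using V by (simp add: divide_right_mono)
    qed
    then have ak: "ennreal \<bar>k - a\<bar> \<le> ennreal (2 * C * D * B / V)" by (intro ennreal_leI) (simp add: abs_minus_commute)
    have "(\<integral>\<^sup>+x. ennreal \<bar>u x - a\<bar> * hardy_density \<Omega> w R x \<partial>lborel)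
        \<le> (\<integral>\<^sup>+x. ennreal \<bar>u x - k\<bar> * hardy_density \<Omega> w R x + ennreal \<bar>k - a\<bar> * hardy_density \<Omega> w R x \<partial>lborel)"
      unfolding distrib_right[symmetric]
      by (intro nn_integral_mono mult_right_mono) (auto simp: ennreal_plus[symmetric] simp del: ennreal_plus intro!: ennreal_leI)
    also have "\<dots> = (\<integral>\<^sup>+x. ennreal \<bar>u x - k\<bar> * hardy_density \<Omega> w R x \<partial>lborel) + ennreal \<bar>k - a\<bar> * (\<integral>\<^sup>+x. hardy_density \<Omega> w R x \<partial>lborel)"
      by (subst nn_integral_add) (auto simp: nn_integral_cmult)
    also have "\<dots> \<le> ennreal (C * (1 + A) * B) + ennreal (2 * C * D * B / V) * ennreal (C * (1 + A))"
      by (intro add_mono mult_mono ak k[OF w] E2[OF w]) auto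
    also have "\<dots> = ennreal (C * (1 + A) * B + 2 * C * D * B / V * (C * (1 + A)))"
      using C D B V w(3) by (simp add: ennreal_mult[symmetric] ennreal_plus[symmetric] del: ennreal_plus)
    also have "C * (1 + A) * B + 2 * C * D * B / V * (C * (1 + A)) = (C + 2 * C * D / V * C) * (1 + A) * B"
      by (simp add: algebra_simps)
    finally show "(\<integral>\<^sup>+x. ennreal \<bar>u x - (\<integral>y. indicator \<Omega> y * u y \<partial>lborel) / measure lborel \<Omega>\<bar> * hardy_density \<Omega> w R x \<partial>lborel)
         \<le> ennreal ((C + 2 * C * D / V * C) * (1 + A) * B)" by (simp add: a_def V_def)
  qed
qed

section \<open>Iterated logarithmic weights\<close>


text \<open>The bound t <= L1 t amounts to ln (1/t) <= 1/t - 1. Iterated, it bounds every L_m from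
  below independently of m.\<close>

lemma L1_bounds:
  assumes "0 < t" "t < 1"
  shows "0 < L1 t" "L1 t < 1" "t \<le> L1 t"
proof -
  have l: "ln t < 0" using assms by simp
  show "0 < L1 t" "L1 t < 1" using l by (auto simp: L1_def)
  have "ln (1 / t) \<le> 1 / t - 1" using assms by (intro ln_le_minus_one) auto
  then have "1 - ln t \<le> 1 / t" using assms by (simp add: ln_div)
  then have "1 / (1 / t) \<le> L1 t" unfolding L1_def using l by (intro frac_le) linarith+
  then show "t \<le> L1 t" by simp
qed

lemma Lm_Suc: "Lm (Suc m) t = L1 (Lm m t)" by (simp add: Lm_def)

lemma Lm_0: "Lm 0 t = t" by (simp add: Lm_def)

lemma Lm_bounds:
  assumes "0 < t" "t < 1"
  shows "0 < Lm m t" "Lm m t < 1" "t \<le> Lm m t"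
proof -
  have "0 < Lm m t \<and> Lm m t < 1 \<and> t \<le> Lm m t"
  proof (induction m)
    case (Suc m)
    then show ?case using L1_bounds[of "Lm m t"] by (auto simp: Lm_Suc)
  qed (use assms in \<open>simp add: Lm_0\<close>)
  then show "0 < Lm m t" "Lm m t < 1" "t \<le> Lm m t" by auto
qed

lemma Lm_mono:
  assumes "0 < s" "s \<le> t" "t < 1"
  shows "Lm m s \<le> Lm m t"
proof (induction m)
  case (Suc m)
  have "0 < Lm m s" "0 < Lm m t" "Lm m t < 1" using Lm_bounds assms by auto
  then have "ln (Lm m s) \<le> ln (Lm m t)" "ln (Lm m t) < 0" using Suc by auto
  then show ?case unfolding Lm_Suc L1_def by (intro frac_le) auto
qed (use assms in \<open>simp add: Lm_0\<close>)

text \<open>The derivative of L1 at s is L1(s)^2 / s. In the chain rule the division by L_m cancels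
  one of the two factors L_m in the derivative of L_m, and the other one joins the product.\<close>

lemma Lm_has_real_derivative:
  assumes t: "0 < t" "t < 1"
  shows "(Lm (Suc m) has_real_derivative (\<Prod>i\<in>{1..<Suc m}. Lm i t) * (Lm (Suc m) t)\<^sup>2 / t) (at t)"
proof (induction m)
  have L1': "(L1 has_real_derivative (L1 s)\<^sup>2 / s) (at s)" if "0 < s" "s < 1" for s
  proof -
    have "ln s < 0" using that by simp
    then have "ln s \<noteq> 1" by linarith
    then show ?thesis unfolding L1_def[abs_def] using that
      by (auto intro!: derivative_eq_intros simp: power2_eq_square divide_simps)
  qed
  {
    case 0
    show ?case using L1'[OF t] by (simp add: Lm_def)
  next
    case (Suc m)
    have b: "0 < Lm (Suc m) t" "Lm (Suc m) t < 1" using Lm_bounds t by auto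
    have "Lm (Suc (Suc m)) = (\<lambda>x. L1 (Lm (Suc m) x))" by (simp add: Lm_Suc fun_eq_iff)
    moreover have "((\<lambda>x. L1 (Lm (Suc m) x)) has_real_derivative
        (L1 (Lm (Suc m) t))\<^sup>2 / Lm (Suc m) t * ((\<Prod>i\<in>{1..<Suc m}. Lm i t) * (Lm (Suc m) t)\<^sup>2 / t)) (at t)"
      by (rule DERIV_chain2[OF L1'[OF b] Suc])
    moreover have "(L1 (Lm (Suc m) t))\<^sup>2 / Lm (Suc m) t * ((\<Prod>i\<in>{1..<Suc m}. Lm i t) * (Lm (Suc m) t)\<^sup>2 / t)
        = (\<Prod>i\<in>{1..<Suc (Suc m)}. Lm i t) * (Lm (Suc (Suc m)) t)\<^sup>2 / t"
      using b by (simp add: Lm_Suc[of "Suc m"] power2_eq_square)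
    ultimately show ?case by simp
  }
qed

lemma Lm_continuous_on: "continuous_on {0<..<1} (Lm m)"
proof (cases m)
  case (Suc k)
  then show ?thesis
    using Lm_has_real_derivative by (force intro!: continuous_at_imp_continuous_on DERIV_isCont)
qed (simp add: Lm_0[abs_def] Lm_def)

text \<open>By induction, since L1 s < \<epsilon> as soon as ln s < 1 - 1/\<epsilon>. It controls
  the antiderivatives at a lower endpoint close to 0.\<close>

lemma Lm_small:
  assumes "0 < \<epsilon>"
  shows "\<exists>\<delta>>0. \<forall>t. 0 < t \<and> t < \<delta> \<longrightarrow> Lm m t < \<epsilon>"
  using assms
proof (induction m arbitrary: \<epsilon>)
  case 0
  then show ?case by (auto simp: Lm_0)
next
  case (Suc m)
  define d where "d = min 1 (exp (1 - 1 / \<epsilon>))"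
  have "d > 0" by (simp add: d_def)
  then obtain \<delta> where \<delta>: "\<delta> > 0" "\<And>t. 0 < t \<Longrightarrow> t < \<delta> \<Longrightarrow> Lm m t < d" using Suc.IH by blast
  have "Lm (Suc m) t < \<epsilon>" if t: "0 < t" "t < min 1 \<delta>" for t
  proof -
    have p: "0 < Lm m t" using Lm_bounds t by auto
    have "Lm m t < exp (1 - 1 / \<epsilon>)" using \<delta>(2)[of t] t by (simp add: d_def)
    then have "ln (Lm m t) < 1 - 1 / \<epsilon>" using p by (metis ln_exp ln_less_cancel_iff exp_gt_zero)
    then have "1 / \<epsilon> < 1 - ln (Lm m t)" by simp
    moreover have "0 < 1 / \<epsilon>" using Suc.prems by simp
    ultimately have "1 / (1 - ln (Lm m t)) < 1 / (1 / \<epsilon>)"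
      by (intro divide_strict_left_mono mult_pos_pos) linarith+
    then show ?thesis by (simp add: Lm_Suc L1_def)
  qed
  then show ?case using \<delta>(1) by (intro exI[of _ "min 1 \<delta>"]) auto
qed

definition log_weight :: "real \<Rightarrow> nat \<Rightarrow> real \<Rightarrow> real" where
  "log_weight \<beta> m t = (\<Prod>i\<in>{1..<m}. Lm i t) * Lm m t powr \<beta>"

lemma weight_log_weight:
  assumes "\<beta> > 0"
  shows "weight (log_weight \<beta> m)"
  unfolding weight_def
proof (intro conjI allI impI)
  show "continuous_on {0<..<1} (log_weight \<beta> m)"
    unfolding log_weight_def[abs_def] using Lm_bounds(1)[of _ m]
    by (intro continuous_on_mult continuous_on_prod continuous_on_powr Lm_continuous_on continuous_on_const) (auto simp: less_le)
next
  fix t :: real assume t: "0 < t \<and> t < 1"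
  show "0 < log_weight \<beta> m t"
  proof -
    have p: "0 < Lm i t" for i using Lm_bounds(1)[of t i] t by auto
    have "0 < (\<Prod>i\<in>{1..<m}. Lm i t)" by (intro prod_pos p)
    moreover have "0 < Lm m t powr \<beta>" using p[of m] by (simp only: powr_gt_zero)
    ultimately show ?thesis unfolding log_weight_def by (rule mult_pos_pos)
  qed
  have "(\<Prod>i\<in>{1..<m}. Lm i t) \<le> 1" using Lm_bounds[of t] t by (intro prod_le_1) (auto intro: less_imp_le)
  moreover have "Lm m t powr \<beta> \<le> 1" using Lm_bounds[of t m] t assms by (auto intro!: powr_le1)
  ultimately show "log_weight \<beta> m t \<le> 1" unfolding log_weight_def by (intro mult_le_one) auto
next
  fix s t :: real assume t: "0 < s \<and> s \<le> t \<and> t < 1"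
  have nn: "0 \<le> Lm i s" for i using Lm_bounds(1)[of s i] t by auto
  show "log_weight \<beta> m s \<le> log_weight \<beta> m t"
    unfolding log_weight_def using Lm_mono[of s t] t nn assms order_trans[OF nn Lm_mono[of s t]]
    by (intro mult_mono prod_mono powr_mono2 prod_nonneg) (auto intro!: prod_nonneg)
qed

lemma nn_integral_FTC_interval:
  fixes f F :: "real \<Rightarrow> real"
  assumes "a \<le> b" "\<And>x. a \<le> x \<Longrightarrow> x \<le> b \<Longrightarrow> (F has_real_derivative f x) (at x)"
    "\<And>x. a \<le> x \<Longrightarrow> x \<le> b \<Longrightarrow> 0 \<le> f x"
  shows "(\<integral>\<^sup>+x\<in>{a..b}. ennreal (f x) \<partial>lborel) = ennreal (F b - F a)"
proof (rule nn_integral_has_integral_lebesgue')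
  show "(f has_integral F b - F a) {a..b}"
    using assms(1,2) by (intro fundamental_theorem_of_calculus)
      (auto simp: has_real_derivative_iff_has_vector_derivative[symmetric] intro: has_field_derivative_at_within)
qed (use assms in auto)

lemma nn_integral_log_weight_interval:
  assumes "\<beta> > 1" "0 < a" "a \<le> b" "b < 1"
  shows "(\<integral>\<^sup>+t\<in>{a..b}. ennreal (log_weight \<beta> (Suc m) t / t) \<partial>lborel)
    = ennreal (Lm (Suc m) b powr (\<beta> - 1) / (\<beta> - 1) - Lm (Suc m) a powr (\<beta> - 1) / (\<beta> - 1))"
proof (rule nn_integral_FTC_interval[OF assms(3)])
  fix t assume t: "a \<le> t" "t \<le> b"
  then have t': "0 < t" "t < 1" using assms by auto
  have p: "0 < Lm (Suc m) t" using Lm_bounds t' by auto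
  have "((\<lambda>t. Lm (Suc m) t powr (\<beta> - 1) / (\<beta> - 1)) has_real_derivative
      (\<beta> - 1) * Lm (Suc m) t powr (\<beta> - 1 - 1) * ((\<Prod>i\<in>{1..<Suc m}. Lm i t) * (Lm (Suc m) t)\<^sup>2 / t) / (\<beta> - 1)) (at t)"
    by (intro DERIV_cdivide DERIV_chain2[OF has_real_derivative_powr[OF p] Lm_has_real_derivative[OF t']])
  moreover have "(\<beta> - 1) * Lm (Suc m) t powr (\<beta> - 1 - 1) * ((\<Prod>i\<in>{1..<Suc m}. Lm i t) * (Lm (Suc m) t)\<^sup>2 / t) / (\<beta> - 1)
      = log_weight \<beta> (Suc m) t / t"
  proof -
    have "Lm (Suc m) t powr (\<beta> - 1 - 1) * (Lm (Suc m) t)\<^sup>2 = Lm (Suc m) t powr \<beta>"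
    proof -
      have "x powr (\<beta> - 1 - 1) * x\<^sup>2 = x powr \<beta>" if "x > 0" for x :: real
      proof -
        have "x\<^sup>2 = x powr 2" using that by simp
        then have "x powr (\<beta> - 1 - 1) * x\<^sup>2 = x powr (\<beta> - 1 - 1 + 2)" by (simp only: powr_add)
        then show ?thesis by simp
      qed
      from this[OF p] show ?thesis .
    qed
    then show ?thesis using assms(1) by (simp add: log_weight_def)
  qed
  ultimately show "((\<lambda>t. Lm (Suc m) t powr (\<beta> - 1) / (\<beta> - 1)) has_real_derivative log_weight \<beta> (Suc m) t / t) (at t)" by simp
  show "0 \<le> log_weight \<beta> (Suc m) t / t"
    using weight_log_weight[of \<beta> "Suc m"] assms(1) t' by (auto simp: weight_def intro!: divide_nonneg_pos less_imp_le)
qed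

text \<open>The antiderivative is available only inside (0,1), so closed subintervals exhaust it and
  Fatou passes to the limit. At the upper endpoint L_m < 1 gives a bound free of m.\<close>

lemma nn_integral_log_weight_le:
  assumes "\<beta> > 1" "m \<ge> 1"
  shows "(\<integral>\<^sup>+t. weight_density (log_weight \<beta> m) t \<partial>lborel) \<le> ennreal (1 / (\<beta> - 1))"
proof -
  obtain k where m: "m = Suc k" using assms(2) by (cases m) auto
  have w: "weight (log_weight \<beta> m)" using assms by (intro weight_log_weight) auto
  note [measurable] = weight_density_measurable[OF w]
  define a b where "a = (\<lambda>n. 1 / real (n + 2))" and "b = (\<lambda>n. 1 - 1 / real (n + 2))"
  have ab: "0 < a n" "a n \<le> b n" "b n < 1" for n by (auto simp: a_def b_def field_simps)
  have lim: "weight_density (log_weight \<beta> m) t = liminf (\<lambda>n. weight_density (log_weight \<beta> m) t * indicator {a n..b n} t)" for t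
  proof (cases "0 < t \<and> t < 1")
    case True
    have "(\<lambda>n. 1 / real (n + 2)) \<longlonglongrightarrow> 0"
      using LIMSEQ_ignore_initial_segment[OF lim_const_over_n, of 1 2] by simp
    then have "\<forall>\<^sub>F n in sequentially. 1 / real (n + 2) < min t (1 - t)"
      using True by (intro order_tendstoD(2)) auto
    then have "\<forall>\<^sub>F n in sequentially. weight_density (log_weight \<beta> m) t * indicator {a n..b n} t = weight_density (log_weight \<beta> m) t"
      by eventually_elim (auto simp: a_def b_def indicator_def)
    then have "(\<lambda>n. weight_density (log_weight \<beta> m) t * indicator {a n..b n} t) \<longlonglongrightarrow> weight_density (log_weight \<beta> m) t"
      by (rule tendsto_eventually)
    then show ?thesis by (intro lim_imp_Liminf[symmetric]) auto
  next
    case False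
    then have "weight_density (log_weight \<beta> m) t = 0" by (auto simp: weight_density_def)
    then show ?thesis by (simp add: Liminf_const)
  qed
  have "(\<integral>\<^sup>+t. weight_density (log_weight \<beta> m) t \<partial>lborel)
      \<le> liminf (\<lambda>n. \<integral>\<^sup>+t\<in>{a n..b n}. weight_density (log_weight \<beta> m) t \<partial>lborel)"
    by (subst lim, rule nn_integral_liminf) measurable
  also have "\<dots> \<le> ennreal (1 / (\<beta> - 1))"
  proof (rule Liminf_le, simp, rule always_eventually, rule allI)
    fix n
    have "(\<integral>\<^sup>+t\<in>{a n..b n}. weight_density (log_weight \<beta> m) t \<partial>lborel)
        = (\<integral>\<^sup>+t\<in>{a n..b n}. ennreal (log_weight \<beta> (Suc k) t / t) \<partial>lborel)"
      using ab[of n] by (intro nn_integral_cong) (auto simp: weight_density_def indicator_def m)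
    also have "\<dots> = ennreal (Lm (Suc k) (b n) powr (\<beta> - 1) / (\<beta> - 1) - Lm (Suc k) (a n) powr (\<beta> - 1) / (\<beta> - 1))"
      by (rule nn_integral_log_weight_interval[OF assms(1) ab])
    also have "\<dots> \<le> ennreal (1 / (\<beta> - 1))"
    proof (rule ennreal_leI)
      have "Lm (Suc k) (b n) powr (\<beta> - 1) \<le> 1"
        using Lm_bounds[of "b n" "Suc k"] ab[of n] assms(1) by (intro powr_le1) auto
      then have "Lm (Suc k) (b n) powr (\<beta> - 1) / (\<beta> - 1) \<le> 1 / (\<beta> - 1)"
        using assms(1) by (intro divide_right_mono) auto
      moreover have "0 \<le> Lm (Suc k) (a n) powr (\<beta> - 1) / (\<beta> - 1)" using assms(1) by simp
      ultimately show "Lm (Suc k) (b n) powr (\<beta> - 1) / (\<beta> - 1) - Lm (Suc k) (a n) powr (\<beta> - 1) / (\<beta> - 1) \<le> 1 / (\<beta> - 1)" by linarith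
    qed
    finally show "(\<integral>\<^sup>+t\<in>{a n..b n}. weight_density (log_weight \<beta> m) t \<partial>lborel) \<le> ennreal (1 / (\<beta> - 1))" .
  qed
  finally show ?thesis .
qed

text \<open>The upper endpoint \<eta>/2 contributes at least (\<eta>/2)^(\<beta>-1)/(\<beta>-1)
  because L_m(t) >= t, and the lower endpoint can be chosen to cost at most half of that. The gain
  is a bound independent of m.\<close>

lemma nn_integral_log_weight_near_0_ge:
  assumes \<beta>: "\<beta> > 1" and \<eta>: "0 < \<eta>" "\<eta> < 1" and m: "m \<ge> 1"
  shows "ennreal ((\<eta> / 2) powr (\<beta> - 1) / 2 / (\<beta> - 1)) \<le> (\<integral>\<^sup>+t\<in>{0<..<\<eta>}. weight_density (log_weight \<beta> m) t \<partial>lborel)"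
proof -
  obtain k where m: "m = Suc k" using m by (cases m) auto
  \<comment> \<open>Chosen so that \<epsilon>^(\<beta>-1) is half of (\<eta>/2)^(\<beta>-1).\<close>
  define \<epsilon> where "\<epsilon> = ((\<eta> / 2) powr (\<beta> - 1) / 2) powr (1 / (\<beta> - 1))"
  have "\<epsilon> > 0" using \<eta> by (simp add: \<epsilon>_def)
  then obtain \<delta> where \<delta>: "\<delta> > 0" "\<And>t. 0 < t \<Longrightarrow> t < \<delta> \<Longrightarrow> Lm m t < \<epsilon>"
    using Lm_small[of \<epsilon> m] by blast
  define a where "a = min (\<delta> / 2) (\<eta> / 2)"
  have a: "0 < a" "a \<le> \<eta> / 2" "a < \<delta>" using \<delta> \<eta> by (auto simp: a_def)
  have "Lm m a powr (\<beta> - 1) \<le> \<epsilon> powr (\<beta> - 1)"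
    using \<delta>(2)[OF a(1,3)] Lm_bounds(1)[of a m] a \<eta> \<beta> by (intro powr_mono2) auto
  also have "\<dots> = (\<eta> / 2) powr (\<beta> - 1) / 2" using \<beta> \<eta> by (simp add: \<epsilon>_def powr_powr)
  finally have 1: "Lm m a powr (\<beta> - 1) \<le> (\<eta> / 2) powr (\<beta> - 1) / 2" .
  have 2: "(\<eta> / 2) powr (\<beta> - 1) \<le> Lm m (\<eta> / 2) powr (\<beta> - 1)"
    using Lm_bounds[of "\<eta> / 2" m] \<eta> \<beta> by (intro powr_mono2) auto
  have "(\<eta> / 2) powr (\<beta> - 1) / 2 / (\<beta> - 1) \<le> (Lm m (\<eta> / 2) powr (\<beta> - 1) - Lm m a powr (\<beta> - 1)) / (\<beta> - 1)"
    using 1 2 \<beta> by (intro divide_right_mono) auto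
  then have "ennreal ((\<eta> / 2) powr (\<beta> - 1) / 2 / (\<beta> - 1))
      \<le> ennreal (Lm m (\<eta> / 2) powr (\<beta> - 1) / (\<beta> - 1) - Lm m a powr (\<beta> - 1) / (\<beta> - 1))"
    by (intro ennreal_leI) (simp add: diff_divide_distrib)
  also have "\<dots> = (\<integral>\<^sup>+t\<in>{a..\<eta>/2}. ennreal (log_weight \<beta> m t / t) \<partial>lborel)"
    unfolding m using \<beta> a \<eta> by (intro nn_integral_log_weight_interval[symmetric]) auto
  also have "\<dots> \<le> (\<integral>\<^sup>+t\<in>{0<..<\<eta>}. weight_density (log_weight \<beta> m) t \<partial>lborel)"
    using a \<eta> by (intro nn_integral_mono) (auto simp: weight_density_def indicator_def)
  finally show ?thesis .
qed

text \<open>For \<beta> <= 1 the weight with m = 2 dominates L_1 L_2, and L_1 L_2 / t is the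
  derivative of ln L_2, which is unbounded below at 0.\<close>

lemma nn_integral_log_weight_near_0_eq_top:
  assumes \<beta>: "0 < \<beta>" "\<beta> \<le> 1" and \<eta>: "0 < \<eta>" "\<eta> < 1"
  shows "(\<integral>\<^sup>+t\<in>{0<..<\<eta>}. weight_density (log_weight \<beta> 2) t \<partial>lborel) = top"
proof -
  define I where "I = (\<integral>\<^sup>+t\<in>{0<..<\<eta>}. weight_density (log_weight \<beta> 2) t \<partial>lborel)"
  have "ennreal (real n) \<le> I" for n
  proof -
    \<comment> \<open>This is L_2(\<eta>/2) exp(-n): once L_2 a is below it, ln L_2 grows by more
      than n between a and \<eta>/2.\<close>
    define \<epsilon> where "\<epsilon> = exp (ln (Lm 2 (\<eta> / 2)) - real n)"
    have "\<epsilon> > 0" by (simp add: \<epsilon>_def)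
    then obtain \<delta> where \<delta>: "\<delta> > 0" "\<And>t. 0 < t \<Longrightarrow> t < \<delta> \<Longrightarrow> Lm 2 t < \<epsilon>"
      using Lm_small[of \<epsilon> 2] by blast
    define a where "a = min (\<delta> / 2) (\<eta> / 2)"
    have a: "0 < a" "a \<le> \<eta> / 2" "a < \<delta>" using \<delta> \<eta> by (auto simp: a_def)
    have "0 < Lm 2 a" using Lm_bounds[of a 2] a \<eta> by auto
    then have "ln (Lm 2 a) < ln \<epsilon>" using \<delta>(2)[OF a(1,3)] by simp
    then have "real n \<le> ln (Lm 2 (\<eta> / 2)) - ln (Lm 2 a)" by (simp add: \<epsilon>_def)
    then have "ennreal (real n) \<le> ennreal (ln (Lm 2 (\<eta> / 2)) - ln (Lm 2 a))" by (rule ennreal_leI)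
    also have "\<dots> = (\<integral>\<^sup>+t\<in>{a..\<eta>/2}. ennreal (Lm 1 t * Lm 2 t / t) \<partial>lborel)"
    proof (rule nn_integral_FTC_interval[symmetric, OF a(2)])
      fix t assume t: "a \<le> t" "t \<le> \<eta> / 2"
      then have t': "0 < t" "t < 1" using a \<eta> by auto
      have p: "0 < Lm 1 t" "0 < Lm 2 t" using Lm_bounds t' by auto
      have "(Lm 2 has_real_derivative Lm 1 t * (Lm 2 t)\<^sup>2 / t) (at t)"
        using Lm_has_real_derivative[OF t', of 1] by (simp add: numeral_2_eq_2)
      from DERIV_chain2[OF DERIV_ln[OF p(2)] this]
      show "((\<lambda>t. ln (Lm 2 t)) has_real_derivative Lm 1 t * Lm 2 t / t) (at t)"
        using p by (simp add: power2_eq_square field_simps)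
      show "0 \<le> Lm 1 t * Lm 2 t / t" using p t' by simp
    qed
    also have "\<dots> \<le> I" unfolding I_def
    proof (rule nn_integral_mono)
      fix t
      show "ennreal (Lm 1 t * Lm 2 t / t) * indicator {a..\<eta>/2} t \<le> weight_density (log_weight \<beta> 2) t * indicator {0<..<\<eta>} t"
      proof (cases "t \<in> {a..\<eta>/2}")
        case True
        then have t: "0 < t" "t < \<eta>" "t < 1" using a \<eta> by auto
        have p: "0 < Lm 1 t" "0 < Lm 2 t" "Lm 2 t < 1" using Lm_bounds t by auto
        have "Lm 2 t powr 1 \<le> Lm 2 t powr \<beta>" using p \<beta> by (intro powr_mono') auto
        then have "Lm 1 t * Lm 2 t \<le> log_weight \<beta> 2 t"
          using p by (simp add: log_weight_def numeral_2_eq_2)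
        then have "Lm 1 t * Lm 2 t / t \<le> log_weight \<beta> 2 t / t" using t by (intro divide_right_mono) auto
        then show ?thesis using True t by (auto simp: weight_density_def intro!: ennreal_leI)
      qed simp
    qed
    finally show ?thesis .
  qed
  then have "I = top" by (metis ennreal_of_nat_eq_real_of_nat ennreal_top_neq_one ennreal_Ex_less_of_nat leD less_top)
  then show ?thesis by (simp add: I_def)
qed

section \<open>Lower bounds and reduction to Borel functions\<close>


text \<open>The upper estimate reversed: h/(L R) <= delta/R and delta <= h make w(h/(L R))/h a
  minorant, again by monotonicity. Each vertical line through a small ball about z meets all heights
  in (0, H) before leaving the larger ball, and Fubini over these lines gives the bound.
  \<open>\<kappa>\<close> and \<open>\<eta>\<close> are fixed before \<open>w\<close>, so they are
  common to all m.\<close>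

lemma hardy_density_lower_bound:
  fixes \<Omega> :: "'a::euclidean_space set"
  assumes o: "open \<Omega>" and bd: "bounded \<Omega>" and c: "chart \<Omega> z r e h L" and \<epsilon>: "\<epsilon> > 0" and R: "R > 0" "\<forall>x\<in>\<Omega>. bdist \<Omega> x < R"
  obtains \<kappa> \<eta> where "\<kappa> > 0" "0 < \<eta>" "\<eta> < 1"
    "\<And>w. weight w \<Longrightarrow> ennreal \<kappa> * (\<integral>\<^sup>+t\<in>{0<..<\<eta>}. weight_density w t \<partial>lborel)
       \<le> (\<integral>\<^sup>+x\<in>ball z \<epsilon>. hardy_density \<Omega> w R x \<partial>lborel)"
proof -
  note r = chartD(2)[OF c] and e = chartD(3)[OF c] and L = chartD(4)[OF c]
  have lip: "\<bar>h x - h y\<bar> \<le> L * dist x y" for x y by (rule chartD[OF c])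
  have tr: "h (x + s *\<^sub>R e) = h x - s" for x s by (rule chartD[OF c])
  have [measurable]: "h \<in> borel_measurable borel" using chart_continuous[OF c] by (simp add: borel_measurable_continuous_onI)
  define \<rho> where "\<rho> = min \<epsilon> (r / (4 * (1 + L)))"
  define LR where "LR = L * R"
  \<comment> \<open>At most LR/2, so that \<eta> < 1. At most \<rho>/4, so that on a line starting
    within \<epsilon>' of z the heights in (0, H) occur within \<rho>/2 of z, given (1 + L)
    \<epsilon>' = \<rho>/4.\<close>
  define H where "H = min (\<rho> / 4) (LR / 2)"
  define \<epsilon>' where "\<epsilon>' = \<rho> / (4 * (1 + L))"
  define \<eta> where "\<eta> = H / LR"
  have \<rho>: "\<rho> > 0" "\<rho> \<le> \<epsilon>" using \<epsilon> r L by (auto simp: \<rho>_def)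
  have \<rho>1: "(1 + L) * \<rho> \<le> r / 4"
  proof -
    have "\<rho> \<le> r / (4 * (1 + L))" by (simp add: \<rho>_def)
    then show ?thesis using L by (simp add: field_simps)
  qed
  have LR: "LR > 0" unfolding LR_def using L R by simp
  have H: "H > 0" "H \<le> \<rho> / 4" using \<rho> LR by (auto simp: H_def)
  have "H \<le> LR / 2" by (simp add: H_def)
  then have \<eta>: "0 < \<eta>" "\<eta> < 1" using H LR by (auto simp: \<eta>_def pos_divide_less_eq)
  have \<epsilon>': "\<epsilon>' > 0" "(1 + L) * \<epsilon>' = \<rho> / 4" using \<rho> L by (auto simp: \<epsilon>'_def field_simps)
  define V where "V = measure lborel (ball z \<epsilon>')"
  have V: "V > 0" "emeasure lborel (ball z \<epsilon>') = ennreal V"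
    using \<epsilon>'(1) emeasure_lborel_ball_finite[of z \<epsilon>']
    by (auto simp: V_def content_ball_pos emeasure_eq_ennreal_measure less_top)
  show ?thesis
  proof (rule that)
    show "V / (2 * \<rho>) > 0" using V \<rho> by simp
    show "0 < \<eta>" "\<eta> < 1" by (fact \<eta>)+
    fix w :: "real \<Rightarrow> real" assume w: "weight w"
    note [measurable] = weight_density_measurable[OF w]
    define f where "f = (\<lambda>t. weight_density w t * indicator {0<..<\<eta>} t)"
    have [measurable]: "f \<in> borel_measurable borel" unfolding f_def by measurable
    define g where "g = (\<lambda>x. ennreal (1 / LR) * f (h x / LR))"
    have [measurable]: "g \<in> borel_measurable borel" unfolding g_def by measurable
    have [measurable]: "ball z \<rho> \<in> sets borel" "ball z \<epsilon>' \<in> sets borel" "ball z \<epsilon> \<in> sets borel" by auto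
    have g0: "0 < h x \<and> h x < H" if "g x \<noteq> 0" for x
    proof -
      have "f (h x / LR) \<noteq> 0" using that by (auto simp: g_def)
      then have "0 < h x / LR" "h x / LR < H / LR"
        by (auto simp: f_def \<eta>_def split: split_indicator_asm)
      then show ?thesis using LR by (auto simp: zero_less_divide_iff divide_less_cancel)
    qed
    have gle: "g x \<le> hardy_density \<Omega> w R x" if x: "x \<in> ball z \<rho>" for x
    proof (cases "g x = 0")
      case False
      note hx = g0[OF False]
      have d: "dist z x < \<rho>" using x by simp
      note near = chart_height_near[OF c d \<rho>1]
      have xO: "x \<in> \<Omega>" and b1: "h x \<le> L * bdist \<Omega> x" and b2: "bdist \<Omega> x \<le> h x"
        using near hx by auto
      have b: "0 < bdist \<Omega> x" "bdist \<Omega> x < R" using bdist_pos[OF o bd xO] R xO by auto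
      have t: "0 < h x / LR" "h x / LR \<le> bdist \<Omega> x / R" "bdist \<Omega> x / R < 1"
        using hx LR R b b1 L by (auto simp: field_simps LR_def)
      then have w1: "0 < w (h x / LR)" "w (h x / LR) \<le> w (bdist \<Omega> x / R)"
        using w unfolding weight_def by (auto intro: le_less_trans)
      have "g x \<le> ennreal (1 / LR) * ennreal (w (h x / LR) / (h x / LR))"
        unfolding g_def f_def weight_density_def by (intro mult_left_mono) (auto simp: indicator_def)
      also have "\<dots> = ennreal (1 / LR * (w (h x / LR) / (h x / LR)))"
        by (intro ennreal_mult[symmetric] divide_nonneg_nonneg less_imp_le[OF w1(1)] less_imp_le[OF t(1)] less_imp_le[OF LR] zero_le_one)
      also have "1 / LR * (w (h x / LR) / (h x / LR)) = w (h x / LR) / h x"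
        using LR R L by simp
      also have "ennreal (w (h x / LR) / h x) \<le> ennreal (w (bdist \<Omega> x / R) / bdist \<Omega> x)"
        using w1 b b2 by (intro ennreal_leI frac_le) auto
      also have "\<dots> = hardy_density \<Omega> w R x" using xO by (simp add: hardy_density_def)
      finally show ?thesis .
    qed simp
    define X where "X = (\<integral>\<^sup>+x\<in>ball z \<epsilon>. hardy_density \<Omega> w R x \<partial>lborel)"
    have "ennreal V * (\<integral>\<^sup>+t. f t \<partial>lborel) = (\<integral>\<^sup>+y. (\<integral>\<^sup>+t. f t \<partial>lborel) * indicator (ball z \<epsilon>') y \<partial>lborel)"
      by (subst nn_integral_cmult_indicator) (auto simp: V mult.commute)
    also have "\<dots> = (\<integral>\<^sup>+y. (\<integral>\<^sup>+s. g (y + s *\<^sub>R e) \<partial>lborel) * indicator (ball z \<epsilon>') y \<partial>lborel)"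
      unfolding g_def tr by (subst nn_integral_line_rescale[OF _ LR]) auto
    also have "\<dots> \<le> (\<integral>\<^sup>+y. (\<integral>\<^sup>+s\<in>{-\<rho>..\<rho>}. g (y + s *\<^sub>R e) * indicator (ball z \<rho>) (y + s *\<^sub>R e) \<partial>lborel) \<partial>lborel)"
    proof (rule nn_integral_mono)
      fix y
      show "(\<integral>\<^sup>+s. g (y + s *\<^sub>R e) \<partial>lborel) * indicator (ball z \<epsilon>') y
          \<le> (\<integral>\<^sup>+s\<in>{-\<rho>..\<rho>}. g (y + s *\<^sub>R e) * indicator (ball z \<rho>) (y + s *\<^sub>R e) \<partial>lborel)"
      proof (cases "y \<in> ball z \<epsilon>'")
        case True
        have "\<bar>h y - h z\<bar> \<le> L * dist y z" by (rule lip)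
        also have "\<dots> \<le> L * \<epsilon>'" using True L by (intro mult_left_mono) (auto simp: dist_commute)
        finally have hy: "\<bar>h y\<bar> \<le> L * \<epsilon>'" using chartD(7)[OF c] by simp
        have "g (y + s *\<^sub>R e) \<le> g (y + s *\<^sub>R e) * indicator (ball z \<rho>) (y + s *\<^sub>R e) * indicator {-\<rho>..\<rho>} s" for s
        proof (cases "g (y + s *\<^sub>R e) = 0")
          case False
          have s: "\<bar>s\<bar> \<le> H + L * \<epsilon>'" using g0[OF False] hy by (auto simp: tr)
          have E: "\<epsilon>' + L * \<epsilon>' = \<rho> / 4" using \<epsilon>'(2) by (simp add: distrib_right)
          have "dist z (y + s *\<^sub>R e) \<le> dist z y + dist y (y + s *\<^sub>R e)" by (rule dist_triangle)
          also have "dist y (y + s *\<^sub>R e) = \<bar>s\<bar>" using e by (simp add: dist_norm)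
          finally have "dist z (y + s *\<^sub>R e) < \<rho>" using True s E H \<rho> by simp
          moreover have "s \<in> {-\<rho>..\<rho>}" using s E H \<rho> \<epsilon>'(1) by auto
          ultimately show ?thesis by simp
        qed simp
        then show ?thesis using True by (auto intro!: nn_integral_mono)
      qed simp
    qed
    also have "\<dots> = (\<integral>\<^sup>+s. (\<integral>\<^sup>+y. g (y + s *\<^sub>R e) * indicator (ball z \<rho>) (y + s *\<^sub>R e) * indicator {-\<rho>..\<rho>} s \<partial>lborel) \<partial>lborel)"
      by (rule lborel_pair.Fubini'[symmetric]) measurable
    also have "\<dots> = (\<integral>\<^sup>+s. (\<integral>\<^sup>+x\<in>ball z \<rho>. g x \<partial>lborel) * indicator {-\<rho>..\<rho>} s \<partial>lborel)"
    proof (rule nn_integral_cong)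
      fix s :: real
      have "(\<integral>\<^sup>+y. g (y + s *\<^sub>R e) * indicator (ball z \<rho>) (y + s *\<^sub>R e) \<partial>lborel) = (\<integral>\<^sup>+x\<in>ball z \<rho>. g x \<partial>lborel)"
        by (rule nn_integral_lborel_translate) measurable
      then show "(\<integral>\<^sup>+y. g (y + s *\<^sub>R e) * indicator (ball z \<rho>) (y + s *\<^sub>R e) * indicator {-\<rho>..\<rho>} s \<partial>lborel)
          = (\<integral>\<^sup>+x\<in>ball z \<rho>. g x \<partial>lborel) * indicator {-\<rho>..\<rho>} s"
        by (subst nn_integral_multc) auto
    qed
    also have "\<dots> = ennreal (2 * \<rho>) * (\<integral>\<^sup>+x\<in>ball z \<rho>. g x \<partial>lborel)"
      using \<rho> by (subst nn_integral_cmult_indicator) (auto simp: mult.commute)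
    also have "\<dots> \<le> ennreal (2 * \<rho>) * X"
      unfolding X_def using gle \<rho>(2) by (intro mult_left_mono nn_integral_mono) (auto simp: indicator_def)
    finally have "ennreal (1 / (2 * \<rho>)) * (ennreal V * (\<integral>\<^sup>+t. f t \<partial>lborel)) \<le> ennreal (1 / (2 * \<rho>)) * (ennreal (2 * \<rho>) * X)"
      by (rule mult_left_mono) simp
    also have "\<dots> = X" using \<rho> by (simp add: mult.assoc[symmetric] ennreal_mult[symmetric])
    finally show "ennreal (V / (2 * \<rho>)) * (\<integral>\<^sup>+t\<in>{0<..<\<eta>}. weight_density w t \<partial>lborel)
       \<le> (\<integral>\<^sup>+x\<in>ball z \<epsilon>. hardy_density \<Omega> w R x \<partial>lborel)"
      using \<rho> V by (simp add: X_def f_def mult.assoc[symmetric] ennreal_mult[symmetric])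
  qed
qed

section \<open>From Lebesgue integrals over \<Omega> to Borel functions on the whole space\<close>

lemma hardy_integral_eq:
  assumes "open \<Omega>"
  shows "hardy_integral \<Omega> R \<beta> m u
    = (\<integral>\<^sup>+x. ennreal \<bar>u x - average \<Omega> u\<bar> * hardy_density \<Omega> (log_weight \<beta> m) R x \<partial>lborel)"
proof -
  have "\<Omega> \<in> sets lebesgue" using assms by simp
  then have "hardy_integral \<Omega> R \<beta> m u
    = (\<integral>\<^sup>+x. ennreal (\<bar>u x - average \<Omega> u\<bar> / bdist \<Omega> x *
        (\<Prod>i\<in>{1..<m}. Lm i (bdist \<Omega> x / R)) * Lm m (bdist \<Omega> x / R) powr \<beta>) * indicator \<Omega> x \<partial>lebesgue)"
    unfolding hardy_integral_def by (subst nn_integral_restrict_space) auto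
  \<comment> \<open>Nonnegative integrals over a measure and over its completion agree for every
    integrand, so \<open>u\<close> may be merely Lebesgue measurable.\<close>
  also have "\<dots> = (\<integral>\<^sup>+x. ennreal (\<bar>u x - average \<Omega> u\<bar> / bdist \<Omega> x *
        (\<Prod>i\<in>{1..<m}. Lm i (bdist \<Omega> x / R)) * Lm m (bdist \<Omega> x / R) powr \<beta>) * indicator \<Omega> x \<partial>lborel)"
    by (rule nn_integral_completion)
  also have "\<dots> = (\<integral>\<^sup>+x. ennreal \<bar>u x - average \<Omega> u\<bar> * hardy_density \<Omega> (log_weight \<beta> m) R x \<partial>lborel)"
    by (intro nn_integral_cong)
      (simp add: hardy_density_def log_weight_def ennreal_mult'[symmetric] mult.assoc[symmetric] times_divide_eq_right)
  finally show ?thesis .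
qed

lemma test_fields_divergence_measurable:
  assumes "\<phi> \<in> test_fields \<Omega>"
  shows "divergence \<phi> \<in> borel_measurable borel"
proof -
  have "continuous_on UNIV (divergence \<phi>)"
    unfolding divergence_def[abs_def] using assms
    by (intro continuous_on_sum continuous_on_inner continuous_on_const) (auto simp: test_fields_def)
  then show ?thesis by (simp add: borel_measurable_continuous_onI)
qed

lemma zero_in_test_fields: "(\<lambda>x. 0) \<in> test_fields \<Omega>"
proof -
  have "frechet_derivative (\<lambda>x. 0::'a) (at x) = (\<lambda>h. 0)" for x :: 'a
    by (rule frechet_derivative_at[symmetric]) simp
  then show ?thesis by (simp add: test_fields_def)
qed

text \<open>Translations and Fubini are carried out for Borel functions, so the extension of
  \<open>u\<close> by zero is replaced by a Borel function equal to it almost everywhere, which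
  changes no integral against a test field. Membership in BV makes the seminorm finite, so
  \<open>B\<close> can be a real number.\<close>

lemma BV_borel_representative:
  fixes u :: "'a::euclidean_space \<Rightarrow> real"
  assumes o: "open \<Omega>" and u: "u \<in> BV \<Omega>"
  obtains v B where "var_bound \<Omega> v B" "bv_seminorm \<Omega> u = ennreal B" "AE x in lborel. indicator \<Omega> x * u x = v x"
proof -
  have [measurable]: "\<Omega> \<in> sets lebesgue" using o by simp
  have iu: "integrable lebesgue (\<lambda>x. indicator \<Omega> x * u x)"
    using u integrable_restrict_space[of \<Omega> lebesgue u] by (simp add: BV_def)
  then have mu: "(\<lambda>x. indicator \<Omega> x * u x) \<in> borel_measurable lebesgue" by (rule borel_measurable_integrable)
  obtain v where vm: "v \<in> borel_measurable lborel" and ae: "AE x in lborel. indicator \<Omega> x * u x = v x"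
    using completion_ex_borel_measurable_real[OF mu] by blast
  have ae': "AE x in lebesgue. indicator \<Omega> x * u x = v x" using ae by (rule AE_completion)
  have vm': "v \<in> borel_measurable lebesgue" using vm by (rule measurable_completion)
  have "integrable lebesgue v" using integrable_cong_AE[OF mu vm' ae'] iu by simp
  then have vi: "integrable lborel v" using integrable_completion[OF vm] by simp
  define S where "S = (SUP \<phi>\<in>test_fields \<Omega>. ereal (\<integral>x. u x * divergence \<phi> x \<partial>lebesgue_on \<Omega>))"
  have bv: "bv_seminorm \<Omega> u = e2ennreal S" by (simp add: bv_seminorm_def S_def)
  have eq: "(\<integral>x. u x * divergence \<phi> x \<partial>lebesgue_on \<Omega>) = (\<integral>x. v x * divergence \<phi> x \<partial>lborel)" if \<phi>: "\<phi> \<in> test_fields \<Omega>" for \<phi>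
  proof -
    note dm = test_fields_divergence_measurable[OF \<phi>]
    have dm': "divergence \<phi> \<in> borel_measurable lebesgue" using dm by (intro measurable_completion) simp
    have "(\<integral>x. u x * divergence \<phi> x \<partial>lebesgue_on \<Omega>) = (\<integral>x. (indicator \<Omega> x * u x) * divergence \<phi> x \<partial>lebesgue)"
      by (subst integral_restrict_space) (auto simp: mult.assoc)
    also have "\<dots> = (\<integral>x. v x * divergence \<phi> x \<partial>lebesgue)"
    proof (rule integral_cong_AE)
      show "(\<lambda>x. (indicator \<Omega> x * u x) * divergence \<phi> x) \<in> borel_measurable lebesgue" using mu dm' by (rule borel_measurable_times)
      show "(\<lambda>x. v x * divergence \<phi> x) \<in> borel_measurable lebesgue" using vm' dm' by (rule borel_measurable_times)
      show "AE x in lebesgue. (indicator \<Omega> x * u x) * divergence \<phi> x = v x * divergence \<phi> x"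
        using ae' by eventually_elim simp
    qed
    also have "\<dots> = (\<integral>x. v x * divergence \<phi> x \<partial>lborel)"
      using vm dm by (intro integral_completion) auto
    finally show ?thesis .
  qed
  have S0: "0 \<le> S"
  proof -
    have "divergence (\<lambda>x. 0) x = 0" for x :: 'a
    proof -
      have "frechet_derivative (\<lambda>x. 0::'a) (at x) = (\<lambda>h. 0)" by (rule frechet_derivative_at[symmetric]) simp
      then show ?thesis by (simp add: divergence_def)
    qed
    then have "ereal 0 = ereal (\<integral>x. u x * divergence (\<lambda>x. 0) x \<partial>lebesgue_on \<Omega>)" by simp
    also have "\<dots> \<le> S" unfolding S_def by (rule SUP_upper[OF zero_in_test_fields])
    finally show ?thesis by (simp add: zero_ereal_def)
  qed
  define B where "B = enn2real (e2ennreal S)"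
  have "e2ennreal S < \<infinity>" using u bv by (simp add: BV_def)
  then have B: "ennreal B = e2ennreal S" by (simp add: B_def less_top)
  then have "S = ereal B" using S0
    by (metis B_def enn2ereal_e2ennreal enn2ereal_ennreal enn2real_nonneg)
  then have "(\<integral>x. v x * divergence \<phi> x \<partial>lborel) \<le> B" if "\<phi> \<in> test_fields \<Omega>" for \<phi>
    using SUP_upper[OF that, of "\<lambda>\<phi>. ereal (\<integral>x. u x * divergence \<phi> x \<partial>lebesgue_on \<Omega>)"] eq[OF that]
    by (simp add: S_def[symmetric])
  then have "var_bound \<Omega> v B" using vi by (simp add: var_bound_def B_def)
  then show ?thesis using that bv B ae by simp
qed


section \<open>Linear functions have bounded variation\<close>

lemma C1_grad_eq_0_off_support:
  assumes "C1_grad f g" "x \<notin> closure {x. f x \<noteq> 0}"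
  shows "g x = 0"
proof -
  have "(f has_derivative (\<lambda>h. 0)) (at x)"
  proof (rule has_derivative_transform_within_open)
    show "((\<lambda>x. 0) has_derivative (\<lambda>h. 0)) (at x)" by simp
    show "open (- closure {x. f x \<noteq> 0})" by (rule open_Compl[OF closed_closure])
    show "x \<in> - closure {x. f x \<noteq> 0}" using assms(2) by simp
    show "0 = f y" if "y \<in> - closure {x. f x \<noteq> 0}" for y
      using that closure_subset[of "{x. f x \<noteq> 0}"] by auto
  qed
  moreover have "(f has_derivative (\<lambda>h. g x \<bullet> h)) (at x)" using assms(1) by (simp add: C1_grad_def)
  ultimately have "(\<lambda>h. g x \<bullet> h) = (\<lambda>h. 0)" by (rule has_derivative_unique[rotated])
  then have "g x \<bullet> g x = 0" by (rule fun_cong)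
  then show ?thesis by simp
qed

lemma integrable_continuous_compact_support:
  fixes f :: "'a::euclidean_space \<Rightarrow> real"
  assumes "continuous_on UNIV f" "compact K" "\<And>x. x \<notin> K \<Longrightarrow> f x = 0"
  shows "integrable lborel f"
proof -
  have "integrable lborel (\<lambda>x. indicator K x *\<^sub>R f x)"
    using assms by (intro borel_integrable_compact) (auto intro: continuous_on_subset)
  moreover have "(\<lambda>x. indicator K x *\<^sub>R f x) = f" using assms(3) by (auto simp: indicator_def fun_eq_iff)
  ultimately show ?thesis by simp
qed

text \<open>Integration by parts against a linear function: since translating a linear function adds a
  constant, the identity is exact for difference quotients.\<close>
lemma integral_linear_times_gradient:
  fixes f :: "'a::euclidean_space \<Rightarrow> real"
  assumes f: "C1_grad f g" and K: "compact (closure {x. f x \<noteq> 0})"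
  shows "(\<integral>x. (b \<bullet> x) * (g x \<bullet> e) \<partial>lborel) = - (b \<bullet> e) * (\<integral>x. f x \<partial>lborel)"
proof -
  define K where "K = closure {x. f x \<noteq> 0}"
  have Kc: "compact K" using K by (simp add: K_def)
  have f0: "f x = 0" if "x \<notin> K" for x using that closure_subset[of "{x. f x \<noteq> 0}"] by (auto simp: K_def)
  have g0: "g x = 0" if "x \<notin> K" for x using C1_grad_eq_0_off_support[OF f] that by (simp add: K_def)
  have cg: "continuous_on UNIV g" and cf: "continuous_on UNIV f"
    using f C1_grad_continuous by (auto simp: C1_grad_def)
  have [measurable]: "f \<in> borel_measurable borel" "g \<in> borel_measurable borel"
    using cf cg by (simp_all add: borel_measurable_continuous_onI)
  obtain M where M: "M \<ge> 0" "\<And>x. norm (g x) \<le> M"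
  proof -
    have "bounded (g ` K)"
      using Kc cg by (intro compact_imp_bounded compact_continuous_image) (auto intro: continuous_on_subset)
    then obtain M where "\<And>x. x \<in> K \<Longrightarrow> norm (g x) \<le> M" unfolding bounded_iff by auto
    then have "norm (g x) \<le> max 0 M" for x using g0[of x] by (cases "x \<in> K") (auto simp: le_max_iff_disj)
    then show ?thesis using that[of "max 0 M"] by auto
  qed
  obtain D0 where D0: "\<And>x. x \<in> K \<Longrightarrow> norm x \<le> D0"
    using compact_imp_bounded[OF Kc] unfolding bounded_iff by auto
  \<comment> \<open>Enlarged by norm e so that all difference quotients with steps t n <= 1 vanish
    outside one ball, which yields an integrable majorant.\<close>
  define D where "D = max 0 D0 + norm e"
  have D0': "D \<ge> 0" by (simp add: D_def)
  have D: "norm x \<le> D" if "x \<in> K" for x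
    using D0[OF that] norm_ge_zero[of e] unfolding D_def by linarith
  define t where "t = (\<lambda>n. 1 / real (Suc n))"
  have t: "0 < t n" "t n \<le> 1" for n by (auto simp: t_def)
  define s where "s = (\<lambda>n x. (b \<bullet> x) * ((f (x + t n *\<^sub>R e) - f x) / t n))"
  have lip: "\<bar>f x - f y\<bar> \<le> M * norm (x - y)" for x y
  proof -
    have "norm (f x - f y) \<le> M * norm (x - y)"
    proof (rule differentiable_bound[OF convex_UNIV])
      fix x show "(f has_derivative (\<lambda>h. g x \<bullet> h)) (at x within UNIV)" using f by (simp add: C1_grad_def)
      show "onorm (\<lambda>h. g x \<bullet> h) \<le> M"
      proof (rule onorm_le)
        fix h show "norm (g x \<bullet> h) \<le> M * norm h"
          using Cauchy_Schwarz_ineq2[of "g x" h] mult_right_mono[OF M(2)[of x] norm_ge_zero[of h]] by simp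
      qed
    qed auto
    then show ?thesis by simp
  qed
  have s_bound: "norm (s n x) \<le> norm b * D * (M * norm e) * indicator (cball 0 D) x" for n x
  proof (cases "norm x \<le> D")
    case True
    have "\<bar>b \<bullet> x\<bar> \<le> norm b * D" using Cauchy_Schwarz_ineq2[of b x] mult_left_mono[OF True norm_ge_zero[of b]] by simp
    moreover have "\<bar>(f (x + t n *\<^sub>R e) - f x) / t n\<bar> \<le> M * norm e"
      using lip[of "x + t n *\<^sub>R e" x] t(1)[of n] by (simp add: pos_divide_le_eq mult_ac)
    ultimately have "\<bar>b \<bullet> x\<bar> * \<bar>(f (x + t n *\<^sub>R e) - f x) / t n\<bar> \<le> norm b * D * (M * norm e)"
      using D0' M by (intro mult_mono) auto
    then show ?thesis using True by (simp add: s_def abs_mult)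
  next
    case False
    then have "x \<notin> K" using D by blast
    moreover have "x + t n *\<^sub>R e \<notin> K"
    proof
      assume "x + t n *\<^sub>R e \<in> K"
      then have "norm (x + t n *\<^sub>R e) \<le> D0" by (rule D0)
      moreover have "norm x \<le> norm (x + t n *\<^sub>R e) + norm (t n *\<^sub>R e)" using norm_triangle_ineq4[of "x + t n *\<^sub>R e" "t n *\<^sub>R e"] by simp
      moreover have "norm (t n *\<^sub>R e) \<le> norm e" using t[of n] by (simp add: mult_left_le_one_le)
      ultimately show False using False by (simp add: D_def)
    qed
    ultimately show ?thesis using D0' M by (simp add: s_def f0)
  qed
  have "(\<lambda>n. \<integral>x. s n x \<partial>lborel) \<longlonglongrightarrow> (\<integral>x. (b \<bullet> x) * (g x \<bullet> e) \<partial>lborel)"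
  proof (rule integral_dominated_convergence)
    show "integrable lborel (\<lambda>x. norm b * D * (M * norm e) * indicator (cball (0::'a) D) x)"
      using emeasure_lborel_cball_finite[of "0::'a" D] by (intro integrable_mult_right) (simp add: integrable_real_indicator)
    show "AE x in lborel. (\<lambda>n. s n x) \<longlonglongrightarrow> (b \<bullet> x) * (g x \<bullet> e)"
    proof (rule always_eventually, rule allI)
      fix x
      have *: "((\<lambda>\<tau>. f (x + \<tau> *\<^sub>R e)) has_derivative (\<lambda>k. g (x + 0 *\<^sub>R e) \<bullet> (k *\<^sub>R e))) (at 0)"
        by (rule has_derivative_compose[where f' = "\<lambda>k. k *\<^sub>R e"])
          (use f in \<open>auto intro!: derivative_eq_intros simp: C1_grad_def\<close>)
      have "((\<lambda>\<tau>. f (x + \<tau> *\<^sub>R e)) has_real_derivative g x \<bullet> e) (at 0)"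
      proof -
        have "(\<lambda>k. g x \<bullet> (k *\<^sub>R e)) = (*) (g x \<bullet> e)" by (simp add: fun_eq_iff mult.commute)
        then show ?thesis using * unfolding has_field_derivative_def by simp
      qed
      then have lim: "((\<lambda>\<tau>. (f (x + \<tau> *\<^sub>R e) - f x) / \<tau>) \<longlongrightarrow> g x \<bullet> e) (at 0)"
        by (simp add: DERIV_def)
      have "t \<longlonglongrightarrow> 0" unfolding t_def using LIMSEQ_inverse_real_of_nat by (simp add: inverse_eq_divide)
      moreover have "t n \<noteq> 0" for n using t(1)[of n] by simp
      ultimately have "filterlim t (at 0) sequentially" by (simp add: filterlim_at)
      from filterlim_compose[OF lim this] show "(\<lambda>n. s n x) \<longlonglongrightarrow> (b \<bullet> x) * (g x \<bullet> e)"
        unfolding s_def by (intro tendsto_intros)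
    qed
    show "AE x in lborel. norm (s n x) \<le> norm b * D * (M * norm e) * indicator (cball 0 D) x" for n
      using s_bound by simp
  qed (simp_all add: s_def)
  moreover have "(\<integral>x. s n x \<partial>lborel) = - (b \<bullet> e) * (\<integral>x. f x \<partial>lborel)" for n
  proof -
    have fi: "integrable lborel f" by (rule integrable_continuous_compact_support[OF cf Kc f0])
    have bi: "integrable lborel (\<lambda>x. (b \<bullet> x) * f x)"
      by (rule integrable_continuous_compact_support[OF _ Kc]) (auto intro!: continuous_intros cf simp: f0)
    \<comment> \<open>Substituting x - t e for x turns the factor b \<bullet> x into b \<bullet> x -
      t (b \<bullet> e); the correction, divided by t, is the right-hand side for every n, before
      any limit.\<close>
    have sh: "(\<integral>x. (b \<bullet> x) * f (x + t n *\<^sub>R e) \<partial>lborel) = (\<integral>x. (b \<bullet> x) * f x - t n * (b \<bullet> e) * f x \<partial>lborel)"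
      and shi: "integrable lborel (\<lambda>x. (b \<bullet> x) * f (x + t n *\<^sub>R e))"
    proof -
      have eq: "(\<lambda>x. (b \<bullet> (x + t n *\<^sub>R e)) * f (x + t n *\<^sub>R e) - t n * (b \<bullet> e) * f (x + t n *\<^sub>R e)) = (\<lambda>x. (b \<bullet> x) * f (x + t n *\<^sub>R e))"
        by (simp add: inner_add_right algebra_simps)
      have m: "(\<lambda>x. (b \<bullet> x) * f x - t n * (b \<bullet> e) * f x) \<in> borel_measurable borel" by measurable
      show "(\<integral>x. (b \<bullet> x) * f (x + t n *\<^sub>R e) \<partial>lborel) = (\<integral>x. (b \<bullet> x) * f x - t n * (b \<bullet> e) * f x \<partial>lborel)"
        using integral_lborel_translate[OF m, of "t n *\<^sub>R e"] unfolding eq .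
      show "integrable lborel (\<lambda>x. (b \<bullet> x) * f (x + t n *\<^sub>R e))"
        using integrable_lborel_translate[OF m, of "t n *\<^sub>R e"] bi fi unfolding eq by simp
    qed
    have "(\<integral>x. s n x \<partial>lborel) = (\<integral>x. ((b \<bullet> x) * f (x + t n *\<^sub>R e) - (b \<bullet> x) * f x) / t n \<partial>lborel)"
      by (simp add: s_def right_diff_distrib)
    also have "\<dots> = ((\<integral>x. (b \<bullet> x) * f (x + t n *\<^sub>R e) \<partial>lborel) - (\<integral>x. (b \<bullet> x) * f x \<partial>lborel)) / t n"
      using shi bi by simp
    also have "\<dots> = - (b \<bullet> e) * (\<integral>x. f x \<partial>lborel)"
      unfolding sh using bi fi t(1)[of n] by simp
    finally show ?thesis .
  qed
  ultimately show ?thesis by (simp add: LIMSEQ_const_iff)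
qed

text \<open>Integration by parts in each coordinate turns the integral against the divergence into
  minus the integral of b \<bullet> \<phi>, which is at most norm b times the volume of \<Omega>
  because |\<phi>| <= 1.\<close>

lemma linear_function_in_BV:
  fixes b :: "'a::euclidean_space"
  assumes o: "open \<Omega>" and bd: "bounded \<Omega>"
  shows "(\<lambda>x. b \<bullet> x) \<in> BV \<Omega>"
proof -
  have \<Omega>l: "\<Omega> \<in> sets lebesgue" and \<Omega>b[measurable]: "\<Omega> \<in> sets borel" using o by auto
  define V where "V = measure lborel \<Omega>"
  have ifin: "integrable lborel (indicator \<Omega> :: 'a \<Rightarrow> real)"
    using emeasure_bounded_finite[OF bd] by (simp add: integrable_real_indicator)
  have "integrable lborel (\<lambda>x. indicator (closure \<Omega>) x *\<^sub>R (b \<bullet> x))"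
    using bd by (intro borel_integrable_compact continuous_intros) (simp add: compact_closure)
  then have "integrable lborel (\<lambda>x. indicator \<Omega> x *\<^sub>R (b \<bullet> x))"
    by (rule Bochner_Integration.integrable_bound) (use closure_subset[of \<Omega>] in \<open>auto simp: indicator_def\<close>)
  then have "integrable lebesgue (\<lambda>x. indicator \<Omega> x *\<^sub>R (b \<bullet> x))" by (subst integrable_completion) auto
  then have int: "integrable (lebesgue_on \<Omega>) (\<lambda>x. b \<bullet> x)"
    using \<Omega>l by (subst integrable_restrict_space) auto
  have bound: "(\<integral>x. (b \<bullet> x) * divergence \<phi> x \<partial>lebesgue_on \<Omega>) \<le> norm b * V" if \<phi>: "\<phi> \<in> test_fields \<Omega>" for \<phi>
  proof -
    define d where "d = (\<lambda>x. frechet_derivative \<phi> (at x))"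
    \<comment> \<open>The gradient of the component of \<phi> along i, that is, the transpose of the
      derivative applied to i.\<close>
    define g where "g = (\<lambda>i x. \<Sum>k\<in>Basis. (d x k \<bullet> i) *\<^sub>R k)"
    define K where "K = closure {x. \<phi> x \<noteq> 0}"
    have K: "compact K" "K \<subseteq> \<Omega>" using \<phi> by (auto simp: test_fields_def K_def)
    have \<phi>0: "\<phi> x = 0" if "x \<notin> K" for x using that closure_subset[of "{x. \<phi> x \<noteq> 0}"] by (auto simp: K_def)
    have der: "(\<phi> has_derivative d x) (at x)" for x
      using \<phi> frechet_derivative_works[of \<phi> "at x"] by (auto simp: test_fields_def d_def differentiable_on_def)
    have cd: "continuous_on UNIV (\<lambda>x. d x k)" if "k \<in> Basis" for k using \<phi> that by (auto simp: test_fields_def d_def)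
    have C: "C1_grad (\<lambda>x. \<phi> x \<bullet> i) (g i)" for i
      unfolding C1_grad_def
    proof (intro conjI allI)
      fix x
      have lin: "linear (d x)" using der has_derivative_linear by blast
      have "d x h \<bullet> i = g i x \<bullet> h" for h
      proof -
        have "d x h = d x (\<Sum>k\<in>Basis. (h \<bullet> k) *\<^sub>R k)" by (simp add: euclidean_representation)
        also have "\<dots> = (\<Sum>k\<in>Basis. (h \<bullet> k) *\<^sub>R d x k)" using lin by (simp add: linear_sum linear_scale)
        finally show ?thesis by (simp add: g_def inner_sum_left inner_commute[of h] mult.commute)
      qed
      moreover have "((\<lambda>x. \<phi> x \<bullet> i) has_derivative (\<lambda>h. d x h \<bullet> i)) (at x)" by (intro has_derivative_inner_left der)
      ultimately show "((\<lambda>x. \<phi> x \<bullet> i) has_derivative (\<lambda>h. g i x \<bullet> h)) (at x)" by simp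
      show "continuous_on UNIV (g i)" unfolding g_def by (intro continuous_intros cd)
    qed
    have sub: "closure {x. \<phi> x \<bullet> i \<noteq> 0} \<subseteq> K" for i unfolding K_def by (intro closure_mono) auto
    have g0: "g i x = 0" if "x \<notin> K" for i x using C1_grad_eq_0_off_support[OF C] sub that by blast
    have Kc: "compact (closure {x. \<phi> x \<bullet> i \<noteq> 0})" for i
      using sub[of i] K(1) by (metis closed_closure compact_Int_closed inf.absorb_iff2)
    have div: "divergence \<phi> x = (\<Sum>i\<in>Basis. g i x \<bullet> i)" for x
      unfolding divergence_def
      by (intro sum.cong) (auto simp: g_def d_def inner_sum_left inner_Basis if_distrib[of "(*) _"] sum.delta cong: if_cong)
    have cg: "continuous_on UNIV (g i)" for i using C by (simp add: C1_grad_def)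
    have c\<phi>: "continuous_on UNIV (\<lambda>x. \<phi> x \<bullet> i)" for i using C1_grad_continuous[OF C] .
    have "(\<integral>x. (b \<bullet> x) * divergence \<phi> x \<partial>lebesgue_on \<Omega>) = (\<integral>x. indicator \<Omega> x *\<^sub>R ((b \<bullet> x) * divergence \<phi> x) \<partial>lebesgue)"
      using \<Omega>l by (subst integral_restrict_space) auto
    also have "(\<lambda>x. indicator \<Omega> x *\<^sub>R ((b \<bullet> x) * divergence \<phi> x)) = (\<lambda>x. (b \<bullet> x) * divergence \<phi> x)"
      using K(2) g0 by (auto simp: fun_eq_iff div indicator_def subset_eq)
    also have "(\<integral>x. (b \<bullet> x) * divergence \<phi> x \<partial>lebesgue) = (\<integral>x. (b \<bullet> x) * divergence \<phi> x \<partial>lborel)"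
      using test_fields_divergence_measurable[OF \<phi>] by (intro integral_completion) auto
    also have "\<dots> = (\<integral>x. (\<Sum>i\<in>Basis. (b \<bullet> x) * (g i x \<bullet> i)) \<partial>lborel)" by (simp add: div sum_distrib_left)
    also have "\<dots> = (\<Sum>i\<in>Basis. \<integral>x. (b \<bullet> x) * (g i x \<bullet> i) \<partial>lborel)"
      by (intro Bochner_Integration.integral_sum integrable_continuous_compact_support[OF _ K(1)] continuous_intros cg)
        (simp add: g0)
    also have "\<dots> = (\<Sum>i\<in>Basis. \<integral>x. - (b \<bullet> i) * (\<phi> x \<bullet> i) \<partial>lborel)"
      using integral_linear_times_gradient[OF C Kc, of b] by simp
    also have "\<dots> = (\<integral>x. (\<Sum>i\<in>Basis. - (b \<bullet> i) * (\<phi> x \<bullet> i)) \<partial>lborel)"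
      by (intro Bochner_Integration.integral_sum[symmetric] integrable_continuous_compact_support[OF _ K(1)] continuous_intros c\<phi>)
        (simp add: \<phi>0)
    also have "\<dots> \<le> (\<integral>x. norm b * indicator \<Omega> x \<partial>lborel)"
    proof (rule integral_mono)
      show "integrable lborel (\<lambda>x. \<Sum>i\<in>Basis. - (b \<bullet> i) * (\<phi> x \<bullet> i))"
        by (intro integrable_continuous_compact_support[OF _ K(1)] continuous_intros c\<phi>) (simp add: \<phi>0)
      show "integrable lborel (\<lambda>x. norm b * indicator \<Omega> x)" using ifin by simp
      fix x
      have "(\<Sum>i\<in>Basis. - (b \<bullet> i) * (\<phi> x \<bullet> i)) = - (b \<bullet> \<phi> x)"
        by (simp add: euclidean_inner[of b "\<phi> x"] sum_negf)
      also have "\<dots> \<le> norm b * norm (\<phi> x)" using Cauchy_Schwarz_ineq2[of b "\<phi> x"] by linarith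
      also have "\<dots> \<le> norm b * indicator \<Omega> x"
        using \<phi> \<phi>0[of x] K(2) by (intro mult_left_mono) (auto simp: test_fields_def indicator_def)
      finally show "(\<Sum>i\<in>Basis. - (b \<bullet> i) * (\<phi> x \<bullet> i)) \<le> norm b * indicator \<Omega> x" .
    qed
    also have "\<dots> = norm b * V" by (simp add: V_def)
    finally show ?thesis .
  qed
  have "bv_seminorm \<Omega> (\<lambda>x. b \<bullet> x) \<le> e2ennreal (ereal (norm b * V))"
    unfolding bv_seminorm_def using bound by (intro e2ennreal_mono SUP_least) auto
  also have "\<dots> < \<infinity>" by simp
  finally show ?thesis using int by (simp add: BV_def)
qed

section \<open>Assembly of the three claims\<close>

lemma hardy_integral_le:
  fixes \<Omega> :: "'a::euclidean_space set"
  assumes \<Omega>: "bounded_lipschitz_domain \<Omega>" and \<beta>: "\<beta> > 1"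
  obtains C where "C > 0"
    "\<And>R m u. R > 0 \<Longrightarrow> \<forall>x\<in>\<Omega>. bdist \<Omega> x < R \<Longrightarrow> m \<ge> 1 \<Longrightarrow> u \<in> BV \<Omega> \<Longrightarrow>
      hardy_integral \<Omega> R \<beta> m u \<le> ennreal C * bv_seminorm \<Omega> u"
proof (rule weighted_Hardy_Poincare[OF \<Omega>], goal_cases)
  case (1 C0)
  have o: "open \<Omega>" using \<Omega> by (simp add: bounded_lipschitz_domain_def)
  have \<Omega>l: "\<Omega> \<in> sets lebesgue" and \<Omega>b[measurable]: "\<Omega> \<in> sets borel" using o by auto
  define C where "C = C0 * (1 + 1 / (\<beta> - 1))"
  have A: "1 / (\<beta> - 1) > 0" using \<beta> by simp
  show ?case
  proof (rule 1(1))
    show C: "C > 0" using 1(2) A by (simp add: C_def add_pos_pos)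
    fix R m u
    assume R: "R > 0" "\<forall>x\<in>\<Omega>. bdist \<Omega> x < R" and m: "m \<ge> (1::nat)" and u: "u \<in> BV \<Omega>"
    obtain v B where v: "var_bound \<Omega> v B" "bv_seminorm \<Omega> u = ennreal B" and ae: "AE x in lborel. indicator \<Omega> x * u x = v x"
      using BV_borel_representative[OF o u] by blast
    note vm[measurable] = var_boundD(2)[OF v(1)]
    have avg: "average \<Omega> u = (\<integral>y. indicator \<Omega> y * v y \<partial>lborel) / measure lborel \<Omega>"
    proof -
      have iu: "integrable lebesgue (\<lambda>x. indicator \<Omega> x * u x)"
        using u \<Omega>l integrable_restrict_space[of \<Omega> lebesgue u] by (simp add: BV_def)
      have "(\<integral>y. u y \<partial>lebesgue_on \<Omega>) = (\<integral>x. indicator \<Omega> x * u x \<partial>lebesgue)"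
        using \<Omega>l by (subst integral_restrict_space) auto
      also have "\<dots> = (\<integral>x. indicator \<Omega> x * v x \<partial>lebesgue)"
      proof (rule integral_cong_AE)
        show "(\<lambda>x. indicator \<Omega> x * u x) \<in> borel_measurable lebesgue" using iu by (rule borel_measurable_integrable)
        show "(\<lambda>x. indicator \<Omega> x * v x) \<in> borel_measurable lebesgue" by (rule measurable_completion) measurable
        show "AE x in lebesgue. indicator \<Omega> x * u x = indicator \<Omega> x * v x"
          using AE_completion[OF ae] by eventually_elim (auto simp: indicator_def split: if_splits)
      qed
      also have "\<dots> = (\<integral>x. indicator \<Omega> x * v x \<partial>lborel)" by (intro integral_completion) measurable
      finally show ?thesis by (simp add: average_def)
    qed
    have "hardy_integral \<Omega> R \<beta> m u = (\<integral>\<^sup>+x. ennreal \<bar>v x - average \<Omega> u\<bar> * hardy_density \<Omega> (log_weight \<beta> m) R x \<partial>lborel)"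
      unfolding hardy_integral_eq[OF o]
    proof (rule nn_integral_cong_AE)
      show "AE x in lborel. ennreal \<bar>u x - average \<Omega> u\<bar> * hardy_density \<Omega> (log_weight \<beta> m) R x = ennreal \<bar>v x - average \<Omega> u\<bar> * hardy_density \<Omega> (log_weight \<beta> m) R x"
        using ae by eventually_elim (auto simp: hardy_density_def indicator_def)
    qed
    \<comment> \<open>The mass bound A = 1/(\<beta> - 1) holds for all m >= 1 at once, so the
      resulting constant is uniform in m.\<close>
    also have "\<dots> \<le> ennreal (C0 * (1 + 1 / (\<beta> - 1)) * B)"
      unfolding avg using \<beta> by (intro 1(3) weight_log_weight nn_integral_log_weight_le A R m v(1)) auto
    also have "\<dots> = ennreal C * bv_seminorm \<Omega> u"
      using C var_boundD(3)[OF v(1)] by (simp add: v(2) C_def[symmetric] ennreal_mult)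
    finally show "hardy_integral \<Omega> R \<beta> m u \<le> ennreal C * bv_seminorm \<Omega> u" .
  qed
qed

text \<open>From a point of the open set one can still move in direction c, so the maximum over the
  closure is attained only on the frontier.\<close>

lemma frontier_point_maximizing:
  fixes \<Omega> :: "'a::euclidean_space set"
  assumes "open \<Omega>" "bounded \<Omega>" "\<Omega> \<noteq> {}" "c \<noteq> 0"
  obtains z where "z \<in> frontier \<Omega>" "\<And>x. x \<in> \<Omega> \<Longrightarrow> c \<bullet> x < c \<bullet> z"
proof -
  have cl: "compact (closure \<Omega>)" "closure \<Omega> \<noteq> {}" using assms by (auto simp: compact_closure)
  have "continuous_on (closure \<Omega>) (\<lambda>x. c \<bullet> x)" by (intro continuous_intros)
  then obtain z where z: "z \<in> closure \<Omega>" "\<And>x. x \<in> closure \<Omega> \<Longrightarrow> c \<bullet> x \<le> c \<bullet> z"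
    using continuous_attains_sup[OF cl] by blast
  have less: "c \<bullet> x < c \<bullet> z" if "x \<in> \<Omega>" for x
  proof -
    obtain e where e: "e > 0" "cball x e \<subseteq> \<Omega>" using assms(1) \<open>x \<in> \<Omega>\<close> open_contains_cball by blast
    have "x + (e / norm c) *\<^sub>R c \<in> cball x e" using e assms(4) by (simp add: dist_norm)
    then have "c \<bullet> (x + (e / norm c) *\<^sub>R c) \<le> c \<bullet> z" using z(2) e(2) closure_subset[of \<Omega>] by blast
    moreover have "0 < (e / norm c) * (c \<bullet> c)" using e assms(4) by simp
    ultimately show ?thesis by (simp add: inner_add_right)
  qed
  then have "z \<in> frontier \<Omega>" using z(1) assms(1) by (auto simp: frontier_def interior_open)
  then show ?thesis using that less by blast
qed

text \<open>A linear function takes different values at two frontier points, so it stays away from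
  its average near one of them, where the lower bound for the Hardy density applies. If \<beta> <= 1
  the first term, m = 2, is already infinite; if \<beta> > 1 and \<alpha> >= 1 all terms are at
  least one fixed positive number.\<close>

lemma hardy_series_linear_eq_top:
  fixes \<Omega> :: "'a::euclidean_space set"
  assumes \<Omega>: "bounded_lipschitz_domain \<Omega>" and R: "R > 0" "\<forall>x\<in>\<Omega>. bdist \<Omega> x < R"
    and \<alpha>: "\<alpha> > 0" and \<beta>: "\<beta> > 0" and \<alpha>\<beta>: "\<alpha> \<ge> 1 \<or> \<beta> \<le> 1" and b: "norm b = 1"
  shows "hardy_series \<Omega> R \<beta> \<alpha> (\<lambda>x. b \<bullet> x) = \<infinity>"
proof -
  have o: "open \<Omega>" and ne: "\<Omega> \<noteq> {}" and bd: "bounded \<Omega>" and lb: "lipschitz_boundary \<Omega>"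
    using \<Omega> by (auto simp: bounded_lipschitz_domain_def)
  define a where "a = average \<Omega> (\<lambda>x. b \<bullet> x)"
  obtain z where z: "z \<in> frontier \<Omega>" "b \<bullet> z \<noteq> a"
  proof -
    obtain x0 where x0: "x0 \<in> \<Omega>" using ne by blast
    have "b \<noteq> 0" "- b \<noteq> 0" using b by auto
    then obtain z1 z2 where "z1 \<in> frontier \<Omega>" "b \<bullet> x0 < b \<bullet> z1" "z2 \<in> frontier \<Omega>" "- b \<bullet> x0 < - b \<bullet> z2"
      using frontier_point_maximizing[OF o bd ne] x0 by metis
    then show ?thesis using that[of z1] that[of z2] by fastforce
  qed
  \<comment> \<open>Half the gap: \<open>b\<close> has norm 1, so b \<bullet> x changes by less than
    \<epsilon> on the ball and stays at least \<epsilon> away from the average.\<close>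
  define \<epsilon> where "\<epsilon> = \<bar>b \<bullet> z - a\<bar> / 2"
  have \<epsilon>: "\<epsilon> > 0" using z by (simp add: \<epsilon>_def)
  have far: "\<epsilon> \<le> \<bar>b \<bullet> x - a\<bar>" if "x \<in> ball z \<epsilon>" for x
  proof -
    have "\<bar>b \<bullet> z - b \<bullet> x\<bar> \<le> dist z x" using Cauchy_Schwarz_ineq2[of b "z - x"] b by (simp add: inner_diff_right dist_norm)
    moreover have "\<bar>b \<bullet> z - a\<bar> \<le> \<bar>b \<bullet> z - b \<bullet> x\<bar> + \<bar>b \<bullet> x - a\<bar>" by linarith
    ultimately show ?thesis using that by (simp add: \<epsilon>_def)
  qed
  obtain r e h L where c: "chart \<Omega> z r e h L" using chart_exists[OF lb o z(1)] by blast
  obtain \<kappa> \<eta> where \<kappa>: "\<kappa> > 0" and \<eta>: "0 < \<eta>" "\<eta> < 1" and low: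
    "\<And>w. weight w \<Longrightarrow> ennreal \<kappa> * (\<integral>\<^sup>+t\<in>{0<..<\<eta>}. weight_density w t \<partial>lborel)
       \<le> (\<integral>\<^sup>+x\<in>ball z \<epsilon>. hardy_density \<Omega> w R x \<partial>lborel)"
    by (rule hardy_density_lower_bound[OF o bd c \<epsilon> R]) blast
  have ge: "ennreal (\<epsilon> * \<kappa>) * (\<integral>\<^sup>+t\<in>{0<..<\<eta>}. weight_density (log_weight \<beta> m) t \<partial>lborel)
      \<le> hardy_integral \<Omega> R \<beta> m (\<lambda>x. b \<bullet> x)" for m
  proof -
    have w: "weight (log_weight \<beta> m)" by (rule weight_log_weight[OF \<beta>])
    have [measurable]: "hardy_density \<Omega> (log_weight \<beta> m) R \<in> borel_measurable borel"
      using R by (intro hardy_density_measurable w o bd) auto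
    have [measurable]: "ball z \<epsilon> \<in> sets borel" by simp
    have "ennreal (\<epsilon> * \<kappa>) * (\<integral>\<^sup>+t\<in>{0<..<\<eta>}. weight_density (log_weight \<beta> m) t \<partial>lborel)
      = ennreal \<epsilon> * (ennreal \<kappa> * (\<integral>\<^sup>+t\<in>{0<..<\<eta>}. weight_density (log_weight \<beta> m) t \<partial>lborel))"
      using \<epsilon> \<kappa> by (simp add: ennreal_mult mult.assoc)
    also have "\<dots> \<le> ennreal \<epsilon> * (\<integral>\<^sup>+x\<in>ball z \<epsilon>. hardy_density \<Omega> (log_weight \<beta> m) R x \<partial>lborel)"
      by (rule mult_left_mono[OF low[OF w]]) simp
    also have "\<dots> = (\<integral>\<^sup>+x. ennreal \<epsilon> * (hardy_density \<Omega> (log_weight \<beta> m) R x * indicator (ball z \<epsilon>) x) \<partial>lborel)"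
      by (intro nn_integral_cmult[symmetric]) measurable
    also have "\<dots> \<le> (\<integral>\<^sup>+x. ennreal \<bar>b \<bullet> x - a\<bar> * hardy_density \<Omega> (log_weight \<beta> m) R x \<partial>lborel)"
      using far by (intro nn_integral_mono) (auto simp: indicator_def intro!: mult_right_mono ennreal_leI)
    finally show ?thesis by (simp add: hardy_integral_eq[OF o] a_def)
  qed
  define summand where "summand = (\<lambda>m. ennreal (\<alpha> ^ (m + 2)) * hardy_integral \<Omega> R \<beta> (m + 2) (\<lambda>x. b \<bullet> x))"
  have part: "(\<Sum>m<n. summand m) \<le> hardy_series \<Omega> R \<beta> \<alpha> (\<lambda>x. b \<bullet> x)" for n
    unfolding hardy_series_def summand_def[symmetric] by (intro sum_le_suminf) auto
  show ?thesis
  proof (cases "\<beta> \<le> 1")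
    case True
    have "ennreal (\<epsilon> * \<kappa>) * top \<le> hardy_integral \<Omega> R \<beta> 2 (\<lambda>x. b \<bullet> x)"
      using ge[of 2] nn_integral_log_weight_near_0_eq_top[OF \<beta> True \<eta>] by simp
    then have "hardy_integral \<Omega> R \<beta> 2 (\<lambda>x. b \<bullet> x) = top" using \<epsilon> \<kappa> by (simp add: ennreal_mult_top top_unique)
    \<comment> \<open>Index 0 of the shifted series is m = 2.\<close>
    then have "summand 0 = top" using \<alpha> by (simp add: summand_def ennreal_mult_top numeral_2_eq_2)
    then show ?thesis using part[of 1] by (simp add: top_unique)
  next
    case False
    then have \<beta>1: "\<beta> > 1" and \<alpha>1: "\<alpha> \<ge> 1" using \<alpha>\<beta> by auto
    define d where "d = \<epsilon> * \<kappa> * ((\<eta> / 2) powr (\<beta> - 1) / 2 / (\<beta> - 1))"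
    have d: "d > 0" using \<epsilon> \<kappa> \<eta> \<beta>1 by (simp add: d_def)
    have dt: "ennreal d \<le> summand m" for m
    proof -
      have "ennreal d = ennreal (\<epsilon> * \<kappa>) * ennreal ((\<eta> / 2) powr (\<beta> - 1) / 2 / (\<beta> - 1))"
        unfolding d_def using \<epsilon> \<kappa> \<beta>1 by (intro ennreal_mult) auto
      also have "\<dots> \<le> ennreal (\<epsilon> * \<kappa>) * (\<integral>\<^sup>+t\<in>{0<..<\<eta>}. weight_density (log_weight \<beta> (m + 2)) t \<partial>lborel)"
        by (intro mult_left_mono nn_integral_log_weight_near_0_ge \<beta>1 \<eta>) auto
      also have "\<dots> \<le> hardy_integral \<Omega> R \<beta> (m + 2) (\<lambda>x. b \<bullet> x)" by (rule ge)
      also have "\<dots> = ennreal 1 * hardy_integral \<Omega> R \<beta> (m + 2) (\<lambda>x. b \<bullet> x)" by simp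
      also have "\<dots> \<le> summand m" unfolding summand_def
        using \<alpha>1 by (intro mult_right_mono ennreal_leI one_le_power) auto
      finally show ?thesis .
    qed
    have "(\<Sum>m<n. ennreal d) \<le> hardy_series \<Omega> R \<beta> \<alpha> (\<lambda>x. b \<bullet> x)" for n :: nat
    proof -
      have "(\<Sum>m<n. ennreal d) \<le> (\<Sum>m<n. summand m)" by (rule sum_mono) (rule dt)
      also note part
      finally show ?thesis .
    qed
    then have le: "ennreal (real n * d) \<le> hardy_series \<Omega> R \<beta> \<alpha> (\<lambda>x. b \<bullet> x)" for n
      using d by (simp add: ennreal_mult ennreal_of_nat_eq_real_of_nat)
    show ?thesis
    proof (rule ccontr)
      assume "hardy_series \<Omega> R \<beta> \<alpha> (\<lambda>x. b \<bullet> x) \<noteq> \<infinity>"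
      then obtain s where s: "s \<ge> 0" "hardy_series \<Omega> R \<beta> \<alpha> (\<lambda>x. b \<bullet> x) = ennreal s"
        by (cases "hardy_series \<Omega> R \<beta> \<alpha> (\<lambda>x. b \<bullet> x)") auto
      obtain n where "s < real n * d" using reals_Archimedean3[OF d] by blast
      moreover have "real n * d \<le> s" using le[of n] s by simp
      ultimately show False by simp
    qed
  qed
qed

theorem corollary1p1:
  fixes \<Omega> :: "'a::euclidean_space set"
  assumes "bounded_lipschitz_domain \<Omega>"
  shows
    "(\<forall>\<beta>>1. \<exists>C>0. \<forall>R>0. (\<forall>x\<in>\<Omega>. bdist \<Omega> x < R) \<longrightarrow>
        (\<forall>m\<ge>1. \<forall>u\<in>BV \<Omega>.
           hardy_integral \<Omega> R \<beta> m u \<le> ennreal (C * 2 ^ m) * bv_seminorm \<Omega> u)) \<and>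
     (\<forall>\<beta>>1. \<exists>C>0. \<forall>R>0. (\<forall>x\<in>\<Omega>. bdist \<Omega> x < R) \<longrightarrow>
        (\<forall>\<alpha>. 0 < \<alpha> \<and> \<alpha> < 1 / 2 \<longrightarrow> (\<forall>u\<in>BV \<Omega>.
           hardy_series \<Omega> R \<beta> \<alpha> u
             \<le> ennreal (C * (4 * \<alpha>\<^sup>2 / (1 - 2 * \<alpha>))) * bv_seminorm \<Omega> u))) \<and>
     (\<forall>R>0. (\<forall>x\<in>\<Omega>. bdist \<Omega> x < R) \<longrightarrow>
        (\<forall>\<alpha>>0. \<forall>\<beta>>0. \<alpha> \<ge> 1 \<or> \<beta> \<le> 1 \<longrightarrow>
           \<not> (\<exists>C'::real. \<forall>u\<in>BV \<Omega>.
                hardy_series \<Omega> R \<beta> \<alpha> u \<le> ennreal C' * bv_seminorm \<Omega> u)))"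
proof (intro conjI allI impI notI, goal_cases)
  case (1 \<beta>)
  then obtain C where C: "C > 0" and le: "\<And>R m u. R > 0 \<Longrightarrow> \<forall>x\<in>\<Omega>. bdist \<Omega> x < R \<Longrightarrow> m \<ge> 1 \<Longrightarrow> u \<in> BV \<Omega> \<Longrightarrow>
    hardy_integral \<Omega> R \<beta> m u \<le> ennreal C * bv_seminorm \<Omega> u"
    by (rule hardy_integral_le[OF assms]) blast
  \<comment> \<open>The constant is already uniform in m, so 1 <= 2^m gives the stated form.\<close>
  have "ennreal C * bv_seminorm \<Omega> u \<le> ennreal (C * 2 ^ m) * bv_seminorm \<Omega> u" for m u
    using C by (intro mult_right_mono ennreal_leI) auto
  then show ?case using C by (intro exI[of _ C]) (auto intro: order_trans[OF le])
next
  case (2 \<beta>)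
  then obtain C where C: "C > 0" and le: "\<And>R m u. R > 0 \<Longrightarrow> \<forall>x\<in>\<Omega>. bdist \<Omega> x < R \<Longrightarrow> m \<ge> 1 \<Longrightarrow> u \<in> BV \<Omega> \<Longrightarrow>
    hardy_integral \<Omega> R \<beta> m u \<le> ennreal C * bv_seminorm \<Omega> u"
    by (rule hardy_integral_le[OF assms]) blast
  show ?case
  proof (intro exI[of _ C] conjI C allI impI ballI)
    fix R \<alpha> :: real and u
    assume R: "R > 0" "\<forall>x\<in>\<Omega>. bdist \<Omega> x < R" and \<alpha>: "0 < \<alpha> \<and> \<alpha> < 1 / 2" and u: "u \<in> BV \<Omega>"
    \<comment> \<open>Summing with a constant uniform in m gives \<alpha>^2/(1 - \<alpha>), which is
      at most 4 \<alpha>^2/(1 - 2 \<alpha>) for 0 < \<alpha> < 1/2.\<close>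
    have "(\<lambda>m. \<alpha>\<^sup>2 * \<alpha> ^ m) sums (\<alpha>\<^sup>2 * (1 / (1 - \<alpha>)))"
      using \<alpha> by (intro sums_mult geometric_sums) auto
    moreover have "(\<lambda>m. \<alpha>\<^sup>2 * \<alpha> ^ m) = (\<lambda>m. \<alpha> ^ (m + 2))" by (simp only: power_add mult.commute)
    ultimately have sm: "(\<lambda>m. \<alpha> ^ (m + 2)) sums (\<alpha>\<^sup>2 / (1 - \<alpha>))" by simp
    have "hardy_series \<Omega> R \<beta> \<alpha> u \<le> (\<Sum>m. ennreal (\<alpha> ^ (m + 2)) * (ennreal C * bv_seminorm \<Omega> u))"
      unfolding hardy_series_def by (intro suminf_le mult_left_mono le R u) auto
    also have "\<dots> = (\<Sum>m. ennreal (\<alpha> ^ (m + 2))) * (ennreal C * bv_seminorm \<Omega> u)" by (rule ennreal_suminf_multc)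
    also have "(\<Sum>m. ennreal (\<alpha> ^ (m + 2))) = ennreal (\<alpha>\<^sup>2 / (1 - \<alpha>))"
      using sm \<alpha> by (intro suminf_ennreal_eq) auto
    also have "ennreal (\<alpha>\<^sup>2 / (1 - \<alpha>)) * (ennreal C * bv_seminorm \<Omega> u) = ennreal (C * (\<alpha>\<^sup>2 / (1 - \<alpha>))) * bv_seminorm \<Omega> u"
    proof -
      have "ennreal (C * (\<alpha>\<^sup>2 / (1 - \<alpha>))) = ennreal C * ennreal (\<alpha>\<^sup>2 / (1 - \<alpha>))"
        using C \<alpha> by (intro ennreal_mult) auto
      then show ?thesis by (simp only: mult_ac)
    qed
    also have "\<dots> \<le> ennreal (C * (4 * \<alpha>\<^sup>2 / (1 - 2 * \<alpha>))) * bv_seminorm \<Omega> u"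
    proof -
      have "\<alpha>\<^sup>2 / (1 - \<alpha>) \<le> 4 * \<alpha>\<^sup>2 / (1 - 2 * \<alpha>)" using \<alpha> by (intro frac_le) auto
      then show ?thesis using C by (intro mult_right_mono ennreal_leI mult_left_mono) auto
    qed
    finally show "hardy_series \<Omega> R \<beta> \<alpha> u \<le> ennreal (C * (4 * \<alpha>\<^sup>2 / (1 - 2 * \<alpha>))) * bv_seminorm \<Omega> u" .
  qed
next
  case (3 R \<alpha> \<beta>)
  then obtain C' where C': "\<And>u. u \<in> BV \<Omega> \<Longrightarrow> hardy_series \<Omega> R \<beta> \<alpha> u \<le> ennreal C' * bv_seminorm \<Omega> u" by blast
  obtain b :: 'a where b: "norm b = 1" using norm_Basis nonempty_Basis by blast
  have u: "(\<lambda>x. b \<bullet> x) \<in> BV \<Omega>"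
    using assms by (intro linear_function_in_BV) (auto simp: bounded_lipschitz_domain_def)
  \<comment> \<open>The right-hand side is finite for every real C'; \<open>ennreal\<close> sends a
    negative one to 0.\<close>
  then have "ennreal C' * bv_seminorm \<Omega> (\<lambda>x. b \<bullet> x) < \<infinity>" by (auto simp: BV_def ennreal_mult_less_top)
  moreover have "hardy_series \<Omega> R \<beta> \<alpha> (\<lambda>x. b \<bullet> x) = \<infinity>"
    using assms 3(1-5) b by (rule hardy_series_linear_eq_top)
  ultimately show False using C'[OF u] by simp
qed

end
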